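(* Let $V_1,V_2:\mathbb{R}^d\to\mathbb{R}$ satisfy: $V_1\ge0$, $V_1(x)\to\infty$ as $|x|\to\infty$, $V_1\in L^\infty_{\mathrm{loc}}(\mathbb{R}^d)$, and $V_2\in L^\infty(\mathbb{R}^d)$. Consider the family of domains $\Omega_L=[-L,L]^d$, $L>0$, with conforming finite element subspaces $X_h\subset H^1_0(\Omega_L)$, and the preconditioned operators $T_{h,L}=(-\Delta_h+V_{1,h})^{-1}(-\Delta_h+V_{1,h}+V_{2,h})$ on $X_h$ defined in the context. Then for every $\epsilon>0$, there exist at most $M(\epsilon)$ eigenvalues of $T_{h,L}$ outside $(1-\epsilon,1+\epsilon)$, where $M(\epsilon)<\infty$ is independent of both $h$ and $L$. Moreover, if $-\Delta+V_1+V_2>0$ on $\mathbb{R}^d$, then $\kappa(T_{h,L})$ is bounded independently of both $h$ and $L$.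
   Context: All function spaces are real. For each $L>0$, $X_h\subset H^1_0(\Omega_L)$ is a (finite-dimensional) conforming finite element space with mesh parameter $h>0$, and $H^1_0(\Omega_L)$ carries the inner product $$\langle u,v\rangle_A=\int_{\Omega_L}(\nabla u\cdot\nabla v+V_1uv)\,\mathrm{d}\boldsymbol{x}.$$ The Galerkin operators on $X_h$ are defined by $((-\Delta_h+V_{1,h})u_h,v_h)_{L^2}=\langle u_h,v_h\rangle_A$ and $((-\Delta_h+V_{1,h}+V_{2,h})u_h,v_h)_{L^2}=\langle u_h,v_h\rangle_A+\int_{\Omega_L}V_2u_hv_h\,\mathrm{d}\boldsymbol{x}$ for all $u_h,v_h\in X_h$. Equivalently, $T_{h,L}=I_h+K_{h,L}$, where $I_h$ is the identity on $X_h$ and $K_{h,L}:X_h\to X_h$ is given by $\langle K_{h,L}u_h,v_h\rangle_A=\int_{\Omega_L}V_2u_hv_h\,\mathrm{d}\boldsymbol{x}$ for all $u_h,v_h\in X_h$; $T_{h,L}$ is self-adjoint with respect to $\langle\cdot,\cdot\rangle_A$. Eigenvalues are counted with multiplicity. The condition $-\Delta+V_1+V_2>0$ on $\mathbb{R}^d$ means $\int_{\mathbb{R}^d}(|\nabla u|^2+(V_1+V_2)u^2)\,\mathrm{d}\boldsymbol{x}>0$ for all $0\ne u\in H^1(\mathbb{R}^d)$ with $\int_{\mathbb{R}^d}V_1u^2\,\mathrm{d}\boldsymbol{x}<\infty$. In that case $T_{h,L}$ is positive and $\kappa(T_{h,L})=\mu_{\max}(T_{h,L})/\mu_{\min}(T_{h,L})$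 is the ratio of its largest to its smallest eigenvalue. *)

theory Defs
  imports "HOL-Analysis.Analysis"
begin

text \<open>
  Subspaces, dimensions and eigenvectors only make sense for functions identified
  up to null sets, so the function spaces below live in this quotient. A function on a
  measurable set \<open>\<Omega>\<close> is represented by its extension by zero.
\<close>

definition ae_equal :: "(real^'d \<Rightarrow> real) \<Rightarrow> (real^'d \<Rightarrow> real) \<Rightarrow> bool" where
  "ae_equal f g \<longleftrightarrow> f \<in> borel_measurable lebesgue \<and> g \<in> borel_measurable lebesgue
                   \<and> (AE x in lebesgue. f x = g x)"

lemma part_equivp_ae_equal: "part_equivp ae_equal"
proof (rule part_equivpI)
  show "\<exists>f::real^'d \<Rightarrow> real. ae_equal f f"
    by (rule exI[of _ "\<lambda>_. 0"]) (simp add: ae_equal_def)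
  show "symp (ae_equal :: (real^'d \<Rightarrow> real) \<Rightarrow> _)"
    by (auto intro!: sympI simp: ae_equal_def eq_commute)
  show "transp (ae_equal :: (real^'d \<Rightarrow> real) \<Rightarrow> _)"
    by (rule transpI) (auto simp: ae_equal_def elim: AE_mp)
qed

quotient_type 'd ae_fun = "real^'d \<Rightarrow> real" / partial: ae_equal
  morphisms ae_rep ae_class
  by (rule part_equivp_ae_equal)

instantiation ae_fun :: (finite) real_vector
begin

lift_definition zero_ae_fun :: "'a ae_fun" is "\<lambda>_. 0"
  by (simp add: ae_equal_def)

lift_definition plus_ae_fun :: "'a ae_fun \<Rightarrow> 'a ae_fun \<Rightarrow> 'a ae_fun" is "\<lambda>f g x. f x + g x"
  by (auto simp: ae_equal_def)

lift_definition uminus_ae_fun :: "'a ae_fun \<Rightarrow> 'a ae_fun" is "\<lambda>f x. - f x"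
  by (auto simp: ae_equal_def)

lift_definition minus_ae_fun :: "'a ae_fun \<Rightarrow> 'a ae_fun \<Rightarrow> 'a ae_fun" is "\<lambda>f g x. f x - g x"
  by (auto simp: ae_equal_def)

lift_definition scaleR_ae_fun :: "real \<Rightarrow> 'a ae_fun \<Rightarrow> 'a ae_fun" is "\<lambda>c f x. c * f x"
  by (auto simp: ae_equal_def)

instance
  by standard (transfer; auto simp: ae_equal_def algebra_simps)+

end

definition Linf :: "(real^'d \<Rightarrow> real) \<Rightarrow> bool" where
  "Linf V \<longleftrightarrow> V \<in> borel_measurable lebesgue \<and> (\<exists>C. AE x in lebesgue. \<bar>V x\<bar> \<le> C)"

definition Linf_loc :: "(real^'d \<Rightarrow> real) \<Rightarrow> bool" where
  "Linf_loc V \<longleftrightarrow> V \<in> borel_measurable lebesgue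
     \<and> (\<forall>K. compact K \<longrightarrow> (\<exists>C. AE x in lebesgue. x \<in> K \<longrightarrow> \<bar>V x\<bar> \<le> C))"

definition L2_on :: "(real^'d) set \<Rightarrow> (real^'d \<Rightarrow> 'b::euclidean_space) \<Rightarrow> bool" where
  "L2_on \<Omega> f \<longleftrightarrow> set_borel_measurable lebesgue \<Omega> f
                  \<and> set_integrable lebesgue \<Omega> (\<lambda>x. (norm (f x))\<^sup>2)"

definition partial_deriv :: "'d \<Rightarrow> (real^'d \<Rightarrow> real) \<Rightarrow> real^'d \<Rightarrow> real" where
  "partial_deriv i \<phi> x = frechet_derivative \<phi> (at x) (axis i 1)"

definition classical_grad :: "(real^'d \<Rightarrow> real) \<Rightarrow> real^'d \<Rightarrow> real^'d" where
  "classical_grad \<phi> x = (\<chi> i. partial_deriv i \<phi> x)"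

primrec C_k :: "nat \<Rightarrow> (real^'d \<Rightarrow> real) \<Rightarrow> bool" where
  "C_k 0 \<phi> \<longleftrightarrow> continuous_on UNIV \<phi>"
| "C_k (Suc k) \<phi> \<longleftrightarrow> (\<forall>x. \<phi> differentiable at x) \<and> (\<forall>i. C_k k (partial_deriv i \<phi>))"

text \<open>The test functions of the interior of \<open>\<Omega>\<close>. The boundaries of the sets \<open>\<Omega>\<close> considered here
  are null sets, so it is immaterial whether integrals run over \<open>\<Omega>\<close> or its interior.\<close>

definition test_functions :: "(real^'d) set \<Rightarrow> (real^'d \<Rightarrow> real) set" where
  "test_functions \<Omega> = {\<phi>. (\<forall>k. C_k k \<phi>) \<and> compact (closure {x. \<phi> x \<noteq> 0})
                          \<and> closure {x. \<phi> x \<noteq> 0} \<subseteq> interior \<Omega>}"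

definition is_weak_grad ::
    "(real^'d) set \<Rightarrow> (real^'d \<Rightarrow> real) \<Rightarrow> (real^'d \<Rightarrow> real^'d) \<Rightarrow> bool" where
  "is_weak_grad \<Omega> u G \<longleftrightarrow> L2_on \<Omega> G \<and>
     (\<forall>\<phi>\<in>test_functions \<Omega>. \<forall>i.
        (LINT x:\<Omega>|lebesgue. u x * partial_deriv i \<phi> x) = - (LINT x:\<Omega>|lebesgue. G x $ i * \<phi> x))"

definition H1 :: "(real^'d) set \<Rightarrow> 'd ae_fun set" where
  "H1 \<Omega> = {u. (AE x in lebesgue. x \<notin> \<Omega> \<longrightarrow> ae_rep u x = 0)
              \<and> L2_on \<Omega> (ae_rep u) \<and> (\<exists>G. is_weak_grad \<Omega> (ae_rep u) G)}"

text \<open>A representative of the weak gradient, determined almost everywhere on \<open>\<Omega>\<close> if \<open>u \<in> H1 \<Omega>\<close>.\<close>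

definition weak_grad :: "(real^'d) set \<Rightarrow> 'd ae_fun \<Rightarrow> real^'d \<Rightarrow> real^'d" where
  "weak_grad \<Omega> u = (SOME G. is_weak_grad \<Omega> (ae_rep u) G)"

definition H1_0 :: "(real^'d) set \<Rightarrow> 'd ae_fun set" where
  "H1_0 \<Omega> = {u \<in> H1 \<Omega>. \<exists>\<phi>. (\<forall>n::nat. \<phi> n \<in> test_functions \<Omega>) \<and>
     (\<lambda>n. LINT x:\<Omega>|lebesgue. (ae_rep u x - \<phi> n x)\<^sup>2
            + (norm (weak_grad \<Omega> u x - classical_grad (\<phi> n) x))\<^sup>2) \<longlonglongrightarrow> 0}"

definition cube :: "real \<Rightarrow> (real^'d) set" where
  "cube L = {x. \<forall>i. x $ i \<in> {-L..L}}"

definition L2_inner :: "(real^'d) set \<Rightarrow> 'd ae_fun \<Rightarrow> 'd ae_fun \<Rightarrow> real" where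
  "L2_inner \<Omega> u v = (LINT x:\<Omega>|lebesgue. ae_rep u x * ae_rep v x)"

definition A_inner ::
    "(real^'d) set \<Rightarrow> (real^'d \<Rightarrow> real) \<Rightarrow> 'd ae_fun \<Rightarrow> 'd ae_fun \<Rightarrow> real" where
  "A_inner \<Omega> V1 u v =
     (LINT x:\<Omega>|lebesgue. weak_grad \<Omega> u x \<bullet> weak_grad \<Omega> v x + V1 x * ae_rep u x * ae_rep v x)"

definition V_form ::
    "(real^'d) set \<Rightarrow> (real^'d \<Rightarrow> real) \<Rightarrow> 'd ae_fun \<Rightarrow> 'd ae_fun \<Rightarrow> real" where
  "V_form \<Omega> V2 u v = (LINT x:\<Omega>|lebesgue. V2 x * ae_rep u x * ae_rep v x)"

definition conforming_space :: "(real^'d) set \<Rightarrow> 'd ae_fun set \<Rightarrow> bool" where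
  "conforming_space \<Omega> X \<longleftrightarrow> X \<subseteq> H1_0 \<Omega> \<and> (\<exists>B. finite B \<and> X = span B)"

definition galerkin_op ::
    "(real^'d) set \<Rightarrow> 'd ae_fun set \<Rightarrow> ('d ae_fun \<Rightarrow> 'd ae_fun \<Rightarrow> real)
      \<Rightarrow> 'd ae_fun \<Rightarrow> 'd ae_fun" where
  "galerkin_op \<Omega> X a u = (THE w. w \<in> X \<and> (\<forall>v\<in>X. L2_inner \<Omega> w v = a u v))"

definition precond_op ::
    "(real^'d) set \<Rightarrow> (real^'d \<Rightarrow> real) \<Rightarrow> (real^'d \<Rightarrow> real) \<Rightarrow> 'd ae_fun set
      \<Rightarrow> 'd ae_fun \<Rightarrow> 'd ae_fun" where
  "precond_op \<Omega> V1 V2 X =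
     inv_into X (galerkin_op \<Omega> X (A_inner \<Omega> V1))
     \<circ> galerkin_op \<Omega> X (\<lambda>u v. A_inner \<Omega> V1 u v + V_form \<Omega> V2 u v)"

definition eigenspace :: "'v::real_vector set \<Rightarrow> ('v \<Rightarrow> 'v) \<Rightarrow> real \<Rightarrow> 'v set" where
  "eigenspace X T \<mu> = {u \<in> X. T u = \<mu> *\<^sub>R u}"

definition eigenvalues :: "'v::real_vector set \<Rightarrow> ('v \<Rightarrow> 'v) \<Rightarrow> real set" where
  "eigenvalues X T = {\<mu>. \<exists>u\<in>eigenspace X T \<mu>. u \<noteq> 0}"

text \<open>For operators that are self-adjoint in some inner product, as here, geometric and
  algebraic multiplicities agree.\<close>

definition eigenvalue_count :: "'v::real_vector set \<Rightarrow> ('v \<Rightarrow> 'v) \<Rightarrow> real set \<Rightarrow> nat" where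
  "eigenvalue_count X T S = (\<Sum>\<mu>\<in>eigenvalues X T \<inter> S. dim (eigenspace X T \<mu>))"

definition mu_max :: "'v::real_vector set \<Rightarrow> ('v \<Rightarrow> 'v) \<Rightarrow> real" where
  "mu_max X T = Max (eigenvalues X T)"

definition mu_min :: "'v::real_vector set \<Rightarrow> ('v \<Rightarrow> 'v) \<Rightarrow> real" where
  "mu_min X T = Min (eigenvalues X T)"

definition condition_number :: "'v::real_vector set \<Rightarrow> ('v \<Rightarrow> 'v) \<Rightarrow> real" where
  "condition_number X T = mu_max X T / mu_min X T"

text \<open>For \<open>V1 \<ge> 0\<close> measurable, integrability of \<open>V1 u\<^sup>2\<close> says that its integral is finite.\<close>

definition schroedinger_positive :: "(real^'d \<Rightarrow> real) \<Rightarrow> (real^'d \<Rightarrow> real) \<Rightarrow> bool" where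
  "schroedinger_positive V1 V2 \<longleftrightarrow>
     (\<forall>u\<in>H1 UNIV. u \<noteq> 0 \<longrightarrow> integrable lebesgue (\<lambda>x. V1 x * (ae_rep u x)\<^sup>2) \<longrightarrow>
        (LINT x|lebesgue. (norm (weak_grad UNIV u x))\<^sup>2 + (V1 x + V2 x) * (ae_rep u x)\<^sup>2) > 0)"

end

theory Submission
  imports Defs
begin

text \<open>
  Write \<open>a(u,w) = \<integral> \<nabla>u \<bullet> \<nabla>w + V1 u w\<close> and \<open>v(u,w) = \<integral> V2 u w\<close>. The \<open>L\<^sup>2\<close> inner product in which both
  Galerkin operators are defined cancels in \<open>T\<close>: a vector \<open>u \<in> X\<close> satisfies \<open>T u = \<mu> u\<close> if and only if
  \<open>v(u,w) = (\<mu> - 1) a(u,w)\<close> for all \<open>w \<in> X\<close> (\<open>precond_op_eigen_iff\<close>). Extension by zero places every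
  conforming space, for every \<open>L\<close> and \<open>h\<close>, inside one space \<open>W\<close>, the functions of \<open>H\<^sup>1\<^sub>0(\<real>\<^sup>d)\<close> for which
  \<open>\<integral> V1 u\<^sup>2\<close> is finite, and the forms \<open>a\<close> and \<open>v\<close> on \<open>W\<close> know nothing of \<open>L\<close> and \<open>h\<close>
  (\<open>conforming_pencil\<close>). Both claims are therefore about arbitrary finite-dimensional subspaces of
  \<open>W\<close>, and uniformity is automatic.

  The analytic input is that \<open>W\<close> embeds compactly into \<open>L\<^sup>2\<close>, in the following quantitative form
  (\<open>finite_rank_L2_bound\<close>): for every \<open>\<delta> > 0\<close> there are finitely many linear functionals \<open>l\<^sub>k\<close> with
  \<open>\<integral> u\<^sup>2 \<le> \<delta> a(u,u) + \<Sum>\<^sub>k l\<^sub>k(u)\<^sup>2\<close> on \<open>W\<close>. Far from the origin \<open>V1 \<ge> 1/\<delta>\<close> takes care of the mass of \<open>u\<close>;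
  near the origin the \<open>l\<^sub>k\<close> are normalized means over the cells of a fine grid, and the gradient
  controls the deviation from these means (\<open>grid_Poincare\<close>).

  Counting eigenvalues: if the eigenvectors with \<open>\<mu> \<ge> 1 + \<epsilon>\<close> spanned a space of dimension larger than
  the number of functionals, some \<open>u \<noteq> 0\<close> in it would be annihilated by all of them, and then
  \<open>\<epsilon> a(u,u) \<le> v(u,u) \<le> C \<integral> u\<^sup>2 \<le> C \<delta> a(u,u)\<close>, which is absurd for small \<open>\<delta>\<close>. The same holds below
  \<open>1 - \<epsilon>\<close> (\<open>eigenvalue_count_le\<close>).

  Condition number: every eigenvalue is a value of the Rayleigh quotient \<open>q/a\<close> with \<open>q = a + v\<close>, which
  is bounded above because \<open>\<integral> u\<^sup>2 \<le> P a(u,u)\<close> (\<open>Poincare\<close>). By hypothesis \<open>q > 0\<close> on \<open>W\<close> apart from \<open>0\<close>, and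
  \<open>positive_form_coercive\<close> improves this to \<open>q \<ge> c a\<close>. Otherwise there are \<open>u\<^sub>n\<close> with \<open>a(u\<^sub>n,u\<^sub>n) = 1\<close> and
  \<open>q(u\<^sub>n,u\<^sub>n) \<rightarrow> 0\<close>. One fixed small \<open>\<delta>\<close> gives \<open>a \<le> 2 q + D \<Sum>\<^sub>k l\<^sub>k\<^sup>2\<close>; on a subsequence all \<open>l\<^sub>k(u\<^sub>n)\<close> converge, and
  \<open>q(u\<^sub>m - u\<^sub>n) \<le> 2 q(u\<^sub>m) + 2 q(u\<^sub>n)\<close> by the parallelogram identity, so that the subsequence is Cauchy
  with respect to \<open>a\<close>. It converges in \<open>W\<close> (\<open>form_domain_complete\<close>), and its limit has \<open>a = 1\<close> and \<open>q = 0\<close>.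

  Since \<open>weak_grad\<close> selects some weak gradient, all of this rests on the uniqueness of weak gradients
  on \<open>\<real>\<^sup>d\<close>, that is, on the fundamental lemma of the calculus of variations.
\<close>

section \<open>Symmetric forms and finite-dimensional eigenvalue problems\<close>

lemma bounded_sequences_common_subsequence:
  fixes f :: "'k \<Rightarrow> nat \<Rightarrow> real"
  assumes "finite K" "\<And>k. k \<in> K \<Longrightarrow> bounded (range (f k))"
  shows "\<exists>r::nat\<Rightarrow>nat. strict_mono r \<and> (\<forall>k\<in>K. convergent (\<lambda>n. f k (r n)))"
  using assms
proof (induction K rule: finite_induct)
  case empty
  show ?case by (auto intro!: exI[of _ id] strict_mono_id)
next
  case (insert k K)
  then obtain r where r: "strict_mono r" "\<forall>k\<in>K. convergent (\<lambda>n. f k (r n))" by auto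
  have "bounded (range (f k))" using insert by simp
  then have "bounded (range (\<lambda>n. f k (r n)))"
    by (rule bounded_subset) auto
  then obtain l s where s: "strict_mono s" "((\<lambda>n. f k (r n)) \<circ> s) \<longlonglongrightarrow> l"
    using bounded_imp_convergent_subsequence by blast
  have "strict_mono (r \<circ> s)" using r s by (auto intro: strict_mono_o)
  moreover have "convergent (\<lambda>n. f j ((r \<circ> s) n))" if "j \<in> insert k K" for j
  proof (cases "j = k")
    case True
    then show ?thesis using s(2) by (auto simp: convergent_def o_def)
  next
    case False
    then have "convergent (\<lambda>n. f j (r n))" using that r by auto
    then have "convergent ((\<lambda>n. f j (r n)) \<circ> s)" using s(1) convergent_subseq_convergent by blast
    then show ?thesis by (simp add: o_def)
  qed
  ultimately show ?case by blast
qed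

text \<open>Gaussian elimination: a pivot \<open>p\<close> with \<open>m k p \<noteq> 0\<close> removes the equation \<open>k\<close> and the unknown \<open>p\<close>.\<close>
lemma homogeneous_system_nontrivial_solution:
  fixes m :: "'k \<Rightarrow> 'b \<Rightarrow> real"
  assumes "finite K" "finite B" "card K < card B"
  shows "\<exists>c. (\<exists>b\<in>B. c b \<noteq> 0) \<and> (\<forall>k\<in>K. (\<Sum>b\<in>B. c b * m k b) = 0)"
  using assms
proof (induction K arbitrary: B m rule: finite_induct)
  case empty
  then obtain b where "b \<in> B" by fastforce
  then show ?case by (auto intro!: exI[of _ "\<lambda>_. 1"])
next
  case (insert k K)
  show ?case
  proof (cases "\<forall>b\<in>B. m k b = 0")
    case True
    have "card K < card B" using insert by simp
    then obtain c where "\<exists>b\<in>B. c b \<noteq> 0" "\<forall>k\<in>K. (\<Sum>b\<in>B. c b * m k b) = 0"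
      using insert.IH[OF insert.prems(1)] by blast
    then show ?thesis using True by (intro exI[of _ c]) auto
  next
    case False
    then obtain p where p: "p \<in> B" "m k p \<noteq> 0" by blast
    define m' where "m' = (\<lambda>j b. m j b - m j p * m k b / m k p)"
    have "card K < card (B - {p})"
      using insert p by (simp add: card_Diff_singleton)
    then obtain c where c: "\<exists>b\<in>B - {p}. c b \<noteq> 0" "\<forall>j\<in>K. (\<Sum>b\<in>B - {p}. c b * m' j b) = 0"
      using insert.IH[of "B - {p}" m'] insert.prems(1) by auto
    define d where "d = (\<lambda>b. if b = p then - (\<Sum>b\<in>B - {p}. c b * m k b) / m k p else c b)"
    have split: "(\<Sum>b\<in>B. d b * m j b) = d p * m j p + (\<Sum>b\<in>B - {p}. c b * m j b)" for j
    proof -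
      have "(\<Sum>b\<in>B. d b * m j b) = d p * m j p + (\<Sum>b\<in>B - {p}. d b * m j b)"
        using sum.remove[OF insert.prems(1) p(1)] by blast
      also have "(\<Sum>b\<in>B - {p}. d b * m j b) = (\<Sum>b\<in>B - {p}. c b * m j b)"
        by (rule sum.cong) (auto simp: d_def)
      finally show ?thesis .
    qed
    have "(\<Sum>b\<in>B. d b * m j b) = 0" if "j \<in> insert k K" for j
    proof (cases "j = k")
      case True
      then show ?thesis unfolding split using p by (simp add: d_def)
    next
      case False
      then have "(\<Sum>b\<in>B - {p}. c b * m' j b) = 0" using c that by auto
      then have "(\<Sum>b\<in>B - {p}. c b * m j b) = (m j p / m k p) * (\<Sum>b\<in>B - {p}. c b * m k b)"
        by (simp add: m'_def right_diff_distrib sum_subtractf sum_distrib_left mult_ac)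
      then show ?thesis unfolding split by (simp add: d_def)
    qed
    moreover have "\<exists>b\<in>B. d b \<noteq> 0" using c by (auto simp: d_def)
    ultimately show ?thesis by blast
  qed
qed

definition linear_functional_on :: "'v::real_vector set \<Rightarrow> ('v \<Rightarrow> real) \<Rightarrow> bool" where
  "linear_functional_on X f \<longleftrightarrow> (\<forall>u\<in>X. \<forall>v\<in>X. f (u + v) = f u + f v)
                              \<and> (\<forall>c. \<forall>u\<in>X. f (c *\<^sub>R u) = c * f u)"

lemma linear_functional_on_sum:
  assumes "linear_functional_on X f" "subspace X" "finite S" "S \<subseteq> X"
  shows "f (\<Sum>e\<in>S. c e *\<^sub>R e) = (\<Sum>e\<in>S. c e * f e)"
  using assms(3,4)
proof (induction S rule: finite_induct)
  case empty
  have "f (0 *\<^sub>R 0) = 0 * f 0"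
    using assms(1) subspace_0[OF assms(2)] unfolding linear_functional_on_def by blast
  then show ?case by simp
next
  case (insert e S)
  have "(\<Sum>e\<in>S. c e *\<^sub>R e) \<in> X"
    using insert assms(2) by (auto intro!: subspace_sum subspace_scale)
  moreover have "c e *\<^sub>R e \<in> X" using insert assms(2) by (auto intro!: subspace_scale)
  ultimately show ?case using insert assms(1) by (simp add: linear_functional_on_def)
qed

lemma linear_functional_on_diff:
  assumes "linear_functional_on X f" "subspace X" "u \<in> X" "v \<in> X"
  shows "f (u - v) = f u - f v"
proof -
  have "(-1) *\<^sub>R v \<in> X" using assms subspace_scale by blast
  then have "f (u + (-1) *\<^sub>R v) = f u + f ((-1) *\<^sub>R v)" and "f ((-1) *\<^sub>R v) = (-1) * f v"
    using assms unfolding linear_functional_on_def by blast+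
  then show ?thesis by simp
qed

lemma discriminant_le:
  fixes A B C :: real
  assumes "\<And>t. 0 \<le> A - 2 * t * B + t\<^sup>2 * C" and "0 \<le> C"
  shows "B\<^sup>2 \<le> A * C"
proof (cases "C = 0")
  case True
  have "B = 0"
  proof (rule ccontr)
    assume "B \<noteq> 0"
    then show False using assms(1)[of "(A + 1) / (2 * B)"] True by (simp add: field_simps)
  qed
  then show ?thesis using True by simp
next
  case False
  then have "C > 0" using assms(2) by simp
  then show ?thesis using assms(1)[of "B / C"] by (simp add: field_simps power2_eq_square)
qed

text \<open>The forms of interest are bilinear only on the subspaces where their integrals converge, so the
  algebraic laws are relativized to a carrier \<open>X\<close>.\<close>
locale sym_form =
  fixes X :: "'v::real_vector set" and a :: "'v \<Rightarrow> 'v \<Rightarrow> real"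
  assumes subspace: "subspace X"
    and commute: "u \<in> X \<Longrightarrow> v \<in> X \<Longrightarrow> a u v = a v u"
    and add_left: "u \<in> X \<Longrightarrow> v \<in> X \<Longrightarrow> w \<in> X \<Longrightarrow> a (u + v) w = a u w + a v w"
    and scale_left: "u \<in> X \<Longrightarrow> v \<in> X \<Longrightarrow> a (c *\<^sub>R u) v = c * a u v"
begin

lemma add_right: "u \<in> X \<Longrightarrow> v \<in> X \<Longrightarrow> w \<in> X \<Longrightarrow> a w (u + v) = a w u + a w v"
  by (metis add_left commute subspace subspace_add)

lemma scale_right: "u \<in> X \<Longrightarrow> v \<in> X \<Longrightarrow> a v (c *\<^sub>R u) = c * a v u"
  by (metis scale_left commute subspace subspace_scale)

lemma diff_left: "u \<in> X \<Longrightarrow> v \<in> X \<Longrightarrow> w \<in> X \<Longrightarrow> a (u - v) w = a u w - a v w"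
  using add_left[of "u - v" v w] subspace subspace_diff by fastforce

lemma diff_right: "u \<in> X \<Longrightarrow> v \<in> X \<Longrightarrow> w \<in> X \<Longrightarrow> a w (u - v) = a w u - a w v"
  by (metis diff_left commute subspace subspace_diff)

lemma linear_functional: "v \<in> X \<Longrightarrow> linear_functional_on X (\<lambda>u. a u v)"
  by (auto simp: linear_functional_on_def add_left scale_left)

lemma quadratic_diff:
  "u \<in> X \<Longrightarrow> v \<in> X \<Longrightarrow> a (u - v) (u - v) = a u u - 2 * a u v + a v v"
  using subspace_diff[OF subspace, of u v] by (simp add: diff_left diff_right commute)

lemma quadratic_scale: "u \<in> X \<Longrightarrow> a (c *\<^sub>R u) (c *\<^sub>R u) = c\<^sup>2 * a u u"
  using subspace_scale[OF subspace, of u c] by (simp add: scale_left scale_right power2_eq_square)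

lemma zero_left: "v \<in> X \<Longrightarrow> a 0 v = 0"
  using scale_left[of 0 v 0] subspace_0[OF subspace] by simp

lemma sum_left:
  "finite S \<Longrightarrow> S \<subseteq> X \<Longrightarrow> v \<in> X \<Longrightarrow> a (\<Sum>e\<in>S. c e *\<^sub>R e) v = (\<Sum>e\<in>S. c e * a e v)"
  using linear_functional_on_sum[OF linear_functional subspace] .

lemma sum_right:
  "finite S \<Longrightarrow> S \<subseteq> X \<Longrightarrow> v \<in> X \<Longrightarrow> a v (\<Sum>e\<in>S. c e *\<^sub>R e) = (\<Sum>e\<in>S. c e * a v e)"
  using sum_left[of S v c] subspace_sum[OF subspace, of S "\<lambda>e. c e *\<^sub>R e"] subspace_scale[OF subspace]
  by (simp add: commute[of v] subset_iff)

definition orthonormal :: "'v set \<Rightarrow> bool" where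
  "orthonormal S \<longleftrightarrow> S \<subseteq> X \<and> (\<forall>e\<in>S. \<forall>f\<in>S. a e f = (if e = f then 1 else 0))"

lemma orthonormal_sum_left:
  assumes "orthonormal S" "finite S" "f \<in> S"
  shows "a (\<Sum>e\<in>S. c e *\<^sub>R e) f = c f"
proof -
  have "a (\<Sum>e\<in>S. c e *\<^sub>R e) f = (\<Sum>e\<in>S. c e * a e f)"
    using assms by (intro sum_left) (auto simp: orthonormal_def)
  also have "\<dots> = (\<Sum>e\<in>S. if e = f then c f else 0)"
    using assms by (intro sum.cong) (auto simp: orthonormal_def)
  finally show ?thesis using assms by simp
qed

lemma orthonormal_quadratic_sum:
  assumes "orthonormal S" "finite S"
  shows "a (\<Sum>e\<in>S. c e *\<^sub>R e) (\<Sum>e\<in>S. c e *\<^sub>R e) = (\<Sum>e\<in>S. (c e)\<^sup>2)"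
proof -
  have "(\<Sum>e\<in>S. c e *\<^sub>R e) \<in> X"
    using assms by (auto simp: orthonormal_def intro!: subspace_sum subspace_scale subspace)
  then have "a (\<Sum>e\<in>S. c e *\<^sub>R e) (\<Sum>e\<in>S. c e *\<^sub>R e)
      = (\<Sum>e\<in>S. c e * a (\<Sum>e\<in>S. c e *\<^sub>R e) e)"
    using assms by (intro sum_right) (auto simp: orthonormal_def)
  also have "\<dots> = (\<Sum>e\<in>S. (c e)\<^sup>2)"
    using orthonormal_sum_left[OF assms, of _ c] by (intro sum.cong) (auto simp: power2_eq_square)
  finally show ?thesis .
qed

lemma orthonormal_independent:
  assumes "orthonormal S" "finite S"
  shows "independent S"
proof
  assume "dependent S"
  then obtain c e where c: "e \<in> S" "c e \<noteq> 0" "(\<Sum>e\<in>S. c e *\<^sub>R e) = 0"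
    using dependent_finite[OF assms(2)] by auto
  then show False
    using orthonormal_sum_left[OF assms c(1), of c] zero_left[of e] assms(1)
    by (auto simp: orthonormal_def)
qed

lemma nonneg_Cauchy_Schwarz:
  assumes nonneg: "\<And>u. u \<in> X \<Longrightarrow> 0 \<le> a u u" and "u \<in> X" "v \<in> X"
  shows "(a u v)\<^sup>2 \<le> a u u * a v v"
proof (rule discriminant_le)
  fix t
  have "0 \<le> a (u - t *\<^sub>R v) (u - t *\<^sub>R v)"
    using assms by (intro nonneg subspace_diff subspace subspace_scale)
  also have "\<dots> = a u u - 2 * t * a u v + t\<^sup>2 * a v v"
    using assms subspace_scale[OF subspace]
    by (subst quadratic_diff) (auto simp: scale_left scale_right power2_eq_square)
  finally show "0 \<le> a u u - 2 * t * a u v + t\<^sup>2 * a v v" .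
qed (rule nonneg[OF assms(3)])

lemma nonneg_diff_le:
  assumes nonneg: "\<And>u. u \<in> X \<Longrightarrow> 0 \<le> a u u" and "u \<in> X" "v \<in> X"
  shows "a (u - v) (u - v) \<le> 2 * a u u + 2 * a v v"
proof -
  have "0 \<le> a (u + v) (u + v)" using assms subspace_add[OF subspace] by blast
  also have "\<dots> = a u u + 2 * a u v + a v v"
    using assms subspace_add[OF subspace, of u v] by (simp add: add_left add_right commute)
  finally show ?thesis using assms by (simp add: quadratic_diff)
qed

text \<open>Convergence in a seminorm implies convergence of the seminorms. It is applied both to \<open>a\<close> and to
  \<open>a + v\<close>.\<close>
lemma nonneg_tendsto:
  assumes nonneg: "\<And>u. u \<in> X \<Longrightarrow> 0 \<le> a u u"
    and "\<And>n. u n \<in> X" "w \<in> X" and lim: "(\<lambda>n. a (u n - w) (u n - w)) \<longlonglongrightarrow> 0"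
  shows "(\<lambda>n. a (u n) (u n)) \<longlonglongrightarrow> a w w"
proof -
  have "(\<lambda>n. a (u n - w) w) \<longlonglongrightarrow> 0"
  proof (rule Lim_null_comparison)
    show "\<forall>\<^sub>F n in sequentially. norm (a (u n - w) w) \<le> sqrt (a (u n - w) (u n - w) * a w w)"
      using nonneg_Cauchy_Schwarz[OF nonneg] assms subspace_diff[OF subspace]
      by (auto intro!: always_eventually real_le_rsqrt)
    show "(\<lambda>n. sqrt (a (u n - w) (u n - w) * a w w)) \<longlonglongrightarrow> 0"
      using tendsto_real_sqrt[OF tendsto_mult[OF lim tendsto_const[of "a w w"]]] by simp
  qed
  then have "(\<lambda>n. a (u n - w) (u n - w) + 2 * a (u n - w) w + a w w) \<longlonglongrightarrow> 0 + 2 * 0 + a w w"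
    by (intro tendsto_intros lim)
  moreover have "a (u n - w) (u n - w) + 2 * a (u n - w) w + a w w = a (u n) (u n)" for n
    using assms by (simp add: quadratic_diff diff_left)
  ultimately show ?thesis by simp
qed

end

lemma sym_form_sum:
  assumes "sym_form X a" "sym_form X b"
  shows "sym_form X (\<lambda>u v. a u v + b u v)"
proof -
  interpret A: sym_form X a by fact
  interpret B: sym_form X b by fact
  show ?thesis
    by unfold_locales
      (auto simp: A.subspace A.commute B.commute A.add_left B.add_left A.scale_left B.scale_left
        algebra_simps)
qed

lemma sym_form_scale:
  assumes "sym_form X a"
  shows "sym_form X (\<lambda>u v. c * a u v)"
proof -
  interpret A: sym_form X a by fact
  show ?thesis
    by unfold_locales (auto simp: A.subspace A.commute A.add_left A.scale_left algebra_simps)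
qed

lemma sym_form_subset:
  assumes "sym_form W a" "subspace X" "X \<subseteq> W"
  shows "sym_form X a"
proof -
  interpret A: sym_form W a by fact
  show ?thesis
    using assms(2,3) by unfold_locales (auto simp: A.commute A.add_left A.scale_left subset_iff)
qed

locale inner_form = sym_form +
  assumes pos: "u \<in> X \<Longrightarrow> u \<noteq> 0 \<Longrightarrow> 0 < a u u"
begin

lemma nonneg: "u \<in> X \<Longrightarrow> 0 \<le> a u u"
  using pos[of u] zero_left[of 0] by (cases "u = 0") (auto intro: less_imp_le)

lemma eq_zero: "u \<in> X \<Longrightarrow> a u u = 0 \<Longrightarrow> u = 0"
  using pos by force

lemma eqI:
  assumes "u \<in> X" "w \<in> X" "\<And>v. v \<in> X \<Longrightarrow> a u v = a w v"
  shows "u = w"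
proof -
  have "u - w \<in> X" using assms subspace_diff[OF subspace] by blast
  then show ?thesis using assms eq_zero[of "u - w"] by (simp add: diff_left)
qed

lemma Gram_Schmidt:
  assumes "finite B" "B \<subseteq> X"
  shows "\<exists>E. finite E \<and> orthonormal E \<and> span E = span B"
  using assms
proof (induction B rule: finite_induct)
  case empty
  then show ?case by (intro exI[of _ "{}"]) (auto simp: orthonormal_def)
next
  case (insert b B)
  then obtain E where E: "finite E" "orthonormal E" "span E = span B" by auto
  have EX: "E \<subseteq> X" using E by (simp add: orthonormal_def)
  define p where "p = (\<Sum>e\<in>E. a b e *\<^sub>R e)"
  have p: "p \<in> span E" unfolding p_def by (intro span_sum span_scale span_base)
  have bX: "b \<in> X" and pX: "p \<in> X"
    using insert EX p span_minimal[OF EX subspace] by auto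
  have orth: "a (b - p) e = 0" if "e \<in> E" for e
    using orthonormal_sum_left[OF E(2,1) that, of "\<lambda>e. a b e"] bX pX EX that
    by (auto simp: diff_left p_def[symmetric] subset_iff)
  show ?case
  proof (cases "b = p")
    case True
    then have "span (insert b B) = span E" using p E
      by (metis span_redundant)
    then show ?thesis using E by auto
  next
    case False
    define q where "q = (1 / sqrt (a (b - p) (b - p))) *\<^sub>R (b - p)"
    have bpX: "b - p \<in> X" using bX pX subspace subspace_diff by blast
    have pos': "a (b - p) (b - p) > 0" using False bpX pos by simp
    have qX: "q \<in> X" unfolding q_def using bpX subspace subspace_scale by blast
    have qq: "a q q = 1"
      using pos' bpX unfolding q_def quadratic_scale[OF bpX] by (simp add: power_divide)
    have qe: "a q e = 0" if "e \<in> E" for e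
      using orth[OF that] bpX EX that unfolding q_def by (auto simp: scale_left)
    have eq: "a e q = 0" if "e \<in> E" for e
      using qe[OF that] commute[of e q] that EX qX by auto
    have "orthonormal (insert q E)"
      using E qX qq qe eq by (auto simp: orthonormal_def)
    moreover have "span (insert q E) = span (insert b B)"
    proof -
      have "b = sqrt (a (b - p) (b - p)) *\<^sub>R q + p" using pos' by (simp add: q_def)
      moreover have "q \<in> span (insert q E)" "p \<in> span (insert q E)"
        using p span_mono[of E "insert q E"] by (auto intro: span_base)
      ultimately have "b \<in> span (insert q E)" by (metis span_add span_scale)
      moreover have "q \<in> span (insert b E)"
        unfolding q_def using p span_mono[of E "insert b E"]
        by (intro span_scale span_diff) (auto intro: span_base)
      ultimately have "span (insert q E) = span (insert b E)"
        using span_mono[of E "insert q E"] span_mono[of E "insert b E"]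
        by (intro antisym span_minimal) (auto intro: span_base)
      also have "\<dots> = span (insert b B)"
        using E(3) by (simp add: span_insert)
      finally show ?thesis .
    qed
    ultimately show ?thesis using E by blast
  qed
qed

lemma subspace_orthonormal_basis:
  assumes "finite B" "X = span B" "subspace Y" "Y \<subseteq> X"
  obtains E where "finite E" "orthonormal E" "span E = Y" "card E = dim Y"
proof -
  obtain D where D: "D \<subseteq> Y" "independent D" "Y \<subseteq> span D" "card D = dim Y"
    using basis_exists by blast
  have "finite D" using independent_span_bound[OF assms(1) D(2)] D assms by auto
  moreover have "D \<subseteq> X" using D assms by auto
  ultimately obtain E where E: "finite E" "orthonormal E" "span E = span D"
    using Gram_Schmidt by blast
  have "span D = Y" using D assms(3) by (simp add: span_subspace)
  then have "card E = dim Y"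
    using E orthonormal_independent[OF E(2,1)] by (metis dim_eq_card_independent dim_span)
  then show ?thesis using that E \<open>span D = Y\<close> by simp
qed

lemma Riesz_representation:
  assumes "finite B" "X = span B" "linear_functional_on X f"
  shows "\<exists>w\<in>X. \<forall>v\<in>X. a w v = f v"
proof -
  obtain E where E: "finite E" "orthonormal E" "span E = X"
    by (rule subspace_orthonormal_basis[OF assms(1,2) subspace order_refl])
  have EX: "E \<subseteq> X" using E by (simp add: orthonormal_def)
  define w where "w = (\<Sum>e\<in>E. f e *\<^sub>R e)"
  have wX: "w \<in> X"
    unfolding w_def using EX by (intro subspace_sum subspace subspace_scale) auto
  have "a w v = f v" if "v \<in> X" for v
  proof -
    have "v \<in> span E" using that E by simp
    then obtain c where v: "v = (\<Sum>e\<in>E. c e *\<^sub>R e)"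
      using span_finite[OF E(1)] by auto
    have "a w v = (\<Sum>e\<in>E. c e * a w e)"
      unfolding v by (rule sum_right[OF E(1) EX wX])
    also have "\<dots> = (\<Sum>e\<in>E. c e * f e)"
      using orthonormal_sum_left[OF E(2,1), of _ f] by (intro sum.cong) (auto simp: w_def)
    also have "\<dots> = f v"
      unfolding v by (rule linear_functional_on_sum[OF assms(3) subspace E(1) EX, symmetric])
    finally show ?thesis .
  qed
  then show ?thesis using wX by (intro bexI[of _ w]) auto
qed

end

text \<open>The eigenvalue problem of \<open>a + v\<close> relative to \<open>a\<close>. The operator \<open>T\<close> enters through its
  eigenvalue equation on \<open>X\<close>.\<close>
locale pencil = inner_form X a + V: sym_form X v for X :: "'v::real_vector set" and a v +
  fixes T :: "'v \<Rightarrow> 'v" and B :: "'v set"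
  assumes finite_B: "finite B" and span_B: "X = span B"
    and eigen_iff: "u \<in> X \<Longrightarrow> T u = \<mu> *\<^sub>R u \<longleftrightarrow> (\<forall>w\<in>X. a u w + v u w = \<mu> * a u w)"
begin

lemma mem_eigenspace:
  "u \<in> eigenspace X T \<mu> \<longleftrightarrow> u \<in> X \<and> (\<forall>w\<in>X. v u w = (\<mu> - 1) * a u w)"
  unfolding eigenspace_def using eigen_iff by (auto simp: algebra_simps)

lemma subspace_eigenspace: "subspace (eigenspace X T \<mu>)"
  using subspace_0[OF subspace] subspace_add[OF subspace] subspace_scale[OF subspace]
  by (auto intro!: subspaceI simp: mem_eigenspace add_left V.add_left scale_left V.scale_left
      zero_left V.zero_left ring_distribs mult.left_commute)

lemma eigenspaces_orthogonal:
  assumes "u \<in> eigenspace X T \<mu>" "w \<in> eigenspace X T \<nu>" "\<mu> \<noteq> \<nu>"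
  shows "a u w = 0"
proof -
  have "(\<mu> - 1) * a u w = v u w" "(\<nu> - 1) * a w u = v w u" "u \<in> X" "w \<in> X"
    using assms by (auto simp: mem_eigenspace)
  then have "(\<mu> - 1) * a u w = (\<nu> - 1) * a u w"
    using commute[of u w] V.commute[of u w] by simp
  then show ?thesis using assms(3) by simp
qed

text \<open>Multiplicities become the cardinality of one orthonormal set, because eigenspaces of different
  eigenvalues are orthogonal.\<close>
lemma eigenvectors_orthonormal_system:
  assumes "finite F"
  obtains S where "finite S" "orthonormal S" "card S = (\<Sum>\<mu>\<in>F. dim (eigenspace X T \<mu>))"
    "\<And>e. e \<in> S \<Longrightarrow> \<exists>\<mu>\<in>F. e \<in> eigenspace X T \<mu>"
proof -
  have "\<exists>E. finite E \<and> orthonormal E \<and> span E = eigenspace X T \<mu>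
      \<and> card E = dim (eigenspace X T \<mu>)" for \<mu>
    by (rule subspace_orthonormal_basis[OF finite_B span_B subspace_eigenspace[of \<mu>]])
       (auto simp: mem_eigenspace)
  then obtain E where E: "\<And>\<mu>. finite (E \<mu>)" "\<And>\<mu>. orthonormal (E \<mu>)"
    "\<And>\<mu>. span (E \<mu>) = eigenspace X T \<mu>" "\<And>\<mu>. card (E \<mu>) = dim (eigenspace X T \<mu>)"
    by metis
  have sub: "e \<in> eigenspace X T \<mu>" if "e \<in> E \<mu>" for e \<mu>
    using that E(3)[of \<mu>] span_base by auto
  have one: "a e e = 1" if "e \<in> E \<mu>" for e \<mu>
    using that E(2)[of \<mu>] by (auto simp: orthonormal_def)
  have disj: "E \<mu> \<inter> E \<nu> = {}" if "\<mu> \<noteq> \<nu>" for \<mu> \<nu>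
  proof (rule ccontr)
    assume "\<not> ?thesis"
    then obtain e where "e \<in> E \<mu>" "e \<in> E \<nu>" by auto
    then show False
      using one[of e \<mu>] eigenspaces_orthogonal[OF sub sub that] by fastforce
  qed
  show ?thesis
  proof (rule that[of "\<Union>\<mu>\<in>F. E \<mu>"])
    show "finite (\<Union>\<mu>\<in>F. E \<mu>)" using assms E(1) by auto
    show "card (\<Union>\<mu>\<in>F. E \<mu>) = (\<Sum>\<mu>\<in>F. dim (eigenspace X T \<mu>))"
      using assms E(1,4) disj by (subst card_UN_disjoint) auto
    show "\<exists>\<mu>\<in>F. e \<in> eigenspace X T \<mu>" if "e \<in> (\<Union>\<mu>\<in>F. E \<mu>)" for e
      using that sub by blast
    have "a e f = (if e = f then 1 else 0)"
      if "e \<in> E \<mu>" "f \<in> E \<nu>" for e f \<mu> \<nu>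
    proof (cases "\<mu> = \<nu>")
      case True
      then show ?thesis using that E(2)[of \<mu>] by (simp add: orthonormal_def)
    next
      case False
      then show ?thesis
        using that disj[OF False] eigenspaces_orthogonal[OF sub sub False, of e f] by auto
    qed
    then show "orthonormal (\<Union>\<mu>\<in>F. E \<mu>)"
      using E(2) unfolding orthonormal_def by blast
  qed
qed

lemma dim_eigenspace_pos:
  assumes "\<mu> \<in> eigenvalues X T"
  shows "0 < dim (eigenspace X T \<mu>)"
proof -
  obtain u where u: "u \<in> eigenspace X T \<mu>" "u \<noteq> 0"
    using assms by (auto simp: eigenvalues_def)
  obtain E where "finite E" "span E = eigenspace X T \<mu>" "card E = dim (eigenspace X T \<mu>)"
    by (rule subspace_orthonormal_basis[OF finite_B span_B subspace_eigenspace[of \<mu>]])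
       (auto simp: mem_eigenspace)
  then show ?thesis using u by (cases "E = {}") (auto simp: card_gt_0_iff)
qed

lemma finite_eigenvalues: "finite (eigenvalues X T)"
proof (rule ccontr)
  assume "infinite (eigenvalues X T)"
  then obtain F where F: "F \<subseteq> eigenvalues X T" "finite F" "card F = Suc (card B)"
    using infinite_arbitrarily_large by blast
  obtain S where S: "finite S" "orthonormal S" "card S = (\<Sum>\<mu>\<in>F. dim (eigenspace X T \<mu>))"
    by (rule eigenvectors_orthonormal_system[OF F(2)])
  have "card F \<le> (\<Sum>\<mu>\<in>F. dim (eigenspace X T \<mu>))"
    using sum_mono[of F "\<lambda>_. 1::nat" "\<lambda>\<mu>. dim (eigenspace X T \<mu>)"] F(1) dim_eigenspace_pos
    by (auto simp: Suc_le_eq)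
  moreover have "card S \<le> card B"
    using independent_span_bound[OF finite_B orthonormal_independent[OF S(2,1)]] S(2)
    unfolding span_B[symmetric] orthonormal_def by simp
  ultimately show False using S F by simp
qed

text \<open>With more eigenvectors than functionals, some nontrivial combination of the eigenvectors is
  annihilated by all functionals, although on the span of eigenvectors on one side of \<open>1\<close> (the side is
  the sign \<open>s\<close>) the form \<open>s v\<close> is at least \<open>\<epsilon> a\<close>. The two sides have to be separated, as the
  contributions of both would cancel in \<open>v u u\<close>.\<close>
lemma eigenvalue_count_one_sided:
  assumes "finite K" "\<And>k. k \<in> K \<Longrightarrow> linear_functional_on X (l k)"
    and small: "\<And>u. u \<in> X \<Longrightarrow> u \<noteq> 0 \<Longrightarrow> (\<And>k. k \<in> K \<Longrightarrow> l k u = 0) \<Longrightarrow> \<bar>v u u\<bar> < \<epsilon> * a u u"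
    and side: "(\<And>\<mu>. \<mu> \<in> F \<Longrightarrow> \<epsilon> \<le> s * (\<mu> - 1))" "\<bar>s\<bar> = 1"
    and "finite F"
  shows "(\<Sum>\<mu>\<in>F. dim (eigenspace X T \<mu>)) \<le> card K"
proof (rule ccontr)
  assume less: "\<not> ?thesis"
  obtain S where S: "finite S" "orthonormal S" "card S = (\<Sum>\<mu>\<in>F. dim (eigenspace X T \<mu>))"
    "\<And>e. e \<in> S \<Longrightarrow> \<exists>\<mu>\<in>F. e \<in> eigenspace X T \<mu>"
    by (rule eigenvectors_orthonormal_system[OF \<open>finite F\<close>]) blast
  have SX: "S \<subseteq> X" using S by (simp add: orthonormal_def)
  obtain c where c: "\<exists>e\<in>S. c e \<noteq> 0" "\<And>k. k \<in> K \<Longrightarrow> (\<Sum>e\<in>S. c e * l k e) = 0"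
    using homogeneous_system_nontrivial_solution[OF assms(1) S(1), of l] less S(3) by auto
  define u where "u = (\<Sum>e\<in>S. c e *\<^sub>R e)"
  have uX: "u \<in> X" unfolding u_def using SX by (intro subspace_sum subspace subspace_scale) auto
  have auu: "a u u = (\<Sum>e\<in>S. (c e)\<^sup>2)"
    unfolding u_def by (rule orthonormal_quadratic_sum[OF S(2,1)])
  have "a u u > 0"
    unfolding auu using c(1) S(1) by (auto intro!: sum_pos2)
  then have "u \<noteq> 0" using zero_left[OF uX] by auto
  have "\<bar>v u u\<bar> < \<epsilon> * a u u"
    using uX \<open>u \<noteq> 0\<close> c(2) assms(2) SX
    by (intro small) (auto simp: u_def linear_functional_on_sum[OF _ subspace S(1)])
  moreover have "\<epsilon> * a u u \<le> s * v u u"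
  proof -
    obtain ev where lam: "\<And>e. e \<in> S \<Longrightarrow> ev e \<in> F \<and> e \<in> eigenspace X T (ev e)"
      using S(4) by metis
    have "v u u = (\<Sum>e\<in>S. c e * v e u)"
      using V.sum_left[OF S(1) SX uX] by (simp add: u_def)
    also have "\<dots> = (\<Sum>e\<in>S. (ev e - 1) * (c e)\<^sup>2)"
    proof (rule sum.cong)
      fix e assume e: "e \<in> S"
      have "v e u = (ev e - 1) * a e u" using lam[OF e] uX by (simp add: mem_eigenspace)
      also have "a e u = c e"
        using orthonormal_sum_left[OF S(2,1) e, of c] commute[of e u] e SX uX by (auto simp: u_def)
      finally show "c e * v e u = (ev e - 1) * (c e)\<^sup>2" by (simp add: power2_eq_square)
    qed simp
    finally have "s * v u u = (\<Sum>e\<in>S. (s * (ev e - 1)) * (c e)\<^sup>2)"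
      by (simp add: sum_distrib_left mult_ac)
    also have "\<dots> \<ge> (\<Sum>e\<in>S. \<epsilon> * (c e)\<^sup>2)"
      using lam side(1) by (intro sum_mono mult_right_mono) auto
    finally show ?thesis by (simp add: auu sum_distrib_left)
  qed
  moreover have "s * v u u \<le> \<bar>v u u\<bar>"
    using side(2) abs_ge_self[of "s * v u u"] by (simp add: abs_mult)
  ultimately show False by simp
qed

lemma eigenvalue_count_le:
  assumes "finite K" "\<And>k. k \<in> K \<Longrightarrow> linear_functional_on X (l k)"
    and small: "\<And>u. u \<in> X \<Longrightarrow> u \<noteq> 0 \<Longrightarrow> (\<And>k. k \<in> K \<Longrightarrow> l k u = 0) \<Longrightarrow> \<bar>v u u\<bar> < \<epsilon> * a u u"
    and "\<epsilon> > 0"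
  shows "eigenvalue_count X T (- {1 - \<epsilon><..<1 + \<epsilon>}) \<le> 2 * card K"
proof -
  let ?d = "\<lambda>\<mu>. dim (eigenspace X T \<mu>)"
  let ?P = "eigenvalues X T \<inter> {1 + \<epsilon>..}" and ?N = "eigenvalues X T \<inter> {..1 - \<epsilon>}"
  have "eigenvalues X T \<inter> - {1 - \<epsilon><..<1 + \<epsilon>} = ?P \<union> ?N" by auto
  moreover have "?P \<inter> ?N = {}" using \<open>\<epsilon> > 0\<close> by auto
  ultimately have "eigenvalue_count X T (- {1 - \<epsilon><..<1 + \<epsilon>}) = sum ?d ?P + sum ?d ?N"
    unfolding eigenvalue_count_def using finite_eigenvalues by (simp add: sum.union_disjoint)
  moreover have "sum ?d ?P \<le> card K"
    by (rule eigenvalue_count_one_sided[OF assms(1,2) small, where s = 1])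
       (auto simp: finite_eigenvalues)
  moreover have "sum ?d ?N \<le> card K"
    by (rule eigenvalue_count_one_sided[OF assms(1,2) small, where s = "-1"])
       (auto simp: finite_eigenvalues)
  ultimately show ?thesis by simp
qed

text \<open>The minimum of the Rayleigh quotient over the unit sphere of \<open>a\<close> is attained, by compactness in
  orthonormal coordinates, and a minimizer is an eigenvector.\<close>
lemma eigenvalue_exists:
  assumes "X \<noteq> {0}" and bdd: "\<And>u. u \<in> X \<Longrightarrow> 0 \<le> a u u + v u u"
  shows "eigenvalues X T \<noteq> {}"
proof -
  obtain E where E: "finite E" "orthonormal E" "span E = X"
    by (rule subspace_orthonormal_basis[OF finite_B span_B subspace order_refl])
  have EX: "E \<subseteq> X" using E by (simp add: orthonormal_def)
  interpret Q: sym_form X "\<lambda>u w. a u w + v u w"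
    by (rule sym_form_sum) (unfold_locales)
  let ?Q = "\<lambda>u w. a u w + v u w"
  define R where "R = (\<lambda>u. ?Q u u) ` {u \<in> X. a u u = 1}"
  have "E \<noteq> {}" using E assms(1) by auto
  then have "R \<noteq> {}" using E(2) by (auto simp: R_def orthonormal_def)
  have below: "bdd_below R" unfolding R_def using bdd by (intro bdd_belowI2[of _ 0]) blast
  define m where "m = Inf R"
  have ge: "m * a u u \<le> ?Q u u" if "u \<in> X" for u
  proof (cases "u = 0")
    case True
    then show ?thesis using zero_left[OF that] V.zero_left[OF that] by simp
  next
    case False
    then have pos': "a u u > 0" using pos that by blast
    define w where "w = (1 / sqrt (a u u)) *\<^sub>R u"
    have "w \<in> X" using that subspace_scale[OF subspace] by (simp add: w_def)
    have "a w w = 1" using pos' that by (simp add: w_def quadratic_scale power_divide)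
    moreover have "?Q w w = ?Q u u / a u u"
      using pos' Q.quadratic_scale[OF that, of "1 / sqrt (a u u)"]
      by (simp add: w_def power_divide)
    ultimately have "?Q u u / a u u \<in> R" using \<open>w \<in> X\<close> by (auto simp: R_def intro!: image_eqI[of _ _ w])
    then have "m \<le> ?Q u u / a u u" unfolding m_def using below by (rule cInf_lower)
    then show ?thesis using pos' by (simp add: field_simps)
  qed
  have "\<exists>u. u \<in> X \<and> a u u = 1 \<and> ?Q u u < m + inverse (real (Suc n))" for n
  proof -
    have "Inf R < m + inverse (real (Suc n))" by (simp add: m_def)
    then obtain r where "r \<in> R" "r < m + inverse (real (Suc n))"
      using cInf_lessD[OF \<open>R \<noteq> {}\<close>] by blast
    then show ?thesis by (auto simp: R_def)
  qed
  then obtain u where u: "\<And>n. u n \<in> X" "\<And>n. a (u n) (u n) = 1"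
      "\<And>n. ?Q (u n) (u n) < m + inverse (real (Suc n))"
    by metis
  have "\<exists>c. u n = (\<Sum>e\<in>E. c e *\<^sub>R e)" for n
    using u(1)[of n] E(3) span_finite[OF E(1)] by auto
  then obtain c where c: "\<And>n. u n = (\<Sum>e\<in>E. c n e *\<^sub>R e)" by metis
  have sq: "(\<Sum>e\<in>E. (c n e)\<^sup>2) = 1" for n
    using orthonormal_quadratic_sum[OF E(2,1), of "c n"] u(2)[of n] c[of n] by simp
  have "bounded (range (\<lambda>n. c n e))" if "e \<in> E" for e
  proof -
    have "(c n e)\<^sup>2 \<le> 1" for n
      using member_le_sum[OF that _ E(1), of "\<lambda>e. (c n e)\<^sup>2"] sq[of n] by simp
    then have "\<bar>c n e\<bar> \<le> 1" for n
      by (simp add: abs_square_le_1)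
    then show ?thesis by (auto simp: bounded_iff)
  qed
  then obtain r :: "nat \<Rightarrow> nat" where r: "strict_mono r" "\<forall>e\<in>E. convergent (\<lambda>n. c (r n) e)"
    using bounded_sequences_common_subsequence[OF E(1), of "\<lambda>e n. c n e"] by blast
  then obtain d where d: "\<And>e. e \<in> E \<Longrightarrow> (\<lambda>n. c (r n) e) \<longlonglongrightarrow> d e"
    unfolding convergent_def by metis
  define w where "w = (\<Sum>e\<in>E. d e *\<^sub>R e)"
  have wX: "w \<in> X" unfolding w_def using EX by (intro subspace_sum subspace subspace_scale) auto
  have "(\<lambda>n. \<Sum>e\<in>E. (c (r n) e)\<^sup>2) \<longlonglongrightarrow> (\<Sum>e\<in>E. (d e)\<^sup>2)"
    by (intro tendsto_intros d)
  then have "(\<Sum>e\<in>E. (d e)\<^sup>2) = 1"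
    using sq LIMSEQ_unique[OF _ tendsto_const[of 1]] by fastforce
  then have ww: "a w w = 1" using orthonormal_quadratic_sum[OF E(2,1), of d] by (simp add: w_def)
  have Qexp: "?Q (\<Sum>e\<in>E. x e *\<^sub>R e) (\<Sum>e\<in>E. x e *\<^sub>R e) = (\<Sum>e\<in>E. x e * (\<Sum>f\<in>E. x f * ?Q e f))" for x
  proof -
    have xX: "(\<Sum>e\<in>E. x e *\<^sub>R e) \<in> X" using EX by (intro subspace_sum subspace subspace_scale) auto
    show ?thesis
      by (subst Q.sum_left[OF E(1) EX xX]) (intro sum.cong refl arg_cong2[where f = "(*)"]
          Q.sum_right[OF E(1) EX] subsetD[OF EX])
  qed
  have "(\<lambda>n. ?Q (u (r n)) (u (r n))) \<longlonglongrightarrow> ?Q w w"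
    unfolding c w_def Qexp by (intro tendsto_intros d)
  moreover have "(\<lambda>n. m + inverse (real (Suc (r n)))) \<longlonglongrightarrow> m + 0"
    using LIMSEQ_subseq_LIMSEQ[OF LIMSEQ_inverse_real_of_nat r(1)]
    by (intro tendsto_intros) (simp add: o_def)
  ultimately have "?Q w w \<le> m + 0"
    using u(3) by (intro LIMSEQ_le) (auto intro: less_imp_le)
  \<comment> \<open>The form \<open>D\<close> is nonnegative and vanishes at \<open>w\<close>, so the Cauchy-Schwarz inequality makes \<open>w\<close>
    orthogonal to everything with respect to \<open>D\<close>; this is the eigenvalue equation.\<close>
  interpret D: sym_form X "\<lambda>u w. ?Q u w + (- m) * a u w"
    by (intro sym_form_sum sym_form_scale) (unfold_locales)
  have Dww: "?Q w w + (- m) * a w w = 0" using ge[OF wX] \<open>?Q w w \<le> m + 0\<close> ww by simp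
  have "a w z + v w z = m * a w z" if "z \<in> X" for z
    using D.nonneg_Cauchy_Schwarz[OF _ wX that] ge Dww by simp
  then have "w \<in> eigenspace X T m" using wX by (simp add: mem_eigenspace algebra_simps)
  moreover have "w \<noteq> 0" using ww zero_left[OF wX] by auto
  ultimately show ?thesis by (auto simp: eigenvalues_def)
qed

lemma eigenvalue_Rayleigh:
  assumes "\<mu> \<in> eigenvalues X T"
  obtains u where "u \<in> X" "u \<noteq> 0" "a u u > 0" "a u u + v u u = \<mu> * a u u"
  using assms pos by (auto simp: eigenvalues_def mem_eigenspace algebra_simps)

lemma condition_number_le:
  assumes "X \<noteq> {0}" "0 < c" 
    and lower: "\<And>u. u \<in> X \<Longrightarrow> c * a u u \<le> a u u + v u u"
    and upper: "\<And>u. u \<in> X \<Longrightarrow> a u u + v u u \<le> C * a u u"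
  shows "mu_min X T > 0 \<and> condition_number X T \<le> C / c"
proof -
  have ne: "eigenvalues X T \<noteq> {}"
    using lower nonneg \<open>0 < c\<close> by (intro eigenvalue_exists assms(1)) (smt (verit) mult_nonneg_nonneg)
  have bnd: "c \<le> \<mu> \<and> \<mu> \<le> C" if mu: "\<mu> \<in> eigenvalues X T" for \<mu>
  proof -
    obtain u where u: "u \<in> X" "a u u > 0" "a u u + v u u = \<mu> * a u u"
      using eigenvalue_Rayleigh[OF mu] by blast
    then have "c * a u u \<le> \<mu> * a u u" "\<mu> * a u u \<le> C * a u u"
      using lower[OF u(1)] upper[OF u(1)] by simp_all
    then show ?thesis using u(2) by simp
  qed
  have "mu_min X T \<in> eigenvalues X T" "mu_max X T \<in> eigenvalues X T"
    unfolding mu_min_def mu_max_def using ne finite_eigenvalues by auto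
  then have "c \<le> mu_min X T" "mu_max X T \<le> C" "c \<le> mu_max X T" using bnd by auto
  then show ?thesis
    unfolding condition_number_def using \<open>0 < c\<close> by (auto intro!: frac_le)
qed

end

text \<open>A positive form \<open>a + v\<close> is bounded below by a multiple of \<open>a\<close>, provided that it controls \<open>a\<close> up to
  finitely many bounded functionals. A minimizing sequence of the Rayleigh quotient on which these
  functionals converge is a Cauchy sequence, and its limit would violate positivity.\<close>
lemma positive_form_coercive:
  assumes "inner_form W a" "sym_form W v"
    and bound: "\<And>u. u \<in> W \<Longrightarrow> \<bar>v u u\<bar> \<le> C * a u u"
    and complete: "\<And>u. (\<And>n. u n \<in> W) \<Longrightarrow>
          (\<And>e. e > 0 \<Longrightarrow> \<exists>N. \<forall>m\<ge>N. \<forall>n\<ge>N. a (u m - u n) (u m - u n) < e) \<Longrightarrow>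
          \<exists>w\<in>W. (\<lambda>n. a (u n - w) (u n - w)) \<longlonglongrightarrow> 0"
    and positive: "\<And>u. u \<in> W \<Longrightarrow> u \<noteq> 0 \<Longrightarrow> 0 < a u u + v u u"
    and "finite K" and functional: "\<And>k. k \<in> K \<Longrightarrow> linear_functional_on W (l k)"
    and functional_bound: "\<And>k u. k \<in> K \<Longrightarrow> u \<in> W \<Longrightarrow> (l k u)\<^sup>2 \<le> M * a u u"
    and Garding: "\<And>u. u \<in> W \<Longrightarrow> a u u \<le> 2 * (a u u + v u u) + D * (\<Sum>k\<in>K. (l k u)\<^sup>2)"
  shows "\<exists>c>0. \<forall>u\<in>W. c * a u u \<le> a u u + v u u"
proof (rule ccontr)
  assume neg: "\<not> ?thesis"
  interpret inner_form W a by fact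
  interpret V: sym_form W v by fact
  let ?Q = "\<lambda>u w. a u w + v u w"
  interpret Q: sym_form W ?Q by (rule sym_form_sum) (unfold_locales)
  have Qnonneg: "0 \<le> ?Q u u" if "u \<in> W" for u
    using positive[OF that] zero_left[of 0] V.zero_left[of 0] that by (cases "u = 0") auto
  have "\<exists>u. u \<in> W \<and> a u u = 1 \<and> ?Q u u < inverse (real (Suc n))" for n
  proof -
    obtain u where u: "u \<in> W" "\<not> inverse (real (Suc n)) * a u u \<le> ?Q u u"
      using neg by (metis inverse_positive_iff_positive of_nat_0_less_iff zero_less_Suc)
    then have "u \<noteq> 0" using zero_left[of u] V.zero_left[of u] by auto
    then have pos': "a u u > 0" using pos u by blast
    define w where "w = (1 / sqrt (a u u)) *\<^sub>R u"
    have "w \<in> W" using u subspace_scale[OF subspace] by (simp add: w_def)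
    moreover have "a w w = 1" using pos' u by (simp add: w_def quadratic_scale power_divide)
    moreover have "?Q w w = ?Q u u / a u u"
      using pos' Q.quadratic_scale[OF u(1), of "1 / sqrt (a u u)"]
      by (simp add: w_def power_divide)
    moreover have "?Q u u / a u u < inverse (real (Suc n))"
      using u(2) pos' by (simp add: divide_less_eq)
    ultimately show ?thesis by auto
  qed
  then obtain u where u: "\<And>n. u n \<in> W" "\<And>n. a (u n) (u n) = 1"
      "\<And>n. ?Q (u n) (u n) < inverse (real (Suc n))"
    by metis
  have "bounded (range (\<lambda>n. l k (u n)))" if "k \<in> K" for k
  proof -
    have "(l k (u n))\<^sup>2 \<le> M" for n using functional_bound[OF that u(1)[of n]] u(2) by simp
    then have "\<bar>l k (u n)\<bar> \<le> sqrt M" for n using real_le_rsqrt[of "\<bar>l k (u n)\<bar>" M] by simp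
    then show ?thesis by (auto simp: bounded_iff)
  qed
  then obtain r :: "nat \<Rightarrow> nat" where r: "strict_mono r" "\<forall>k\<in>K. convergent (\<lambda>n. l k (u (r n)))"
    using bounded_sequences_common_subsequence[OF \<open>finite K\<close>, of "\<lambda>k n. l k (u n)"] by blast
  then obtain y where y: "\<And>k. k \<in> K \<Longrightarrow> (\<lambda>n. l k (u (r n))) \<longlonglongrightarrow> y k"
    unfolding convergent_def by metis
  define w where "w = (\<lambda>n. u (r n))"
  have wW: "w n \<in> W" for n using u by (simp add: w_def)
  have Qw: "(\<lambda>n. ?Q (w n) (w n)) \<longlonglongrightarrow> 0"
  proof (rule tendsto_sandwich[of "\<lambda>_. 0" _ _ "\<lambda>n. inverse (real (Suc (r n)))"])
    show "(\<lambda>n. inverse (real (Suc (r n)))) \<longlonglongrightarrow> 0"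
      using LIMSEQ_subseq_LIMSEQ[OF LIMSEQ_inverse_real_of_nat r(1)] by (simp add: o_def)
    show "\<forall>\<^sub>F n in sequentially. 0 \<le> ?Q (w n) (w n)"
      using Qnonneg[OF wW] by simp
    show "\<forall>\<^sub>F n in sequentially. ?Q (w n) (w n) \<le> inverse (real (Suc (r n)))"
      using less_imp_le[OF u(3)] unfolding w_def by (intro always_eventually) blast
  qed simp
  \<comment> \<open>The squared distance of \<open>w m\<close> and \<open>w n\<close> is at most \<open>g m + g n\<close>: the parallelogram identity separates
    the energies, and the limits \<open>y k\<close> separate the functionals.\<close>
  define g where "g = (\<lambda>n. 4 * ?Q (w n) (w n) + \<bar>D\<bar> * (\<Sum>k\<in>K. 2 * (l k (w n) - y k)\<^sup>2))"
  have g0: "g \<longlonglongrightarrow> 4 * 0 + \<bar>D\<bar> * (\<Sum>k\<in>K. 2 * (y k - y k)\<^sup>2)"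
    unfolding g_def using y by (intro tendsto_intros Qw) (auto simp: w_def)
  have dist: "a (w m - w n) (w m - w n) \<le> g m + g n" for m n
  proof -
    have "w m - w n \<in> W" using wW subspace_diff[OF subspace] by blast
    then have "a (w m - w n) (w m - w n)
        \<le> 2 * ?Q (w m - w n) (w m - w n) + D * (\<Sum>k\<in>K. (l k (w m - w n))\<^sup>2)"
      by (rule Garding)
    also have "?Q (w m - w n) (w m - w n) \<le> 2 * ?Q (w m) (w m) + 2 * ?Q (w n) (w n)"
      using Q.nonneg_diff_le[OF Qnonneg wW wW] .
    also have "D * (\<Sum>k\<in>K. (l k (w m - w n))\<^sup>2) \<le> \<bar>D\<bar> * (\<Sum>k\<in>K. (l k (w m - w n))\<^sup>2)"
      by (intro mult_right_mono sum_nonneg) auto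
    also have "(\<Sum>k\<in>K. (l k (w m - w n))\<^sup>2)
        \<le> (\<Sum>k\<in>K. 2 * (l k (w m) - y k)\<^sup>2 + 2 * (l k (w n) - y k)\<^sup>2)"
    proof (rule sum_mono)
      fix k assume "k \<in> K"
      have "l k (w m - w n) = (l k (w m) - y k) - (l k (w n) - y k)"
        using linear_functional_on_diff[OF functional[OF \<open>k \<in> K\<close>] subspace wW wW] by simp
      moreover have "(s - t)\<^sup>2 \<le> 2 * s\<^sup>2 + 2 * t\<^sup>2" for s t :: real
        using zero_le_power2[of "s + t"] by (simp add: power2_eq_square algebra_simps)
      ultimately show "(l k (w m - w n))\<^sup>2 \<le> 2 * (l k (w m) - y k)\<^sup>2 + 2 * (l k (w n) - y k)\<^sup>2"
        by metis
    qed
    finally show ?thesis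
      by (simp add: g_def sum.distrib distrib_left mult_left_mono)
  qed
  have "\<exists>z\<in>W. (\<lambda>n. a (w n - z) (w n - z)) \<longlonglongrightarrow> 0"
  proof (rule complete[OF wW])
    fix e :: real assume "e > 0"
    then obtain N where N: "\<And>n. n \<ge> N \<Longrightarrow> \<bar>g n\<bar> < e / 2"
      using LIMSEQ_D[OF g0, of "e / 2"] by auto
    have "a (w m - w n) (w m - w n) < e" if "m \<ge> N" "n \<ge> N" for m n
      using dist[of m n] N[OF that(1)] N[OF that(2)] by linarith
    then show "\<exists>N. \<forall>m\<ge>N. \<forall>n\<ge>N. a (w m - w n) (w m - w n) < e" by blast
  qed
  then obtain z where z: "z \<in> W" "(\<lambda>n. a (w n - z) (w n - z)) \<longlonglongrightarrow> 0" by blast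
  have "(\<lambda>n. a (w n) (w n)) \<longlonglongrightarrow> a z z"
    by (rule nonneg_tendsto[OF nonneg wW z])
  then have "a z z = 1"
    using u(2) LIMSEQ_unique[OF _ tendsto_const[of 1]] by (fastforce simp: w_def)
  have "(\<lambda>n. ?Q (w n - z) (w n - z)) \<longlonglongrightarrow> 0"
  proof (rule tendsto_sandwich[of "\<lambda>_. 0" _ _ "\<lambda>n. (1 + C) * a (w n - z) (w n - z)"])
    have dW: "w n - z \<in> W" for n using wW z(1) subspace_diff[OF subspace] by blast
    show "\<forall>\<^sub>F n in sequentially. 0 \<le> ?Q (w n - z) (w n - z)" using Qnonneg[OF dW] by simp
    have "v (w n - z) (w n - z) \<le> C * a (w n - z) (w n - z)" for n
      using bound[OF dW[of n]] by linarith
    then show "\<forall>\<^sub>F n in sequentially. ?Q (w n - z) (w n - z) \<le> (1 + C) * a (w n - z) (w n - z)"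
      by (simp add: distrib_right)
    show "(\<lambda>n. (1 + C) * a (w n - z) (w n - z)) \<longlonglongrightarrow> 0"
      using tendsto_mult[OF tendsto_const[of "1 + C"] z(2)] by simp
  qed simp
  then have "(\<lambda>n. ?Q (w n) (w n)) \<longlonglongrightarrow> ?Q z z"
    using Q.nonneg_tendsto[of w z] Qnonneg wW z(1) by blast
  then have "?Q z z = 0" using Qw LIMSEQ_unique by blast
  moreover have "z \<noteq> 0" using \<open>a z z = 1\<close> zero_left[OF z(1)] by auto
  ultimately show False using positive[OF z(1)] by simp
qed

section \<open>Square integrable functions\<close>

abbreviation sqnorm :: "'a measure \<Rightarrow> ('a \<Rightarrow> 'b::euclidean_space) \<Rightarrow> real" where
  "sqnorm M f \<equiv> LINT x|M. (norm (f x))\<^sup>2"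

lemma norm_diff_sq_le:
  fixes x y :: "'a::real_inner"
  shows "(norm (x - y))\<^sup>2 \<le> 2 * (norm x)\<^sup>2 + 2 * (norm y)\<^sup>2"
  using zero_le_power2[of "norm (x + y)"]
  by (simp add: power2_norm_eq_inner inner_left_distrib inner_right_distrib inner_diff_left
      inner_diff_right inner_commute)

definition square_integrable :: "'a measure \<Rightarrow> ('a \<Rightarrow> 'b::euclidean_space) \<Rightarrow> bool" where
  "square_integrable M f \<longleftrightarrow> f \<in> borel_measurable M \<and> integrable M (\<lambda>x. (norm (f x))\<^sup>2)"

definition L2_tendsto ::
    "'a measure \<Rightarrow> (nat \<Rightarrow> 'a \<Rightarrow> 'b::euclidean_space) \<Rightarrow> ('a \<Rightarrow> 'b) \<Rightarrow> bool" where
  "L2_tendsto M f g \<longleftrightarrow> (\<lambda>n. sqnorm M (\<lambda>x. f n x - g x)) \<longlonglongrightarrow> 0"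

lemma square_integrable_measurable: "square_integrable M f \<Longrightarrow> f \<in> borel_measurable M"
  by (simp add: square_integrable_def)

lemma square_integrable_norm: "square_integrable M f \<Longrightarrow> integrable M (\<lambda>x. (norm (f x))\<^sup>2)"
  by (simp add: square_integrable_def)

lemma square_integrable_power2:
  "square_integrable M f \<Longrightarrow> integrable M (\<lambda>x. (f x :: real)\<^sup>2)"
  by (simp add: square_integrable_def)

lemma square_integrable_inner:
  assumes "square_integrable M f" "square_integrable M g"
  shows "integrable M (\<lambda>x. f x \<bullet> g x)"
proof (rule Bochner_Integration.integrable_bound)
  show "integrable M (\<lambda>x. (norm (f x))\<^sup>2 + (norm (g x))\<^sup>2)"
    using assms by (auto simp: square_integrable_def)
  show "(\<lambda>x. f x \<bullet> g x) \<in> borel_measurable M"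
    using assms by (auto simp: square_integrable_def)
  have "norm (x \<bullet> y) \<le> norm ((norm x)\<^sup>2 + (norm y)\<^sup>2)" for x y :: 'b
  proof -
    have "\<bar>x \<bullet> y\<bar> \<le> norm x * norm y" by (rule Cauchy_Schwarz_ineq2)
    moreover have "2 * norm x * norm y \<le> (norm x)\<^sup>2 + (norm y)\<^sup>2" by (rule sum_squares_bound)
    moreover have "0 \<le> norm x * norm y" by simp
    ultimately show ?thesis by simp
  qed
  then show "AE x in M. norm (f x \<bullet> g x) \<le> norm ((norm (f x))\<^sup>2 + (norm (g x))\<^sup>2)" by simp
qed

lemma square_integrable_mult:
  assumes "square_integrable M f" "square_integrable M g"
  shows "integrable M (\<lambda>x. f x * g x :: real)"
  using square_integrable_inner[OF assms] by simp

lemma square_integrable_scaleR: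
  assumes "square_integrable M f"
  shows "square_integrable M (\<lambda>x. c *\<^sub>R f x)"
  using assms by (auto simp: square_integrable_def power_mult_distrib)

lemma square_integrable_diff:
  assumes "square_integrable M f" "square_integrable M g"
  shows "square_integrable M (\<lambda>x. f x - g x)"
  unfolding square_integrable_def
proof
  show m: "(\<lambda>x. f x - g x) \<in> borel_measurable M"
    using assms by (auto simp: square_integrable_def)
  show "integrable M (\<lambda>x. (norm (f x - g x))\<^sup>2)"
  proof (rule Bochner_Integration.integrable_bound)
    show "integrable M (\<lambda>x. 2 * (norm (f x))\<^sup>2 + 2 * (norm (g x))\<^sup>2)"
      using assms by (auto simp: square_integrable_def)
    show "(\<lambda>x. (norm (f x - g x))\<^sup>2) \<in> borel_measurable M" using m by simp
    show "AE x in M. norm ((norm (f x - g x))\<^sup>2) \<le> norm (2 * (norm (f x))\<^sup>2 + 2 * (norm (g x))\<^sup>2)"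
      using norm_diff_sq_le by (intro AE_I2) simp
  qed
qed

lemma square_integrable_add:
  assumes "square_integrable M f" "square_integrable M g"
  shows "square_integrable M (\<lambda>x. f x + g x)"
  using square_integrable_diff[OF assms(1) square_integrable_scaleR[OF assms(2), of "-1"]] by simp

lemma square_integrable_indicator:
  assumes "square_integrable M f" "S \<in> sets M"
  shows "square_integrable M (\<lambda>x. indicator S x *\<^sub>R f x)"
  unfolding square_integrable_def
proof
  show m: "(\<lambda>x. indicator S x *\<^sub>R f x) \<in> borel_measurable M"
    using assms by (auto simp: square_integrable_def)
  show "integrable M (\<lambda>x. (norm (indicator S x *\<^sub>R f x))\<^sup>2)"
  proof (rule Bochner_Integration.integrable_bound[OF square_integrable_norm[OF assms(1)]])
    show "(\<lambda>x. (norm (indicator S x *\<^sub>R f x))\<^sup>2) \<in> borel_measurable M" using m by measurable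
    show "AE x in M. norm ((norm (indicator S x *\<^sub>R f x))\<^sup>2) \<le> norm ((norm (f x))\<^sup>2)"
      by (intro AE_I2) (simp add: indicator_def)
  qed
qed

lemma square_integrable_AE_cong:
  assumes "square_integrable M f" "g \<in> borel_measurable M" "AE x in M. f x = g x"
  shows "square_integrable M g"
proof -
  have "integrable M (\<lambda>x. (norm (f x))\<^sup>2) \<longleftrightarrow> integrable M (\<lambda>x. (norm (g x))\<^sup>2)"
  proof (rule integrable_cong_AE)
    show "AE x in M. (norm (f x))\<^sup>2 = (norm (g x))\<^sup>2" using assms(3) by eventually_elim simp
  qed (use assms in \<open>auto simp: square_integrable_def\<close>)
  then show ?thesis using assms by (simp add: square_integrable_def)
qed

lemma square_integrable_nth:
  assumes "square_integrable M (f :: 'a \<Rightarrow> real^'n)"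
  shows "square_integrable M (\<lambda>x. f x $ i)"
  unfolding square_integrable_def
proof
  have "(\<lambda>x. f x \<bullet> axis i 1) \<in> borel_measurable M"
    using assms by (intro borel_measurable_inner) (auto simp: square_integrable_def)
  then show m: "(\<lambda>x. f x $ i) \<in> borel_measurable M" by (simp add: inner_axis)
  show "integrable M (\<lambda>x. (norm (f x $ i))\<^sup>2)"
  proof (rule Bochner_Integration.integrable_bound[OF square_integrable_norm[OF assms]])
    show "(\<lambda>x. (norm (f x $ i))\<^sup>2) \<in> borel_measurable M" using m by measurable
    show "AE x in M. norm ((norm (f x $ i))\<^sup>2) \<le> norm ((norm (f x))\<^sup>2)"
      using power_mono[OF component_le_norm_cart abs_ge_zero, of _ i 2] by (intro AE_I2) simp
  qed
qed

lemma integral_inner_Cauchy_Schwarz: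
  assumes f: "square_integrable M f" and g: "square_integrable M g"
  shows "(LINT x|M. f x \<bullet> g x)\<^sup>2 \<le> sqnorm M f * sqnorm M g"
proof (rule discriminant_le)
  fix t :: real
  have "0 \<le> sqnorm M (\<lambda>x. f x - t *\<^sub>R g x)" by simp
  also have "(\<lambda>x. (norm (f x - t *\<^sub>R g x))\<^sup>2)
      = (\<lambda>x. (norm (f x))\<^sup>2 - 2 * t * (f x \<bullet> g x) + t\<^sup>2 * (norm (g x))\<^sup>2)"
    by (rule ext)
       (simp add: power2_norm_eq_inner inner_diff_left inner_diff_right inner_commute[of "g _" "f _"],
        simp add: power2_eq_square algebra_simps)
  also have "(LINT x|M. (norm (f x))\<^sup>2 - 2 * t * (f x \<bullet> g x) + t\<^sup>2 * (norm (g x))\<^sup>2)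
     = sqnorm M f - 2 * t * (LINT x|M. f x \<bullet> g x) + t\<^sup>2 * sqnorm M g"
    using square_integrable_norm[OF f] square_integrable_norm[OF g] square_integrable_inner[OF f g]
    by simp
  finally show "0 \<le> sqnorm M f - 2 * t * (LINT x|M. f x \<bullet> g x)
      + t\<^sup>2 * sqnorm M g" .
qed simp

lemma integral_norm_diff_sq_le:
  assumes f: "square_integrable M f" and g: "square_integrable M g"
  shows "sqnorm M (\<lambda>x. f x - g x)
       \<le> 2 * sqnorm M f + 2 * sqnorm M g"
proof -
  have "sqnorm M (\<lambda>x. f x - g x) \<le> (LINT x|M. 2 * (norm (f x))\<^sup>2 + 2 * (norm (g x))\<^sup>2)"
    using square_integrable_norm[OF f] square_integrable_norm[OF g]
      square_integrable_norm[OF square_integrable_diff[OF f g]]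
    by (intro integral_mono norm_diff_sq_le) auto
  then show ?thesis using square_integrable_norm[OF f] square_integrable_norm[OF g] by simp
qed

lemma L2_tendsto_inner_null:
  assumes f: "\<And>n. square_integrable M (f n)" and g: "\<And>n. square_integrable M (g n)"
    and "(\<lambda>n. sqnorm M (f n)) \<longlonglongrightarrow> 0" "(\<lambda>n. sqnorm M (g n)) \<longlonglongrightarrow> c"
  shows "(\<lambda>n. LINT x|M. f n x \<bullet> g n x) \<longlonglongrightarrow> 0"
proof (rule Lim_null_comparison)
  show "\<forall>\<^sub>F n in sequentially. norm (LINT x|M. f n x \<bullet> g n x)
     \<le> sqrt ((sqnorm M (f n)) * sqnorm M (g n))"
    using integral_inner_Cauchy_Schwarz[OF f g]
    by (intro always_eventually allI) (simp add: real_le_rsqrt)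
  show "(\<lambda>n. sqrt ((sqnorm M (f n)) * sqnorm M (g n))) \<longlonglongrightarrow> 0"
    using tendsto_real_sqrt[OF tendsto_mult[OF assms(3,4)]] by simp
qed

lemma L2_tendsto_inner:
  assumes f: "\<And>n. square_integrable M (f n)" "square_integrable M F" "L2_tendsto M f F"
    and g: "\<And>n. square_integrable M (g n)" "square_integrable M G" "L2_tendsto M g G"
  shows "(\<lambda>n. LINT x|M. f n x \<bullet> g n x) \<longlonglongrightarrow> (LINT x|M. F x \<bullet> G x)"
proof -
  have fd: "square_integrable M (\<lambda>x. f n x - F x)" and gd: "square_integrable M (\<lambda>x. g n x - G x)" for n
    using f g square_integrable_diff by blast+
  have eq: "(LINT x|M. f n x \<bullet> g n x) = (LINT x|M. (f n x - F x) \<bullet> (g n x - G x))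
      + (LINT x|M. (f n x - F x) \<bullet> G x) + (LINT x|M. (g n x - G x) \<bullet> F x) + (LINT x|M. F x \<bullet> G x)" for n
  proof -
    have "(LINT x|M. f n x \<bullet> g n x) = (LINT x|M. (f n x - F x) \<bullet> (g n x - G x)
        + (f n x - F x) \<bullet> G x + (g n x - G x) \<bullet> F x + F x \<bullet> G x)"
      by (intro Bochner_Integration.integral_cong refl)
         (simp add: inner_diff_left inner_diff_right inner_commute[of "g n _" "F _"]
           inner_commute[of "G _" "F _"])
    then show ?thesis
      using square_integrable_inner[OF fd gd] square_integrable_inner[OF fd g(2)]
        square_integrable_inner[OF gd f(2)] square_integrable_inner[OF f(2) g(2)] by simp
  qed
  have "(\<lambda>n. LINT x|M. (f n x - F x) \<bullet> (g n x - G x)) \<longlonglongrightarrow> 0"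
    by (rule L2_tendsto_inner_null[OF fd gd f(3)[unfolded L2_tendsto_def] g(3)[unfolded L2_tendsto_def]])
  moreover have "(\<lambda>n. LINT x|M. (f n x - F x) \<bullet> G x) \<longlonglongrightarrow> 0"
    by (rule L2_tendsto_inner_null[OF fd g(2) f(3)[unfolded L2_tendsto_def] tendsto_const])
  moreover have "(\<lambda>n. LINT x|M. (g n x - G x) \<bullet> F x) \<longlonglongrightarrow> 0"
    by (rule L2_tendsto_inner_null[OF gd f(2) g(3)[unfolded L2_tendsto_def] tendsto_const])
  ultimately have "(\<lambda>n. (LINT x|M. (f n x - F x) \<bullet> (g n x - G x))
      + (LINT x|M. (f n x - F x) \<bullet> G x) + (LINT x|M. (g n x - G x) \<bullet> F x) + (LINT x|M. F x \<bullet> G x))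
      \<longlonglongrightarrow> 0 + 0 + 0 + (LINT x|M. F x \<bullet> G x)"
    by (intro tendsto_intros)
  then show ?thesis unfolding eq by simp
qed

lemma L2_tendsto_const: "L2_tendsto M (\<lambda>_. f) f"
  by (simp add: L2_tendsto_def)

lemma L2_tendsto_norm:
  assumes f: "\<And>n. square_integrable M (f n)" "square_integrable M F" "L2_tendsto M f F"
  shows "(\<lambda>n. sqnorm M (f n)) \<longlonglongrightarrow> sqnorm M F"
  using L2_tendsto_inner[OF f f] by (simp add: power2_norm_eq_inner)

lemma L2_tendsto_le:
  assumes "\<And>n. (sqnorm M (\<lambda>x. f n x - F x)) \<le> h n" "h \<longlonglongrightarrow> 0"
  shows "L2_tendsto M f F"
  unfolding L2_tendsto_def
proof (rule tendsto_sandwich[OF _ _ tendsto_const assms(2)])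
  show "\<forall>\<^sub>F n in sequentially. 0 \<le> sqnorm M (\<lambda>x. f n x - F x)" by simp
  show "\<forall>\<^sub>F n in sequentially. (sqnorm M (\<lambda>x. f n x - F x)) \<le> h n"
    using assms(1) by (intro always_eventually allI)
qed

lemma L2_tendsto_dominated:
  assumes "L2_tendsto M f F" "\<And>n. square_integrable M (\<lambda>x. f n x - F x)"
    and "\<And>n. (\<lambda>x. g n x - G x) \<in> borel_measurable M"
    and "\<And>n. AE x in M. norm (g n x - G x) \<le> norm (f n x - F x)"
  shows "L2_tendsto M g G"
proof -
  have *: "AE x in M. (norm (g n x - G x))\<^sup>2 \<le> (norm (f n x - F x))\<^sup>2" for n
    using assms(4)[of n] by eventually_elim (simp add: power_mono)
  have "sqnorm M (\<lambda>x. g n x - G x) \<le> sqnorm M (\<lambda>x. f n x - F x)" for n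
  proof (rule integral_mono_AE)
    show i: "integrable M (\<lambda>x. (norm (f n x - F x))\<^sup>2)"
      using assms(2) square_integrable_norm by blast
    show "integrable M (\<lambda>x. (norm (g n x - G x))\<^sup>2)"
    proof (rule Bochner_Integration.integrable_bound[OF i])
      show "(\<lambda>x. (norm (g n x - G x))\<^sup>2) \<in> borel_measurable M" using assms(3)[of n] by measurable
      show "AE x in M. norm ((norm (g n x - G x))\<^sup>2) \<le> norm ((norm (f n x - F x))\<^sup>2)"
        using *[of n] by eventually_elim simp
    qed
  qed (use * in auto)
  then show ?thesis by (rule L2_tendsto_le[OF _ assms(1)[unfolded L2_tendsto_def]])
qed

lemma L2_tendsto_indicator:
  assumes f: "\<And>n. square_integrable M (f n)" "square_integrable M F" "L2_tendsto M f F"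
    and S: "S \<in> sets M"
  shows "L2_tendsto M (\<lambda>n x. indicator S x *\<^sub>R f n x) (\<lambda>x. indicator S x *\<^sub>R F x)"
proof (rule L2_tendsto_dominated[OF f(3)])
  show "square_integrable M (\<lambda>x. f n x - F x)" for n using f square_integrable_diff by blast
  show "(\<lambda>x. indicator S x *\<^sub>R f n x - indicator S x *\<^sub>R F x) \<in> borel_measurable M" for n
    using square_integrable_measurable[OF square_integrable_indicator[OF f(1) S]]
      square_integrable_measurable[OF square_integrable_indicator[OF f(2) S]]
    by (rule borel_measurable_diff)
qed (simp add: indicator_def)

lemma L2_tendsto_set_norm:
  assumes f: "\<And>n. square_integrable M (f n)" "square_integrable M F" "L2_tendsto M f F"
    and S: "S \<in> sets M"
  shows "(\<lambda>n. LINT x:S|M. (norm (f n x))\<^sup>2) \<longlonglongrightarrow> (LINT x:S|M. (norm (F x))\<^sup>2)"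
proof -
  have eq: "sqnorm M (\<lambda>x. indicator S x *\<^sub>R g x) = (LINT x:S|M. (norm (g x))\<^sup>2)"
    for g :: "'a \<Rightarrow> 'b"
    unfolding set_lebesgue_integral_def
    by (intro Bochner_Integration.integral_cong) (auto simp: indicator_def)
  show ?thesis
    using L2_tendsto_norm[OF square_integrable_indicator[OF f(1) S]
        square_integrable_indicator[OF f(2) S] L2_tendsto_indicator[OF f S]]
    unfolding eq .
qed

lemma L2_tendsto_diff:
  assumes f: "\<And>n. square_integrable M (f n)" "square_integrable M F" "L2_tendsto M f F"
    and g: "\<And>n. square_integrable M (g n)" "square_integrable M G" "L2_tendsto M g G"
  shows "L2_tendsto M (\<lambda>n x. f n x - g n x) (\<lambda>x. F x - G x)"
proof -
  have fd: "square_integrable M (\<lambda>x. f n x - F x)" and gd: "square_integrable M (\<lambda>x. g n x - G x)" for n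
    using f g square_integrable_diff by blast+
  have "sqnorm M (\<lambda>x. f n x - g n x - (F x - G x))
     \<le> 2 * sqnorm M (\<lambda>x. f n x - F x) + 2 * sqnorm M (\<lambda>x. g n x - G x)" for n
  proof -
    have "f n x - g n x - (F x - G x) = (f n x - F x) - (g n x - G x)" for x
      by (simp add: algebra_simps)
    then show ?thesis using integral_norm_diff_sq_le[OF fd[of n] gd[of n]] by (simp only:)
  qed
  moreover have "(\<lambda>n. 2 * sqnorm M (\<lambda>x. f n x - F x) + 2 * sqnorm M (\<lambda>x. g n x - G x))
      \<longlonglongrightarrow> 2 * 0 + 2 * 0"
    using f(3) g(3) unfolding L2_tendsto_def by (intro tendsto_intros)
  ultimately show ?thesis by (intro L2_tendsto_le[OF _ ]) simp_all
qed

lemma L2_tendsto_scaleR: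
  assumes "L2_tendsto M f F"
  shows "L2_tendsto M (\<lambda>n x. c *\<^sub>R f n x) (\<lambda>x. c *\<^sub>R F x)"
proof -
  have "(norm (c *\<^sub>R x - c *\<^sub>R y))\<^sup>2 = c\<^sup>2 * (norm (x - y))\<^sup>2" for x y :: 'b
    by (metis norm_scaleR power2_abs power_mult_distrib scaleR_diff_right)
  then show ?thesis
    using tendsto_mult[OF tendsto_const[of "c\<^sup>2"] assms[unfolded L2_tendsto_def]]
    by (simp add: L2_tendsto_def)
qed

lemma L2_tendsto_add:
  assumes f: "\<And>n. square_integrable M (f n)" "square_integrable M F" "L2_tendsto M f F"
    and g: "\<And>n. square_integrable M (g n)" "square_integrable M G" "L2_tendsto M g G"
  shows "L2_tendsto M (\<lambda>n x. f n x + g n x) (\<lambda>x. F x + G x)"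
  using L2_tendsto_diff[OF f square_integrable_scaleR[OF g(1), of "-1"]
      square_integrable_scaleR[OF g(2), of "-1"] L2_tendsto_scaleR[OF g(3), of "-1"]]
  by simp

lemma L2_tendsto_perturb:
  assumes sq: "\<And>n. square_integrable M (f n)" "\<And>n. square_integrable M (g n)" "square_integrable M F"
    and g: "L2_tendsto M g F"
    and fg: "\<And>n. (sqnorm M (\<lambda>x. f n x - g n x)) \<le> inverse (real (Suc n))"
  shows "L2_tendsto M f F"
proof -
  have "(\<lambda>n. sqnorm M (\<lambda>x. f n x - g n x)) \<longlonglongrightarrow> 0"
    using fg by (intro tendsto_sandwich[OF _ _ tendsto_const LIMSEQ_inverse_real_of_nat]) simp_all
  then have "L2_tendsto M (\<lambda>n x. f n x - g n x) (\<lambda>x. 0)" by (simp add: L2_tendsto_def)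
  moreover have "square_integrable M (\<lambda>x. 0 :: 'b)" by (simp add: square_integrable_def)
  ultimately have "L2_tendsto M (\<lambda>n x. f n x - g n x + g n x) (\<lambda>x. 0 + F x)"
    using sq g square_integrable_diff[OF sq(1,2)] by (intro L2_tendsto_add)
  then show ?thesis by simp
qed

lemma L2_tendsto_nth:
  fixes F :: "'a \<Rightarrow> real^'n"
  assumes f: "\<And>n. square_integrable M (f n)" "square_integrable M F" "L2_tendsto M f F"
  shows "L2_tendsto M (\<lambda>n x. f n x $ i) (\<lambda>x. F x $ i)"
proof (rule L2_tendsto_dominated[OF f(3)])
  show "square_integrable M (\<lambda>x. f n x - F x)" for n using f square_integrable_diff by blast
  show "(\<lambda>x. f n x $ i - F x $ i) \<in> borel_measurable M" for n
    using square_integrable_measurable[OF square_integrable_nth[OF f(1)]]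
      square_integrable_measurable[OF square_integrable_nth[OF f(2)]]
    by (rule borel_measurable_diff)
  have "norm (x $ i - y $ i) \<le> norm (x - y)" for x y :: "real^'n"
    using component_le_norm_cart[of "x - y" i] by simp
  then show "AE x in M. norm (f n x $ i - F x $ i) \<le> norm (f n x - F x)" for n by simp
qed

lemma L2_tendsto_commute:
  "L2_tendsto M f F \<longleftrightarrow> (\<lambda>n. sqnorm M (\<lambda>x. F x - f n x)) \<longlonglongrightarrow> 0"
  by (simp add: L2_tendsto_def norm_minus_commute)

lemma integrable_bounded_mult:
  fixes f :: "'a \<Rightarrow> real"
  assumes "integrable M f" "w \<in> borel_measurable M" "AE x in M. \<bar>w x\<bar> \<le> C"
  shows "integrable M (\<lambda>x. w x * f x)"
proof (rule Bochner_Integration.integrable_bound)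
  show "integrable M (\<lambda>x. C * f x)" using assms(1) by simp
  show "(\<lambda>x. w x * f x) \<in> borel_measurable M"
    by (intro borel_measurable_times assms(2) borel_measurable_integrable assms(1))
  show "AE x in M. norm (w x * f x) \<le> norm (C * f x)"
    using assms(3) by eventually_elim (auto simp: abs_mult intro!: mult_right_mono)
qed

lemma borel_measurable_norm_sq:
  fixes f :: "'a \<Rightarrow> 'b::euclidean_space"
  shows "f \<in> borel_measurable M \<Longrightarrow> (\<lambda>x. (norm (f x))\<^sup>2) \<in> borel_measurable M"
  by measurable

lemma norm_Pair_sq: "(norm (a, b))\<^sup>2 = (norm a)\<^sup>2 + (norm b)\<^sup>2"
  by (simp add: norm_Pair)

lemma square_integrable_Pair:
  assumes "square_integrable M f" "square_integrable M g"
  shows "square_integrable M (\<lambda>x. (f x, g x))"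
  unfolding square_integrable_def norm_Pair_sq
  using assms by (intro conjI borel_measurable_Pair Bochner_Integration.integrable_add
      square_integrable_norm square_integrable_measurable)

lemma square_integrable_fst_snd:
  assumes "square_integrable M f"
  shows "square_integrable M (\<lambda>x. fst (f x))" "square_integrable M (\<lambda>x. snd (f x))"
proof -
  have m: "f \<in> borel_measurable M" by (rule square_integrable_measurable[OF assms])
  have m1: "(\<lambda>x. fst (f x)) \<in> borel_measurable M" and m2: "(\<lambda>x. snd (f x)) \<in> borel_measurable M"
    by (rule measurable_compose[OF m]; intro borel_measurable_continuous_onI continuous_intros)+
  have sq: "(norm (fst z))\<^sup>2 \<le> (norm z)\<^sup>2" "(norm (snd z))\<^sup>2 \<le> (norm z)\<^sup>2" for z :: "'b \<times> 'c"
    by (metis norm_Pair_sq prod.collapse le_add_same_cancel1 zero_le_power2)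
       (metis norm_Pair_sq prod.collapse le_add_same_cancel2 zero_le_power2)
  show "square_integrable M (\<lambda>x. fst (f x))"
    unfolding square_integrable_def
  proof (intro conjI m1 Bochner_Integration.integrable_bound[OF square_integrable_norm[OF assms]])
    show "(\<lambda>x. (norm (fst (f x)))\<^sup>2) \<in> borel_measurable M"
      by (intro borel_measurable_norm_sq m1)
  qed (use sq in simp)
  show "square_integrable M (\<lambda>x. snd (f x))"
    unfolding square_integrable_def
  proof (intro conjI m2 Bochner_Integration.integrable_bound[OF square_integrable_norm[OF assms]])
    show "(\<lambda>x. (norm (snd (f x)))\<^sup>2) \<in> borel_measurable M"
      by (intro borel_measurable_norm_sq m2)
  qed (use sq in simp)
qed

lemma L2_tendsto_AE_cong:
  assumes "L2_tendsto M f F" "\<And>n. f n \<in> borel_measurable M" "F \<in> borel_measurable M"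
    "G \<in> borel_measurable M" "AE x in M. F x = G x"
  shows "L2_tendsto M f G"
proof -
  have "sqnorm M (\<lambda>x. f n x - F x) = sqnorm M (\<lambda>x. f n x - G x)" for n
  proof (rule integral_cong_AE)
    show "AE x in M. (norm (f n x - F x))\<^sup>2 = (norm (f n x - G x))\<^sup>2"
      using assms(5) by eventually_elim simp
  qed (use assms(2)[of n] assms(3,4) in measurable)
  then show ?thesis using assms(1) by (simp add: L2_tendsto_def)
qed

text \<open>The Riesz-Fischer theorem, together with the almost everywhere convergence of a subsequence that
  its proof provides. Let \<open>d\<^sub>k\<close> be the distance of consecutive members of a subsequence with
  \<open>\<integral> d\<^sub>k\<^sup>2 \<le> 8\<^sup>-\<^sup>k\<close>. Then \<open>\<Sum>\<^sub>k 2\<^sup>k d\<^sub>k\<^sup>2\<close> is integrable, hence finite almost everywhere, and so is \<open>\<Sum>\<^sub>k d\<^sub>k\<close> because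
  \<open>d\<^sub>k \<le> 2\<^sup>-\<^sup>k + 2\<^sup>k d\<^sub>k\<^sup>2\<close>. The convergence in the mean is Fatou's lemma.\<close>
theorem square_integrable_complete:
  fixes f :: "nat \<Rightarrow> 'a \<Rightarrow> 'b::euclidean_space"
  assumes f: "\<And>n. square_integrable M (f n)"
    and Cauchy: "\<And>e. e > 0 \<Longrightarrow> \<exists>N. \<forall>m\<ge>N. \<forall>n\<ge>N. (sqnorm M (\<lambda>x. f m x - f n x)) < e"
  obtains F r where "square_integrable M F" "L2_tendsto M f F"
    "strict_mono (r :: nat \<Rightarrow> nat)" "AE x in M. (\<lambda>n. f (r n) x) \<longlonglongrightarrow> F x"
proof -
  define I where "I = (\<lambda>m n. sqnorm M (\<lambda>x. f m x - f n x))"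
  have fd: "square_integrable M (\<lambda>x. f m x - f n x)" for m n
    using f square_integrable_diff by blast
  have fm[measurable]: "f n \<in> borel_measurable M" for n using f square_integrable_measurable by blast
  have nn: "(\<integral>\<^sup>+x. ennreal ((norm (f m x - f n x))\<^sup>2) \<partial>M) = ennreal (I m n)" for m n
    unfolding I_def using square_integrable_norm[OF fd] by (intro nn_integral_eq_integral) auto
  have "\<exists>N. \<forall>k. (\<forall>m\<ge>N k. \<forall>n\<ge>N k. I m n < (1/8)^k)"
    using Cauchy[of "(1/8)^k" for k] unfolding I_def by (intro choice) auto
  then obtain N where N: "\<And>k m n. m \<ge> N k \<Longrightarrow> n \<ge> N k \<Longrightarrow> I m n < (1/8)^k" by blast
  define r where "r = (\<lambda>k. k + (\<Sum>j\<le>k. N j))"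
  have r: "strict_mono r" unfolding r_def by (auto intro!: strict_mono_Suc_iff[THEN iffD2])
  have rN: "r k \<ge> N k" for k
    using member_le_sum[of k "{..k}" N] unfolding r_def by simp
  define d where "d = (\<lambda>k x. norm (f (r (Suc k)) x - f (r k) x))"
  have d[measurable]: "d k \<in> borel_measurable M" for k unfolding d_def by simp
  have "I (r (Suc k)) (r k) < (1/8)^k" for k
    using N[of k "r (Suc k)" "r k"] rN[of k] strict_monoD[OF r, of k "Suc k"] by simp
  then have dI: "(\<integral>\<^sup>+x. ennreal ((d k x)\<^sup>2) \<partial>M) \<le> ennreal ((1/8)^k)" for k
    unfolding d_def nn by (intro ennreal_leI less_imp_le)
  have "(\<integral>\<^sup>+x. (\<Sum>k. ennreal (2^k * (d k x)\<^sup>2)) \<partial>M) = (\<Sum>k. \<integral>\<^sup>+x. ennreal (2^k * (d k x)\<^sup>2) \<partial>M)"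
    by (rule nn_integral_suminf) simp
  also have "\<dots> \<le> (\<Sum>k. ennreal ((1/4)^k))"
  proof (intro suminf_le summableI)
    fix k
    have "(\<integral>\<^sup>+x. ennreal (2^k * (d k x)\<^sup>2) \<partial>M) = ennreal (2^k) * (\<integral>\<^sup>+x. ennreal ((d k x)\<^sup>2) \<partial>M)"
      by (simp add: ennreal_mult nn_integral_cmult)
    also have "\<dots> \<le> ennreal (2^k) * ennreal ((1/8)^k)"
      using dI by (intro mult_left_mono) auto
    also have "\<dots> = ennreal (2^k * (1/8)^k)" by (simp add: ennreal_mult)
    also have "2^k * (1/8)^k = ((1/4)^k :: real)"
      by (simp flip: power_mult_distrib)
    finally show "(\<integral>\<^sup>+x. ennreal (2^k * (d k x)\<^sup>2) \<partial>M) \<le> ennreal ((1/4)^k)" .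
  qed
  also have "\<dots> = ennreal (\<Sum>k. (1/4)^k)"
    by (intro suminf_ennreal2) (auto intro: summable_geometric)
  finally have fin: "(\<integral>\<^sup>+x. (\<Sum>k. ennreal (2^k * (d k x)\<^sup>2)) \<partial>M) \<noteq> \<infinity>"
    by (auto simp: top_unique)
  have AE_sum: "AE x in M. (\<Sum>k. ennreal (2^k * (d k x)\<^sup>2)) \<noteq> \<infinity>"
    by (rule nn_integral_PInf_AE[OF _ fin]) simp
  have AE_conv: "AE x in M. convergent (\<lambda>n. f (r n) x)"
    using AE_sum
  proof eventually_elim
    case (elim x)
    then have "summable (\<lambda>k. 2^k * (d k x)\<^sup>2)"
      by (intro summable_suminf_not_top) auto
    then have s: "summable (\<lambda>k. (1/2)^k + 2^k * (d k x)\<^sup>2)"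
      by (intro summable_add summable_geometric) auto
    have "d k x \<le> (1/2)^k + 2^k * (d k x)\<^sup>2" for k
    proof -
      have "0 \<le> 2^k * (d k x - (1/2)^k)\<^sup>2" by simp
      also have "\<dots> = 2^k * (d k x)\<^sup>2 - 2 * (2^k * (1/2)^k) * d k x + (2^k * (1/2)^k) * (1/2)^k"
        by (simp add: power2_eq_square algebra_simps)
      also have "2^k * (1/2)^k = (1::real)" by (simp flip: power_mult_distrib)
      finally have "2 * d k x \<le> (1/2)^k + 2^k * (d k x)\<^sup>2" by simp
      moreover have "d k x \<ge> 0" by (simp add: d_def)
      ultimately show ?thesis by simp
    qed
    then have "summable (\<lambda>k. norm (f (r (Suc k)) x - f (r k) x))"
      by (intro summable_comparison_test'[OF s, of 0]) (simp add: d_def)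
    then have "summable (\<lambda>k. f (r (Suc k)) x - f (r k) x)"
      by (rule summable_norm_cancel)
    then have "convergent (\<lambda>n. \<Sum>k<n. f (r (Suc k)) x - f (r k) x)"
      by (simp add: summable_iff_convergent)
    then have "convergent (\<lambda>n. f (r n) x - f (r 0) x)"
      by (simp add: sum_lessThan_telescope[of "\<lambda>k. f (r k) x"])
    then show ?case
      using convergent_add[OF _ convergent_const[of "f (r 0) x"]] by fastforce
  qed
  define F where "F = (\<lambda>x. lim (\<lambda>n. f (r n) x))"
  have Fm[measurable]: "F \<in> borel_measurable M"
    unfolding F_def by (rule borel_measurable_lim_metric) simp
  have AE_lim: "AE x in M. (\<lambda>n. f (r n) x) \<longlonglongrightarrow> F x"
    using AE_conv by eventually_elim (simp add: F_def convergent_LIMSEQ_iff)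
  have bound: "(\<integral>\<^sup>+x. ennreal ((norm (f m x - F x))\<^sup>2) \<partial>M) \<le> ennreal ((1/8)^k)" if "m \<ge> N k" for m k
  proof -
    have "(\<integral>\<^sup>+x. ennreal ((norm (f m x - F x))\<^sup>2) \<partial>M)
        = (\<integral>\<^sup>+x. liminf (\<lambda>n. ennreal ((norm (f m x - f (r n) x))\<^sup>2)) \<partial>M)"
    proof (rule nn_integral_cong_AE, use AE_lim in eventually_elim)
      case (elim x)
      then have "(\<lambda>n. ennreal ((norm (f m x - f (r n) x))\<^sup>2)) \<longlonglongrightarrow> ennreal ((norm (f m x - F x))\<^sup>2)"
        by (intro tendsto_intros)
      then show ?case by (simp only: lim_imp_Liminf[OF sequentially_bot])
    qed
    also have "\<dots> \<le> liminf (\<lambda>n. \<integral>\<^sup>+x. ennreal ((norm (f m x - f (r n) x))\<^sup>2) \<partial>M)"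
      by (rule nn_integral_liminf) simp
    also have "\<dots> = liminf (\<lambda>n. ennreal (I m (r n)))" by (simp add: nn)
    also have "\<dots> \<le> limsup (\<lambda>n. ennreal (I m (r n)))" by (rule Liminf_le_Limsup) simp
    also have "\<dots> \<le> ennreal ((1/8)^k)"
    proof (rule Limsup_bounded)
      show "\<forall>\<^sub>F n in sequentially. ennreal (I m (r n)) \<le> ennreal ((1/8)^k)"
        using eventually_ge_at_top[of "N k"]
      proof eventually_elim
        case (elim n)
        then have "r n \<ge> N k" using seq_suble[OF r, of n] by simp
        then show ?case using N[OF that] by (intro ennreal_leI less_imp_le)
      qed
    qed
    finally show ?thesis .
  qed
  have int: "integrable M (\<lambda>x. (norm (f m x - F x))\<^sup>2)" if "m \<ge> N k" for m k
  proof (rule integrableI_bounded)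
    show "(\<integral>\<^sup>+x. ennreal (norm ((norm (f m x - F x))\<^sup>2)) \<partial>M) < \<infinity>"
      using le_less_trans[OF bound[OF that], of \<infinity>] by simp
  qed measurable
  have "square_integrable M (\<lambda>x. f (N 0) x - F x)"
    using int[of 0 "N 0"] by (simp add: square_integrable_def)
  then have "square_integrable M (\<lambda>x. f (N 0) x - (f (N 0) x - F x))"
    by (rule square_integrable_diff[OF f])
  then have F: "square_integrable M F" by simp
  have "L2_tendsto M f F"
    unfolding L2_tendsto_def
  proof (rule LIMSEQ_I)
    fix e :: real assume "e > 0"
    then obtain k where k: "(1/8)^k < e" using real_arch_pow_inv[of e "1/8"] by auto
    have "norm ((sqnorm M (\<lambda>x. f m x - F x)) - 0) < e" if "m \<ge> N k" for m
    proof -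
      have "ennreal (sqnorm M (\<lambda>x. f m x - F x)) \<le> ennreal ((1/8)^k)"
        using bound[OF that] int[OF that] by (subst nn_integral_eq_integral[symmetric]) auto
      then show ?thesis using k by (simp add: ennreal_le_iff)
    qed
    then show "\<exists>no. \<forall>n\<ge>no. norm ((sqnorm M (\<lambda>x. f n x - F x)) - 0) < e" by blast
  qed
  then show ?thesis using that F r AE_lim by blast
qed

section \<open>Test functions and the fundamental lemma of the calculus of variations\<close>

lemma partial_deriv_eq:
  assumes "(f has_derivative D) (at x)"
  shows "partial_deriv i f x = D (axis i 1)"
  using frechet_derivative_at[OF assms] by (simp add: partial_deriv_def)

lemma differentiable_has_derivative_classical_grad:
  fixes f :: "real^'d \<Rightarrow> real"
  assumes "f differentiable at x"
  shows "(f has_derivative (\<lambda>h. classical_grad f x \<bullet> h)) (at x)"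
proof -
  let ?D = "frechet_derivative f (at x)"
  have D: "(f has_derivative ?D) (at x)" using assms by (simp add: frechet_derivative_works)
  then have lin: "linear ?D" by (rule has_derivative_linear)
  have "?D h = classical_grad f x \<bullet> h" for h
  proof -
    have "?D h = ?D (\<Sum>i\<in>UNIV. h $ i *\<^sub>R axis i 1)"
      by (simp add: basis_expansion flip: scalar_mult_eq_scaleR)
    also have "\<dots> = (\<Sum>i\<in>UNIV. h $ i * ?D (axis i 1))"
      by (simp add: linear_sum[OF lin] linear_cmul[OF lin])
    finally show ?thesis
      by (simp add: classical_grad_def partial_deriv_def inner_vec_def mult.commute)
  qed
  then show ?thesis using D by (metis (no_types, lifting) ext)
qed

lemma partial_deriv_eq_classical_grad: "partial_deriv i f x = classical_grad f x $ i"
  by (simp add: classical_grad_def)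

lemma C_k_continuous: "C_k k f \<Longrightarrow> continuous_on UNIV f"
  by (cases k) (auto intro: differentiable_imp_continuous_on simp: differentiable_on_def)

lemma partial_deriv_add:
  assumes "\<And>x. f differentiable at x" "\<And>x. g differentiable at x"
  shows "partial_deriv i (\<lambda>x. f x + g x) = (\<lambda>x. partial_deriv i f x + partial_deriv i g x)"
proof
  fix x
  show "partial_deriv i (\<lambda>x. f x + g x) x = partial_deriv i f x + partial_deriv i g x"
    using assms[of x] has_derivative_add
    by (intro partial_deriv_eq[THEN trans])
       (auto simp: partial_deriv_def frechet_derivative_works)
qed

lemma partial_deriv_scale:
  assumes "\<And>x. f differentiable at x"
  shows "partial_deriv i (\<lambda>x. c * f x) = (\<lambda>x. c * partial_deriv i f x)"
proof
  fix x
  have "((\<lambda>x. c * f x) has_derivative (\<lambda>h. c * frechet_derivative f (at x) h)) (at x)"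
    using assms[of x] by (intro has_derivative_mult_right) (simp add: frechet_derivative_works)
  then show "partial_deriv i (\<lambda>x. c * f x) x = c * partial_deriv i f x"
    by (subst partial_deriv_eq) (auto simp: partial_deriv_def)
qed

lemma C_k_add: "C_k k f \<Longrightarrow> C_k k g \<Longrightarrow> C_k k (\<lambda>x. f x + g x)"
  by (induction k arbitrary: f g) (auto intro!: continuous_intros simp: partial_deriv_add)

lemma C_k_scale: "C_k k f \<Longrightarrow> C_k k (\<lambda>x. c * f x)"
  by (induction k arbitrary: f) (auto intro!: continuous_intros simp: partial_deriv_scale)

lemma test_functionsD:
  assumes "\<phi> \<in> test_functions \<Omega>"
  shows "C_k k \<phi>" "compact (closure {x. \<phi> x \<noteq> 0})" "closure {x. \<phi> x \<noteq> 0} \<subseteq> \<Omega>"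
    "\<phi> differentiable at x" "continuous_on UNIV \<phi>" "\<phi> \<in> test_functions UNIV"
proof -
  show "C_k k \<phi>" "compact (closure {x. \<phi> x \<noteq> 0})" for k
    using assms by (auto simp: test_functions_def)
  show "closure {x. \<phi> x \<noteq> 0} \<subseteq> \<Omega>"
    using assms interior_subset by (auto simp: test_functions_def)
  have "C_k (Suc 0) \<phi>" using assms unfolding test_functions_def by blast
  then show "\<phi> differentiable at x" "continuous_on UNIV \<phi>" using C_k_continuous[of "Suc 0" \<phi>] by auto
  show "\<phi> \<in> test_functions UNIV" using assms by (auto simp: test_functions_def)
qed

lemma test_function_add:
  assumes "\<phi> \<in> test_functions UNIV" "\<psi> \<in> test_functions UNIV"
  shows "(\<lambda>x. \<phi> x + \<psi> x) \<in> test_functions UNIV"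
proof -
  have "closure {x. \<phi> x + \<psi> x \<noteq> 0} \<subseteq> closure ({x. \<phi> x \<noteq> 0} \<union> {x. \<psi> x \<noteq> 0})"
    by (intro closure_mono) auto
  then have "closure {x. \<phi> x + \<psi> x \<noteq> 0} \<subseteq> closure {x. \<phi> x \<noteq> 0} \<union> closure {x. \<psi> x \<noteq> 0}"
    by simp
  moreover have "compact (closure {x. \<phi> x \<noteq> 0} \<union> closure {x. \<psi> x \<noteq> 0})"
    using assms test_functionsD(2) compact_Un by blast
  ultimately have "compact (closure {x. \<phi> x + \<psi> x \<noteq> 0})"
    by (meson bounded_subset closed_closure compact_eq_bounded_closed)
  then show ?thesis using assms by (simp add: test_functions_def C_k_add)
qed

lemma test_function_scale:
  assumes "\<phi> \<in> test_functions UNIV"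
  shows "(\<lambda>x. c * \<phi> x) \<in> test_functions UNIV"
proof -
  have "closure {x. c * \<phi> x \<noteq> 0} \<subseteq> closure {x. \<phi> x \<noteq> 0}"
    by (intro closure_mono) auto
  then have "compact (closure {x. c * \<phi> x \<noteq> 0})"
    using test_functionsD(2)[OF assms]
    by (meson bounded_subset closed_closure compact_eq_bounded_closed)
  then show ?thesis using assms by (simp add: test_functions_def C_k_scale)
qed

lemma classical_grad_add:
  assumes "\<phi> \<in> test_functions \<Omega>" "\<psi> \<in> test_functions \<Omega>'"
  shows "classical_grad (\<lambda>x. \<phi> x + \<psi> x) x = classical_grad \<phi> x + classical_grad \<psi> x"
  using partial_deriv_add[OF test_functionsD(4)[OF assms(1)] test_functionsD(4)[OF assms(2)]]
  by (simp add: classical_grad_def vec_eq_iff)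

lemma classical_grad_scale:
  assumes "\<phi> \<in> test_functions \<Omega>"
  shows "classical_grad (\<lambda>x. c * \<phi> x) x = c *\<^sub>R classical_grad \<phi> x"
  using partial_deriv_scale[OF test_functionsD(4)[OF assms]]
  by (simp add: classical_grad_def vec_eq_iff)

lemma test_function_has_derivative:
  assumes "\<phi> \<in> test_functions \<Omega>"
  shows "(\<phi> has_derivative (\<lambda>h. classical_grad \<phi> x \<bullet> h)) (at x)"
  by (rule differentiable_has_derivative_classical_grad[OF test_functionsD(4)[OF assms]])

lemma continuous_classical_grad:
  assumes "\<phi> \<in> test_functions \<Omega>"
  shows "continuous_on UNIV (classical_grad \<phi>)"
proof -
  have "C_k (Suc 0) \<phi>" using test_functionsD(1)[OF assms] .
  then have "continuous_on UNIV (partial_deriv i \<phi>)" for i by simp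
  then show ?thesis unfolding classical_grad_def[abs_def]
    by (intro continuous_on_vec_lambda) (simp add: eta_contract_eq)
qed

lemma classical_grad_eq_0:
  assumes "x \<notin> closure {x. \<phi> x \<noteq> 0}"
  shows "classical_grad \<phi> x = 0"
proof -
  have "((\<lambda>_. 0) has_derivative (\<lambda>_. 0)) (at x within UNIV)" by simp
  then have "(\<phi> has_derivative (\<lambda>_. 0)) (at x)"
    by (rule has_derivative_transform_within_open[where s = "- closure {x. \<phi> x \<noteq> 0}"])
       (use assms closure_subset[of "{x. \<phi> x \<noteq> 0}"] in auto)
  then show ?thesis by (simp add: classical_grad_def vec_eq_iff partial_deriv_eq)
qed

lemma continuous_compact_support_integrable:
  fixes f :: "real^'d \<Rightarrow> 'b::euclidean_space"
  assumes "continuous_on UNIV f" "compact K" "\<And>x. x \<notin> K \<Longrightarrow> f x = 0"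
  shows "f \<in> borel_measurable borel" "f \<in> borel_measurable lebesgue"
    "integrable lborel f" "integrable lebesgue f" "square_integrable lebesgue f"
proof -
  show m: "f \<in> borel_measurable borel" using assms(1) by (rule borel_measurable_continuous_onI)
  then show m': "f \<in> borel_measurable lebesgue"
    by (simp add: measurable_completion)
  have int: "integrable lborel g" if "continuous_on UNIV g" "\<And>x. x \<notin> K \<Longrightarrow> g x = 0"
    for g :: "real^'d \<Rightarrow> 'c::euclidean_space"
  proof -
    have "integrable lborel (\<lambda>x. indicator K x *\<^sub>R g x)"
      using assms(2) continuous_on_subset[OF that(1)] by (intro borel_integrable_compact) auto
    moreover have "(\<lambda>x. indicator K x *\<^sub>R g x) = g" using that(2) by (auto simp: indicator_def)
    ultimately show ?thesis by simp
  qed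
  show "integrable lborel f" using int assms by blast
  then show "integrable lebesgue f" using m by (simp add: integrable_completion)
  have c: "continuous_on UNIV (\<lambda>x. (norm (f x))\<^sup>2)" using assms(1) by (intro continuous_intros)
  then have "integrable lborel (\<lambda>x. (norm (f x))\<^sup>2)" using assms(3) by (intro int) auto
  moreover have "(\<lambda>x. (norm (f x))\<^sup>2) \<in> borel_measurable borel"
    using c by (rule borel_measurable_continuous_onI)
  ultimately have "integrable lebesgue (\<lambda>x. (norm (f x))\<^sup>2)" by (simp add: integrable_completion)
  then show "square_integrable lebesgue f" using m' by (simp add: square_integrable_def)
qed

lemma test_function_zero: "x \<notin> closure {x. \<phi> x \<noteq> 0} \<Longrightarrow> \<phi> x = 0"
  using closure_subset[of "{x. \<phi> x \<noteq> 0}"] by blast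

lemma test_function_square_integrable:
  assumes "\<phi> \<in> test_functions \<Omega>"
  shows "square_integrable lebesgue \<phi>"
  by (rule continuous_compact_support_integrable(5)[OF test_functionsD(5)[OF assms]
        test_functionsD(2)[OF assms]]) (rule test_function_zero)

lemma classical_grad_square_integrable:
  assumes "\<phi> \<in> test_functions \<Omega>"
  shows "square_integrable lebesgue (classical_grad \<phi>)"
  by (rule continuous_compact_support_integrable(5)[OF continuous_classical_grad[OF assms]
        test_functionsD(2)[OF assms]]) (rule classical_grad_eq_0)

text \<open>For \<open>j = 0\<close> this is the standard smooth function that vanishes on the negative half-line. Allowing
  powers of \<open>s\<close> in the denominator makes the family closed under differentiation, up to linear
  combinations.\<close>
definition flat :: "nat \<Rightarrow> real \<Rightarrow> real" where
  "flat j s = (if s > 0 then exp (- inverse s) / s ^ j else 0)"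

lemma flat_tendsto_0: "(flat j \<longlongrightarrow> 0) (at 0)"
proof (rule filterlim_split_at_real)
  have "(flat j \<longlongrightarrow> 0) (at_left 0) \<longleftrightarrow> ((\<lambda>_. 0) \<longlongrightarrow> (0::real)) (at_left (0::real))"
    by (intro tendsto_cong) (auto simp: flat_def eventually_at_filter)
  then show "(flat j \<longlongrightarrow> 0) (at_left 0)" by simp
  have "((\<lambda>x::real. x ^ j / exp x) \<longlongrightarrow> 0) at_top" by (rule tendsto_power_div_exp_0)
  moreover have "\<forall>\<^sub>F x in at_top. flat j (inverse x) = x ^ j / exp x"
    using eventually_gt_at_top[of "0::real"]
    by eventually_elim (simp add: flat_def exp_minus divide_inverse power_inverse mult.commute)
  ultimately have "((\<lambda>x. flat j (inverse x)) \<longlongrightarrow> 0) at_top"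
    by (simp cong: tendsto_cong)
  then show "(flat j \<longlongrightarrow> 0) (at_right 0)"
    by (simp add: filterlim_at_right_to_top)
qed

lemma DERIV_flat: "(flat j has_real_derivative flat (j + 2) s - real j * flat (j + 1) s) (at s)"
proof -
  consider "s > 0" | "s < 0" | "s = 0" by linarith
  then show ?thesis
  proof cases
    case 1
    have "((\<lambda>s. exp (- inverse s) * inverse s ^ j) has_real_derivative
        exp (- inverse s) * (inverse s)\<^sup>2 * inverse s ^ j
        - exp (- inverse s) * (real j * inverse s ^ (j - 1) * (inverse s)\<^sup>2)) (at s)"
      using 1 by (auto intro!: derivative_eq_intros simp: power2_eq_square)
    also have "exp (- inverse s) * (inverse s)\<^sup>2 * inverse s ^ j
        - exp (- inverse s) * (real j * inverse s ^ (j - 1) * (inverse s)\<^sup>2)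
        = flat (j + 2) s - real j * flat (j + 1) s"
      using 1 by (cases j) (simp_all add: flat_def field_simps power2_eq_square)
    finally have "((\<lambda>s. exp (- inverse s) * inverse s ^ j) has_real_derivative
        flat (j + 2) s - real j * flat (j + 1) s) (at s)" .
    then show ?thesis
      by (rule has_field_derivative_transform_within_open[where S = "{0<..}"])
         (use 1 in \<open>auto simp: flat_def field_simps\<close>)
  next
    case 2
    have "((\<lambda>s. 0) has_real_derivative 0) (at s)" by simp
    then have "(flat j has_real_derivative 0) (at s)"
      by (rule has_field_derivative_transform_within_open[where S = "{..<0}"])
         (use 2 in \<open>auto simp: flat_def\<close>)
    then show ?thesis using 2 by (simp add: flat_def)
  next
    case 3
    have "(flat j has_real_derivative 0) (at 0)"
      unfolding has_field_derivative_iff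
    proof (rule Lim_transform_eventually[OF flat_tendsto_0[of "Suc j"]])
      show "\<forall>\<^sub>F h in at 0. flat (Suc j) h = (flat j h - flat j 0) / (h - 0)"
        by (simp add: flat_def mult.commute)
    qed
    then show ?thesis using 3 by (simp add: flat_def)
  qed
qed

lemma flat_le_1: "flat 0 s \<le> 1" and flat_nonneg: "0 \<le> flat j s"
  by (auto simp: flat_def)

text \<open>Closed under partial derivatives and contained in the differentiable functions, hence consisting of
  smooth functions.\<close>
inductive_set flat_algebra :: "(real^'d \<Rightarrow> real) set" where
  const: "(\<lambda>_. c) \<in> flat_algebra"
| flat: "(\<lambda>x. flat j (a * x $ i + b)) \<in> flat_algebra"
| add: "f \<in> flat_algebra \<Longrightarrow> g \<in> flat_algebra \<Longrightarrow> (\<lambda>x. f x + g x) \<in> flat_algebra"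
| mult: "f \<in> flat_algebra \<Longrightarrow> g \<in> flat_algebra \<Longrightarrow> (\<lambda>x. f x * g x) \<in> flat_algebra"

lemma flat_algebra_derivative:
  assumes "f \<in> flat_algebra"
  shows "(\<forall>x. f differentiable at x) \<and> (\<forall>k. partial_deriv k f \<in> flat_algebra)"
  using assms
proof induction
  case (const c)
  have "partial_deriv k (\<lambda>_::real^'a. c) = (\<lambda>_. 0)" for k
    by (rule ext) (simp add: partial_deriv_def)
  then show ?case by (simp add: flat_algebra.const)
next
  case (flat j a i b)
  have D: "((\<lambda>x. flat j (a * x $ i + b)) has_derivative
      (\<lambda>h. (flat (j + 2) (a * x $ i + b) - real j * flat (j + 1) (a * x $ i + b)) * (a * h $ i))) (at x)"
    for x :: "real^'a"
  proof -
    have "((\<lambda>x. a * x $ i + b) has_derivative (\<lambda>h. a * h $ i)) (at x)"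
      by (auto intro!: derivative_eq_intros bounded_linear_imp_has_derivative bounded_linear_vec_nth)
    from has_derivative_compose[OF this DERIV_flat[unfolded has_field_derivative_def]]
    show ?thesis by simp
  qed
  have pd: "partial_deriv k (\<lambda>x. flat j (a * x $ i + b)) = (\<lambda>x. (if k = i then a else 0) *
      (flat (j + 2) (a * x $ i + b) + (- real j) * flat (j + 1) (a * x $ i + b)))" for k
    by (rule ext) (simp add: partial_deriv_eq[OF D] axis_def)
  show ?case
  proof (intro conjI allI)
    show "(\<lambda>x. flat j (a * x $ i + b)) differentiable at x" for x :: "real^'a"
      using D by (rule differentiableI)
    show "partial_deriv k (\<lambda>x. flat j (a * x $ i + b)) \<in> flat_algebra" for k
      unfolding pd by (intro flat_algebra.mult flat_algebra.add flat_algebra.const flat_algebra.flat)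
  qed
next
  case (add f g)
  then show ?case by (simp add: partial_deriv_add flat_algebra.add)
next
  case (mult f g)
  have "partial_deriv k (\<lambda>x. f x * g x) = (\<lambda>x. f x * partial_deriv k g x + partial_deriv k f x * g x)" for k
  proof
    fix x
    have "(f has_derivative frechet_derivative f (at x)) (at x)"
         "(g has_derivative frechet_derivative g (at x)) (at x)"
      using mult.IH by (auto simp: frechet_derivative_works)
    then show "partial_deriv k (\<lambda>x. f x * g x) x = f x * partial_deriv k g x + partial_deriv k f x * g x"
      by (subst partial_deriv_eq[OF has_derivative_mult]) (auto simp: partial_deriv_def)
  qed
  moreover have "(\<lambda>x. f x * partial_deriv k g x + partial_deriv k f x * g x) \<in> flat_algebra" for k
    using mult by (intro flat_algebra.add flat_algebra.mult) blast+
  ultimately show ?case using mult.IH by (simp add: differentiable_mult)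
qed

lemma flat_algebra_smooth: "f \<in> flat_algebra \<Longrightarrow> C_k k f"
proof (induction k arbitrary: f)
  case 0
  then show ?case using flat_algebra_derivative[OF 0]
    by (auto intro!: differentiable_imp_continuous_on simp: differentiable_on_def)
next
  case (Suc k)
  then show ?case using flat_algebra_derivative[OF Suc.prems] by auto
qed

lemma flat_algebra_prod:
  assumes "finite I" "\<And>i. i \<in> I \<Longrightarrow> f i \<in> flat_algebra"
  shows "(\<lambda>x. \<Prod>i\<in>I. f i x) \<in> flat_algebra"
  using assms
proof (induction I rule: finite_induct)
  case empty
  then show ?case using flat_algebra.const[of 1] by simp
next
  case (insert i I)
  then have "(\<lambda>x. f i x * (\<Prod>i\<in>I. f i x)) \<in> flat_algebra"
    by (intro flat_algebra.mult) auto
  then show ?case using insert by simp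
qed

text \<open>A smooth function supported in a box, increasing with \<open>n\<close> to the indicator function of its
  interior.\<close>
definition bump :: "real^'d \<Rightarrow> real^'d \<Rightarrow> nat \<Rightarrow> real^'d \<Rightarrow> real" where
  "bump a b n x = (\<Prod>i\<in>UNIV. flat 0 (real (Suc n) * (x $ i - a $ i)) * flat 0 (real (Suc n) * (b $ i - x $ i)))"

lemma bump_eq_0:
  assumes "x \<notin> box a b"
  shows "bump a b n x = 0"
proof -
  obtain i where "\<not> (a $ i < x $ i \<and> x $ i < b $ i)" using assms by (auto simp: mem_box_cart)
  then have "real (Suc n) * (x $ i - a $ i) \<le> 0 \<or> real (Suc n) * (b $ i - x $ i) \<le> 0"
    by (auto simp: mult_le_0_iff not_less)
  then have "flat 0 (real (Suc n) * (x $ i - a $ i)) * flat 0 (real (Suc n) * (b $ i - x $ i)) = 0"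
    by (auto simp: flat_def)
  then show ?thesis unfolding bump_def by (intro prod_zero) auto
qed

lemma bump_test_function: "bump a b n \<in> test_functions UNIV"
proof -
  have "(\<lambda>x. flat 0 (real (Suc n) * (x $ i - a $ i)) * flat 0 (real (Suc n) * (b $ i - x $ i))) \<in> flat_algebra" for i
    using flat_algebra.mult[OF flat_algebra.flat[of 0 "real (Suc n)" i "- real (Suc n) * a $ i"]
      flat_algebra.flat[of 0 "- real (Suc n)" i "real (Suc n) * b $ i"]] by (simp add: algebra_simps)
  then have "bump a b n \<in> flat_algebra"
    unfolding bump_def[abs_def] by (intro flat_algebra_prod) auto
  moreover have "closure {x. bump a b n x \<noteq> 0} \<subseteq> cbox a b"
    using bump_eq_0[of _ a b n] box_subset_cbox[of a b] by (intro closure_minimal) auto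
  then have "compact (closure {x. bump a b n x \<noteq> 0})"
    by (meson bounded_cbox bounded_subset closed_closure compact_eq_bounded_closed)
  ultimately show ?thesis by (simp add: test_functions_def flat_algebra_smooth)
qed

lemma bump_bounds: "0 \<le> bump a b n x" "bump a b n x \<le> 1"
  unfolding bump_def
  by (auto intro!: prod_nonneg prod_le_1 mult_nonneg_nonneg mult_le_one simp: flat_nonneg flat_le_1)

lemma flat_scaled_tendsto_1:
  fixes t :: real
  assumes "(t::real) > 0"
  shows "(\<lambda>n. flat 0 (real (Suc n) * t)) \<longlonglongrightarrow> 1"
proof -
  have "(\<lambda>n. exp (- (inverse (real (Suc n)) * inverse t))) \<longlonglongrightarrow> exp (- (0 * inverse t))"
    by (intro tendsto_intros LIMSEQ_inverse_real_of_nat)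
  moreover have "flat 0 (real (Suc n) * t) = exp (- (inverse (real (Suc n)) * inverse t))" for n
    using assms by (simp add: flat_def del: of_nat_Suc)
  ultimately show ?thesis by simp
qed

lemma bump_tendsto_indicator: "(\<lambda>n. bump a b n x) \<longlonglongrightarrow> indicator (box a b) x"
proof (cases "x \<in> box a b")
  case True
  have "(\<lambda>n. bump a b n x) \<longlonglongrightarrow> (\<Prod>i\<in>(UNIV :: 'a set). 1 * 1)"
    unfolding bump_def using True
    by (intro tendsto_prod tendsto_mult flat_scaled_tendsto_1) (simp_all add: mem_box_cart del: of_nat_Suc)
  then show ?thesis using True by simp
qed (simp add: bump_eq_0)

text \<open>By dominated convergence along the bump functions, the integral of \<open>g\<close> over every box vanishes. Almost
  every value of \<open>g\<close> is the limit of the means of \<open>g\<close> over shrinking cubes, by Lebesgue's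
  differentiation theorem.\<close>
theorem fundamental_lemma:
  fixes g :: "real^'d \<Rightarrow> real"
  assumes g: "square_integrable lebesgue g"
    and zero: "\<And>\<phi>. \<phi> \<in> test_functions UNIV \<Longrightarrow> (LINT x|lebesgue. g x * \<phi> x) = 0"
  shows "AE x in lebesgue. g x = 0"
proof -
  have "square_integrable lebesgue (\<lambda>x. indicator (cbox a b) x :: real)" for a b :: "real^'d"
  proof -
    have "integrable lebesgue (indicator (cbox a b) :: real^'d \<Rightarrow> real)"
      by (intro integrable_real_indicator) (auto simp: emeasure_lborel_cbox_eq)
    moreover have "(\<lambda>x. (norm (indicator (cbox a b) x :: real))\<^sup>2) = indicator (cbox a b)"
      by (auto simp: indicator_def)
    ultimately show ?thesis by (simp add: square_integrable_def)
  qed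
  then have int: "integrable lebesgue (\<lambda>x. g x * indicator (cbox a b) x)" for a b :: "real^'d"
    using square_integrable_mult[OF g] by blast
  then have sint: "set_integrable lebesgue (cbox a b) g" for a b
    by (simp add: set_integrable_def mult.commute)
  then have on: "g integrable_on cbox a b" for a b
    by (rule set_lebesgue_integral_eq_integral)
  have "integral (cbox a b) g = 0" for a b
  proof -
    have "(\<lambda>n. LINT x|lebesgue. g x * bump a b n x) \<longlonglongrightarrow> (LINT x|lebesgue. g x * indicator (box a b) x)"
    proof (rule integral_dominated_convergence)
      show "integrable lebesgue (\<lambda>x. \<bar>g x * indicator (cbox a b) x\<bar>)" using int by (rule integrable_abs)
      show "AE x in lebesgue. (\<lambda>n. g x * bump a b n x) \<longlonglongrightarrow> g x * indicator (box a b) x"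
        by (intro AE_I2 tendsto_intros bump_tendsto_indicator)
      have gm: "g \<in> borel_measurable lebesgue" using g by (rule square_integrable_measurable)
      show "(\<lambda>x. g x * bump a b n x) \<in> borel_measurable lebesgue" for n
        using gm square_integrable_measurable[OF test_function_square_integrable[OF bump_test_function]]
        by (rule borel_measurable_times)
      show "(\<lambda>x. g x * indicator (box a b) x) \<in> borel_measurable lebesgue"
        using gm by (intro borel_measurable_times borel_measurable_indicator) auto
      have "norm (g x * bump a b n x) \<le> \<bar>g x * indicator (cbox a b) x\<bar>" for n x
        using bump_bounds[of a b n x] bump_eq_0[of x a b n] box_subset_cbox[of a b]
        by (cases "x \<in> box a b") (auto simp: abs_mult mult_left_le)
      then show "AE x in lebesgue. norm (g x * bump a b n x) \<le> \<bar>g x * indicator (cbox a b) x\<bar>" for n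
        by simp
    qed
    then have "(LINT x|lebesgue. g x * indicator (box a b) x) = 0"
      using zero[OF bump_test_function] LIMSEQ_unique[OF _ tendsto_const] by simp
    moreover have "set_integrable lebesgue (box a b) g"
      using sint[of a b] absolutely_integrable_on_open_interval by blast
    ultimately have "integral (box a b) g = 0"
      by (simp add: set_lebesgue_integral_def mult.commute set_lebesgue_integral_eq_integral(2)[symmetric])
    then show ?thesis by (simp add: integral_open_interval)
  qed
  note null = this
  obtain N where N: "negligible N" "\<And>x e. \<lbrakk>x \<notin> N; 0 < e\<rbrakk> \<Longrightarrow> \<exists>d>0. \<forall>h. 0 < h \<and> h < d \<longrightarrow>
      norm (integral (cbox x (x + h *\<^sub>R One)) g /\<^sub>R h ^ DIM(real^'d) - g x) < e"
    by (rule integrable_ccontinuous_explicit[OF on]) blast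
  have "g x = 0" if xN: "x \<notin> N" for x
  proof (rule ccontr)
    assume "g x \<noteq> 0"
    then obtain d where "d > 0" "\<forall>h. 0 < h \<and> h < d \<longrightarrow>
      norm (integral (cbox x (x + h *\<^sub>R One)) g /\<^sub>R h ^ DIM(real^'d) - g x) < \<bar>g x\<bar>"
      using N(2)[OF xN, of "\<bar>g x\<bar>"] zero_less_abs_iff by metis
    then show False using null by (auto dest: spec[of _ "d / 2"])
  qed
  then show ?thesis
    using N(1) by (auto intro!: AE_I'[of N] simp: negligible_iff_null_sets)
qed

section \<open>Translation and Poincare estimates for test functions\<close>

lemma nn_integral_lborel_translate:
  fixes f :: "'a::euclidean_space \<Rightarrow> ennreal"
  assumes "f \<in> borel_measurable borel"
  shows "(\<integral>\<^sup>+x. f (x + c) \<partial>lborel) = (\<integral>\<^sup>+x. f x \<partial>lborel)"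
proof -
  have "(\<integral>\<^sup>+x. f x \<partial>lborel) = (\<integral>\<^sup>+x. f x \<partial>distr lborel borel ((+) c))"
    by (simp add: lborel_distr_plus)
  also have "\<dots> = (\<integral>\<^sup>+x. f (c + x) \<partial>lborel)"
    using assms by (intro nn_integral_distr) auto
  finally show ?thesis by (simp add: add.commute)
qed

lemma integral_lborel_translate:
  fixes f :: "'a::euclidean_space \<Rightarrow> real"
  assumes "f \<in> borel_measurable borel"
  shows "(LINT x|lborel. f (x + c)) = (LINT x|lborel. f x)"
proof -
  have "(LINT x|lborel. f x) = (LINT x|distr lborel borel ((+) c). f x)"
    by (simp add: lborel_distr_plus)
  also have "\<dots> = (LINT x|lborel. f (c + x))"
    using assms by (intro integral_distr) auto
  finally show ?thesis by (simp add: add.commute)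
qed

lemma nn_integral_lborel_eq_lebesgue:
  fixes f :: "'a::euclidean_space \<Rightarrow> real"
  assumes "integrable lborel f" "\<And>x. 0 \<le> f x"
  shows "(\<integral>\<^sup>+x. ennreal (f x) \<partial>lborel) = ennreal (LINT x|lebesgue. f x)"
  using assms borel_measurable_integrable[OF assms(1)]
  by (simp add: nn_integral_eq_integral integral_completion)

lemma continuous_nn_measurable:
  fixes f :: "'a::topological_space \<Rightarrow> real"
  assumes "continuous_on UNIV f"
  shows "(\<lambda>x. ennreal (f x)) \<in> borel_measurable borel"
  using borel_measurable_continuous_onI[OF assms] by measurable

text \<open>The increment \<open>m\<close> is the mean over \<open>{0..1}\<close> of the derivative \<open>g\<close> along the segment, and
  \<open>0 \<le> \<integral> (g - m)\<^sup>2 = \<integral> g\<^sup>2 - m\<^sup>2\<close>.\<close>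
lemma test_function_line_square_le:
  assumes "\<phi> \<in> test_functions UNIV"
  shows "ennreal ((\<phi> (x + h) - \<phi> x)\<^sup>2)
     \<le> (\<integral>\<^sup>+t. indicator {0..1::real} t * ennreal ((classical_grad \<phi> (x + t *\<^sub>R h) \<bullet> h)\<^sup>2) \<partial>lborel)"
proof -
  define g where "g = (\<lambda>t. classical_grad \<phi> (x + t *\<^sub>R h) \<bullet> h)"
  define m where "m = \<phi> (x + h) - \<phi> x"
  have g: "continuous_on {0..1} g"
    unfolding g_def
    by (intro continuous_intros continuous_on_compose2[OF continuous_classical_grad[OF assms]]) auto
  have "((\<lambda>t. \<phi> (x + t *\<^sub>R h)) has_vector_derivative g t) (at t within {0..1})" for t
  proof -
    have "((\<lambda>t. x + t *\<^sub>R h) has_derivative (\<lambda>t. t *\<^sub>R h)) (at t within {0..1})"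
      by (auto intro!: derivative_eq_intros)
    from has_derivative_compose[OF this test_function_has_derivative[OF assms]]
    show ?thesis by (simp add: has_vector_derivative_def g_def)
  qed
  then have gI: "(g has_integral m) {0..1}"
    using fundamental_theorem_of_calculus[of 0 1 "\<lambda>t. \<phi> (x + t *\<^sub>R h)" g] by (simp add: m_def)
  have "(\<lambda>t. (g t)\<^sup>2) integrable_on {0..1}"
    using g by (intro integrable_continuous_interval continuous_intros)
  then obtain J where J: "((\<lambda>t. (g t)\<^sup>2) has_integral J) {0..1}" by blast
  have c: "((\<lambda>_. m\<^sup>2) has_integral m\<^sup>2) {0..1::real}"
    using has_integral_const_real[of "m\<^sup>2" 0 1] by simp
  have "((\<lambda>t. (g t)\<^sup>2 - 2 * m * g t + m\<^sup>2) has_integral (J - 2 * m * m + m\<^sup>2)) {0..1}"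
    by (intro has_integral_add has_integral_diff J has_integral_mult_right gI c)
  moreover have "0 \<le> (g t)\<^sup>2 - 2 * m * g t + m\<^sup>2" for t
    using zero_le_power2[of "g t - m"] by (simp add: power2_diff algebra_simps)
  ultimately have "0 \<le> J - 2 * m * m + m\<^sup>2" by (rule has_integral_nonneg)
  then have "m\<^sup>2 \<le> J" by (simp add: power2_eq_square)
  moreover have "(\<integral>\<^sup>+t. ennreal (indicator {0..1::real} t * (g t)\<^sup>2) \<partial>lborel) = ennreal J"
    using J by (intro nn_integral_has_integral_lebesgue) auto
  ultimately show ?thesis
    by (simp add: g_def m_def ennreal_mult' ennreal_indicator ennreal_leI)
qed

text \<open>The estimate along a segment is integrated over all starting points; after exchanging the
  integrals, translation invariance removes the position \<open>t\<close> on the segment. Here and below, integrals of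
  nonnegative functions with respect to the Borel measure are used, to which Tonelli's theorem applies.\<close>
lemma nn_integral_translate_diff_le:
  assumes "\<phi> \<in> test_functions UNIV"
  shows "(\<integral>\<^sup>+x. ennreal ((\<phi> (x + h) - \<phi> x)\<^sup>2) \<partial>lborel)
     \<le> ennreal ((norm h)\<^sup>2 * sqnorm lebesgue (classical_grad \<phi>))"
proof -
  let ?G = "classical_grad \<phi>"
  have cG: "continuous_on UNIV ?G" by (rule continuous_classical_grad[OF assms])
  have c1: "continuous_on UNIV (\<lambda>(x, t). (?G (x + t *\<^sub>R h) \<bullet> h)\<^sup>2)"
    unfolding split_beta by (intro continuous_intros continuous_on_compose2[OF cG]) auto
  have meas: "(\<lambda>(x, t). indicator {0..1::real} t * ennreal ((?G (x + t *\<^sub>R h) \<bullet> h)\<^sup>2))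
      \<in> borel_measurable (lborel \<Otimes>\<^sub>M lborel)"
  proof -
    have "(\<lambda>z. ennreal ((\<lambda>(x, t). (?G (x + t *\<^sub>R h) \<bullet> h)\<^sup>2) z)) \<in> borel_measurable (lborel \<Otimes>\<^sub>M lborel)"
      using continuous_nn_measurable[OF c1] by (simp add: lborel_prod)
    moreover have "(\<lambda>z. indicator {0..1::real} (snd z)) \<in> borel_measurable (lborel \<Otimes>\<^sub>M lborel)"
      by (rule measurable_compose[OF measurable_snd]) simp
    ultimately have "(\<lambda>z. indicator {0..1::real} (snd z) * ennreal ((\<lambda>(x, t). (?G (x + t *\<^sub>R h) \<bullet> h)\<^sup>2) z))
      \<in> borel_measurable (lborel \<Otimes>\<^sub>M lborel)" by measurable
    then show ?thesis by (simp add: split_beta)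
  qed
  have c2: "continuous_on UNIV (\<lambda>x. (?G x \<bullet> h)\<^sup>2)" using cG by (intro continuous_intros)
  have int: "integrable lborel (\<lambda>x. (norm (?G x))\<^sup>2)"
    using cG by (intro continuous_compact_support_integrable(3)[OF _ test_functionsD(2)[OF assms]]
        continuous_intros) (simp_all add: classical_grad_eq_0)
  have "(\<integral>\<^sup>+x. ennreal ((\<phi> (x + h) - \<phi> x)\<^sup>2) \<partial>lborel)
    \<le> (\<integral>\<^sup>+x. (\<integral>\<^sup>+t. indicator {0..1::real} t * ennreal ((?G (x + t *\<^sub>R h) \<bullet> h)\<^sup>2) \<partial>lborel) \<partial>lborel)"
    by (intro nn_integral_mono test_function_line_square_le[OF assms])
  also have "\<dots> = (\<integral>\<^sup>+t. (\<integral>\<^sup>+x. indicator {0..1::real} t * ennreal ((?G (x + t *\<^sub>R h) \<bullet> h)\<^sup>2) \<partial>lborel) \<partial>lborel)"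
    using lborel_pair.Fubini'[OF meas] by simp
  also have "\<dots> = (\<integral>\<^sup>+t. indicator {0..1::real} t * (\<integral>\<^sup>+x. ennreal ((?G x \<bullet> h)\<^sup>2) \<partial>lborel) \<partial>lborel)"
  proof (intro nn_integral_cong)
    fix t :: real
    have c3: "continuous_on UNIV (\<lambda>x. (?G (x + t *\<^sub>R h) \<bullet> h)\<^sup>2)"
      by (intro continuous_intros continuous_on_compose2[OF cG]) auto
    show "(\<integral>\<^sup>+x. indicator {0..1::real} t * ennreal ((?G (x + t *\<^sub>R h) \<bullet> h)\<^sup>2) \<partial>lborel)
        = indicator {0..1::real} t * (\<integral>\<^sup>+x. ennreal ((?G x \<bullet> h)\<^sup>2) \<partial>lborel)"
      using nn_integral_lborel_translate[OF continuous_nn_measurable[OF c2], of "t *\<^sub>R h"]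
        continuous_nn_measurable[OF c3]
      by (subst nn_integral_cmult) auto
  qed
  also have "\<dots> = (\<integral>\<^sup>+x. ennreal ((?G x \<bullet> h)\<^sup>2) \<partial>lborel)"
    by (subst nn_integral_multc) auto
  also have "\<dots> \<le> (\<integral>\<^sup>+x. ennreal ((norm h)\<^sup>2 * (norm (?G x))\<^sup>2) \<partial>lborel)"
  proof (intro nn_integral_mono ennreal_leI)
    fix x
    have "(?G x \<bullet> h)\<^sup>2 \<le> (norm (?G x) * norm h)\<^sup>2"
      using Cauchy_Schwarz_ineq2[of "?G x" h] by (simp add: abs_le_square_iff[symmetric])
    then show "(?G x \<bullet> h)\<^sup>2 \<le> (norm h)\<^sup>2 * (norm (?G x))\<^sup>2"
      by (simp add: power_mult_distrib mult.commute)
  qed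
  also have "\<dots> = ennreal ((norm h)\<^sup>2 * sqnorm lebesgue ?G)"
    using int by (subst nn_integral_lborel_eq_lebesgue) auto
  finally show ?thesis .
qed

lemma ennreal_two_mult: "0 \<le> b \<Longrightarrow> 0 \<le> c \<Longrightarrow> ennreal (2 * b + 2 * c) = 2 * ennreal b + 2 * ennreal c"
  by (simp add: ennreal_mult')

lemma ennreal_le_two_mult:
  "a \<le> 2 * b + 2 * c \<Longrightarrow> 0 \<le> b \<Longrightarrow> 0 \<le> c \<Longrightarrow> ennreal a \<le> 2 * ennreal b + 2 * ennreal c"
  using ennreal_leI[of a "2 * b + 2 * c"] by (simp only: ennreal_two_mult)

text \<open>A translation that moves \<open>S\<close> off itself controls the mass in \<open>S\<close> by the gradient and the mass outside.\<close>
lemma test_function_translate_diff_le: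
  assumes "\<phi> \<in> test_functions UNIV" "S \<in> sets borel" "\<And>x. x \<in> S \<Longrightarrow> x + h \<notin> S"
  shows "(LINT x:S|lebesgue. (\<phi> x)\<^sup>2)
    \<le> 2 * (norm h)\<^sup>2 * sqnorm lebesgue (classical_grad \<phi>)
      + 2 * (LINT x:-S|lebesgue. (\<phi> x)\<^sup>2)"
proof -
  let ?I = "sqnorm lebesgue (classical_grad \<phi>)"
  have c: "continuous_on UNIV \<phi>" by (rule test_functionsD(5)[OF assms(1)])
  have cm[measurable]: "\<phi> \<in> borel_measurable borel" using c by (rule borel_measurable_continuous_onI)
  note S[measurable] = assms(2)
  have "integrable lborel (\<lambda>x. (\<phi> x)\<^sup>2)"
    by (rule continuous_compact_support_integrable(3)[OF continuous_on_power[OF c]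
          test_functionsD(2)[OF assms(1)]]) (drule test_function_zero, simp)
  then have int: "integrable lborel (\<lambda>x. indicator T x * (\<phi> x)\<^sup>2)" if "T \<in> sets borel" for T
    using that integrable_mult_indicator[of T lborel "\<lambda>x. (\<phi> x)\<^sup>2"] by simp
  have eq: "(\<integral>\<^sup>+x. ennreal (indicator T x * (\<phi> x)\<^sup>2) \<partial>lborel) = ennreal (LINT x:T|lebesgue. (\<phi> x)\<^sup>2)"
    if "T \<in> sets borel" for T
    using nn_integral_lborel_eq_lebesgue[OF int[OF that]] by (simp add: set_lebesgue_integral_def)
  have pos: "0 \<le> (norm h)\<^sup>2 * ?I" "0 \<le> (LINT x:-S|lebesgue. (\<phi> x)\<^sup>2)"
    unfolding set_lebesgue_integral_def
    by (intro mult_nonneg_nonneg integral_nonneg_AE AE_I2 zero_le_power2, simp)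
  have m1: "(\<lambda>x. ennreal ((\<phi> (x + h) - \<phi> x)\<^sup>2)) \<in> borel_measurable lborel"
    by measurable
  have m2: "(\<lambda>x. ennreal (indicator (- S) (x + h) * (\<phi> (x + h))\<^sup>2)) \<in> borel_measurable lborel"
    by measurable
  have "ennreal (LINT x:S|lebesgue. (\<phi> x)\<^sup>2) = (\<integral>\<^sup>+x. ennreal (indicator S x * (\<phi> x)\<^sup>2) \<partial>lborel)"
    using eq[OF S] by simp
  also have "\<dots> \<le> (\<integral>\<^sup>+x. 2 * ennreal ((\<phi> (x + h) - \<phi> x)\<^sup>2)
      + 2 * ennreal (indicator (- S) (x + h) * (\<phi> (x + h))\<^sup>2) \<partial>lborel)"
  proof (intro nn_integral_mono)
    fix x
    have "indicator S x * (\<phi> x)\<^sup>2 \<le> 2 * (\<phi> (x + h) - \<phi> x)\<^sup>2 + 2 * (indicator (- S) (x + h) * (\<phi> (x + h))\<^sup>2)"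
    proof (cases "x \<in> S")
      case True
      have "(\<phi> x)\<^sup>2 \<le> 2 * (\<phi> (x + h) - \<phi> x)\<^sup>2 + 2 * (\<phi> (x + h))\<^sup>2"
        using norm_diff_sq_le[of "\<phi> (x + h)" "\<phi> (x + h) - \<phi> x"] by simp
      then show ?thesis using True assms(3)[OF True] by simp
    qed simp
    then show "ennreal (indicator S x * (\<phi> x)\<^sup>2) \<le> 2 * ennreal ((\<phi> (x + h) - \<phi> x)\<^sup>2)
      + 2 * ennreal (indicator (- S) (x + h) * (\<phi> (x + h))\<^sup>2)"
      by (rule ennreal_le_two_mult) auto
  qed
  also have "\<dots> = 2 * (\<integral>\<^sup>+x. ennreal ((\<phi> (x + h) - \<phi> x)\<^sup>2) \<partial>lborel)
      + 2 * (\<integral>\<^sup>+x. ennreal (indicator (- S) (x + h) * (\<phi> (x + h))\<^sup>2) \<partial>lborel)"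
    unfolding nn_integral_cmult[OF m1, symmetric] nn_integral_cmult[OF m2, symmetric]
    by (intro nn_integral_add borel_measurable_times_ennreal m1 m2) simp_all
  also have "(\<integral>\<^sup>+x. ennreal (indicator (- S) (x + h) * (\<phi> (x + h))\<^sup>2) \<partial>lborel)
      = (\<integral>\<^sup>+x. ennreal (indicator (- S) x * (\<phi> x)\<^sup>2) \<partial>lborel)"
    by (rule nn_integral_lborel_translate[of "\<lambda>x. ennreal (indicator (- S) x * (\<phi> x)\<^sup>2)"]) measurable
  also have "\<dots> = ennreal (LINT x:-S|lebesgue. (\<phi> x)\<^sup>2)" using S by (intro eq) auto
  also have "2 * (\<integral>\<^sup>+x. ennreal ((\<phi> (x + h) - \<phi> x)\<^sup>2) \<partial>lborel) \<le> 2 * ennreal ((norm h)\<^sup>2 * ?I)"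
    by (intro mult_left_mono nn_integral_translate_diff_le[OF assms(1)]) auto
  finally have "ennreal (LINT x:S|lebesgue. (\<phi> x)\<^sup>2)
      \<le> 2 * ennreal ((norm h)\<^sup>2 * ?I) + 2 * ennreal (LINT x:-S|lebesgue. (\<phi> x)\<^sup>2)"
    by (simp only: add_right_mono)
  also have "\<dots> = ennreal (2 * ((norm h)\<^sup>2 * ?I) + 2 * (LINT x:-S|lebesgue. (\<phi> x)\<^sup>2))"
    using pos by (simp only: ennreal_two_mult)
  finally show ?thesis
    using ennreal_le_iff[of "2 * ((norm h)\<^sup>2 * ?I) + 2 * (LINT x:-S|lebesgue. (\<phi> x)\<^sup>2)"]
    using pos by (simp add: mult.assoc)
qed

text \<open>The difference quotients integrate to zero by translation invariance. They converge to the partial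
  derivative, dominated by the Lipschitz constant on a neighbourhood of the support.\<close>
lemma integral_partial_derivative_eq_0:
  fixes f :: "real^'d \<Rightarrow> real" and G :: "real^'d \<Rightarrow> real^'d"
  assumes deriv: "\<And>x. (f has_derivative (\<lambda>h. G x \<bullet> h)) (at x)"
    and G: "continuous_on UNIV G" and K: "compact K"
    and f0: "\<And>x. x \<notin> K \<Longrightarrow> f x = 0" and G0: "\<And>x. x \<notin> K \<Longrightarrow> G x = 0"
  shows "(LINT x|lborel. G x $ i) = 0"
proof -
  let ?e = "axis i 1 :: real^'d"
  define q where "q = (\<lambda>n x. (f (x + inverse (real (Suc n)) *\<^sub>R ?e) - f x) * real (Suc n))"
  define K' where "K' = {x + y | x y. x \<in> K \<and> y \<in> cball (0::real^'d) 1}"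
  have K': "compact K'" unfolding K'_def by (intro compact_sums K compact_cball)
  have fc: "continuous_on UNIV f"
    using has_derivative_continuous[OF deriv] by (simp add: continuous_on_eq_continuous_at)
  have "compact (G ` K)" using K G by (meson compact_continuous_image continuous_on_subset top_greatest)
  then obtain B0 where B0: "\<And>x. x \<in> K \<Longrightarrow> norm (G x) \<le> B0"
    using compact_imp_bounded bounded_iff by (metis imageI)
  define B where "B = max B0 0"
  have B: "norm (G x) \<le> B" for x
    using B0[of x] G0[of x] by (cases "x \<in> K") (auto simp: B_def)
  have lip: "norm (f (x + t *\<^sub>R ?e) - f x) \<le> B * \<bar>t\<bar>" for x t
  proof -
    have "norm (f (x + t *\<^sub>R ?e) - f x) \<le> B * norm (x + t *\<^sub>R ?e - x)"
    proof (rule differentiable_bound[of UNIV f "\<lambda>x h. G x \<bullet> h"])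
      show "onorm (\<lambda>h. G y \<bullet> h) \<le> B" for y
      proof (rule onorm_le)
        show "norm (G y \<bullet> h) \<le> B * norm h" for h
          using Cauchy_Schwarz_ineq2[of "G y" h] mult_right_mono[OF B[of y] norm_ge_zero[of h]] by simp
      qed
    qed (use deriv in auto)
    then show ?thesis by (simp add: norm_axis_1)
  qed
  have int: "integrable lborel f"
    by (rule continuous_compact_support_integrable(3)[OF fc K f0])
  have fm: "f \<in> borel_measurable borel" using fc by (rule borel_measurable_continuous_onI)
  have qc: "continuous_on UNIV (q n)" for n
    unfolding q_def by (intro continuous_intros continuous_on_compose2[OF fc]) auto
  have q0: "q n x = 0" if "x \<notin> K'" for n x
  proof -
    let ?t = "inverse (real (Suc n))"
    have "x \<notin> K"
    proof
      assume "x \<in> K"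
      then have "x + 0 \<in> K'" unfolding K'_def by (intro CollectI exI conjI refl) auto
      then show False using that by simp
    qed
    moreover have "x + ?t *\<^sub>R ?e \<notin> K"
    proof
      assume "x + ?t *\<^sub>R ?e \<in> K"
      moreover have "norm (- ?t *\<^sub>R ?e) \<le> 1" by (simp add: norm_axis_1 field_simps)
      ultimately have "(x + ?t *\<^sub>R ?e) + (- ?t *\<^sub>R ?e) \<in> K'"
        unfolding K'_def
        by (intro CollectI exI[of _ "x + ?t *\<^sub>R ?e"] exI[of _ "- ?t *\<^sub>R ?e"]) (simp del: of_nat_Suc)
      then show False using that by (simp del: of_nat_Suc)
    qed
    ultimately show ?thesis by (simp add: q_def f0)
  qed
  have qint: "integrable lborel (q n)" for n
    by (rule continuous_compact_support_integrable(3)[OF qc K' q0])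
  have "(LINT x|lborel. q n x) = 0" for n
  proof -
    let ?c = "inverse (real (Suc n)) *\<^sub>R ?e"
    have sc: "continuous_on UNIV (\<lambda>x. f (x + ?c))"
      by (intro continuous_intros continuous_on_compose2[OF fc]) auto
    have "integrable lborel (\<lambda>x. q n x * inverse (real (Suc n)) + f x)"
      using qint int by auto
    moreover have "q n x * inverse (real (Suc n)) + f x = f (x + ?c)" for x
      by (simp add: q_def mult.assoc del: of_nat_Suc)
    ultimately have "integrable lborel (\<lambda>x. f (x + ?c))" by (simp only:)
    then have "(LINT x|lborel. q n x) = ((LINT x|lborel. f (x + ?c)) - (LINT x|lborel. f x)) * real (Suc n)"
      using int by (simp add: q_def del: of_nat_Suc)
    then show ?thesis using integral_lborel_translate[OF fm] by simp
  qed
  moreover have "(\<lambda>n. LINT x|lborel. q n x) \<longlonglongrightarrow> (LINT x|lborel. G x $ i)"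
  proof (rule integral_dominated_convergence)
    have "emeasure lborel K' < \<infinity>" using K' emeasure_compact_finite by blast
    moreover have "K' \<in> sets lborel" using K' by (simp add: borel_compact)
    ultimately show "integrable lborel (\<lambda>x. B * indicator K' x)"
      by (intro integrable_mult_right integrable_real_indicator)
    have "continuous_on UNIV (\<lambda>x. G x $ i)" using G by (intro continuous_intros)
    then show "(\<lambda>x. G x $ i) \<in> borel_measurable lborel"
      using borel_measurable_continuous_onI by simp
    show "q n \<in> borel_measurable lborel" for n using qint by (rule borel_measurable_integrable)
    have "norm (q n x) \<le> B * indicator K' x" for n x
    proof (cases "x \<in> K'")
      case True
      have "\<bar>f (x + inverse (real (Suc n)) *\<^sub>R ?e) - f x\<bar> * real (Suc n)
          \<le> (B * \<bar>inverse (real (Suc n))\<bar>) * real (Suc n)"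
        using lip[of x "inverse (real (Suc n))"] by (intro mult_right_mono) auto
      also have "\<dots> = B" by simp
      finally show ?thesis using True by (simp add: q_def abs_mult del: of_nat_Suc)
    qed (simp add: q0)
    then show "AE x in lborel. norm (q n x) \<le> B * indicator K' x" for n by simp
    have "(\<lambda>n. q n x) \<longlonglongrightarrow> G x $ i" for x
    proof -
      have "((\<lambda>t. x + t *\<^sub>R ?e) has_derivative (\<lambda>t. t *\<^sub>R ?e)) (at 0)"
        by (auto intro!: derivative_eq_intros)
      from has_derivative_compose[OF this, of f "\<lambda>h. G x \<bullet> h"] deriv[of x]
      have "((\<lambda>t. f (x + t *\<^sub>R ?e)) has_derivative (\<lambda>t. t * (G x \<bullet> ?e))) (at 0)" by simp
      then have "((\<lambda>t. f (x + t *\<^sub>R ?e)) has_real_derivative (G x \<bullet> ?e)) (at 0)"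
        by (simp add: has_field_derivative_def mult.commute[of "G x \<bullet> ?e"] mult_commute_abs)
      then have lim: "((\<lambda>t. (f (x + t *\<^sub>R ?e) - f x) / t) \<longlongrightarrow> G x \<bullet> ?e) (at 0)"
        by (simp add: has_field_derivative_iff)
      have "filterlim (\<lambda>n. inverse (real (Suc n))) (at 0) sequentially"
        by (intro filterlim_atI LIMSEQ_inverse_real_of_nat) auto
      from filterlim_compose[OF lim this] show ?thesis
        by (simp add: q_def divide_inverse inner_axis del: of_nat_Suc)
    qed
    then show "AE x in lborel. (\<lambda>n. q n x) \<longlonglongrightarrow> G x $ i" by simp
  qed
  ultimately show ?thesis using LIMSEQ_unique[OF _ tendsto_const] by fastforce
qed

lemma test_function_integration_by_parts:
  assumes \<phi>: "\<phi> \<in> test_functions UNIV" and \<psi>: "\<psi> \<in> test_functions UNIV"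
  shows "(LINT x|lebesgue. \<phi> x * partial_deriv i \<psi> x) = - (LINT x|lebesgue. classical_grad \<phi> x $ i * \<psi> x)"
proof -
  let ?G = "\<lambda>x. \<phi> x *\<^sub>R classical_grad \<psi> x + \<psi> x *\<^sub>R classical_grad \<phi> x"
  have Gc: "continuous_on UNIV ?G"
    using test_functionsD(5)[OF \<phi>] test_functionsD(5)[OF \<psi>]
      continuous_classical_grad[OF \<phi>] continuous_classical_grad[OF \<psi>]
    by (intro continuous_intros)
  have "(LINT x|lborel. ?G x $ i) = 0"
  proof (rule integral_partial_derivative_eq_0[where f = "\<lambda>x. \<phi> x * \<psi> x"])
    show "((\<lambda>x. \<phi> x * \<psi> x) has_derivative (\<lambda>h. ?G x \<bullet> h)) (at x)" for x
      using has_derivative_mult[OF test_function_has_derivative[OF \<phi>] test_function_has_derivative[OF \<psi>]]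
      by (simp add: inner_add_left mult.commute)
    show "\<phi> x * \<psi> x = 0" if "x \<notin> closure {x. \<psi> x \<noteq> 0}" for x
      using test_function_zero[OF that] by simp
    show "?G x = 0" if "x \<notin> closure {x. \<psi> x \<noteq> 0}" for x
      using test_function_zero[OF that] classical_grad_eq_0[OF that] by simp
  qed (rule Gc test_functionsD(2)[OF \<psi>])+
  moreover have "(\<lambda>x. ?G x $ i) \<in> borel_measurable borel"
    by (rule borel_measurable_continuous_onI[OF continuous_on_component[OF Gc]])
  ultimately have "(LINT x|lebesgue. ?G x $ i) = 0" by (simp add: integral_completion)
  moreover have "integrable lebesgue (\<lambda>x. \<phi> x * partial_deriv i \<psi> x)"
    using square_integrable_mult[OF test_function_square_integrable[OF \<phi>]
        square_integrable_nth[OF classical_grad_square_integrable[OF \<psi>]]]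
    by (simp add: partial_deriv_eq_classical_grad)
  moreover have "integrable lebesgue (\<lambda>x. classical_grad \<phi> x $ i * \<psi> x)"
    using square_integrable_mult[OF square_integrable_nth[OF classical_grad_square_integrable[OF \<phi>]]
        test_function_square_integrable[OF \<psi>]] .
  ultimately show ?thesis by (simp add: partial_deriv_eq_classical_grad mult.commute)
qed

definition grid_index :: "real \<Rightarrow> real^'d \<Rightarrow> int^'d" where
  "grid_index s x = (\<chi> i. \<lfloor>x $ i / s\<rfloor>)"

definition grid_cell :: "real \<Rightarrow> int^'d \<Rightarrow> (real^'d) set" where
  "grid_cell s k = {x. grid_index s x = k}"

lemma grid_cell_between_boxes:
  assumes "s > 0"
  defines "l \<equiv> \<lambda>k::int^'d. (\<chi> i. s * real_of_int (k $ i)) :: real^'d"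
  shows "box (l k) (\<chi> i. l k $ i + s) \<subseteq> grid_cell s k" "grid_cell s k \<subseteq> cbox (l k) (\<chi> i. l k $ i + s)"
  using assms
  by (auto simp: grid_cell_def grid_index_def vec_eq_iff mem_box_cart floor_eq_iff field_simps
      intro: less_imp_le) (metis less_imp_le)

lemma grid_cell_borel: "grid_cell s k \<in> sets borel"
proof -
  have "(\<lambda>x::real^'a. x $ i / s) \<in> borel_measurable borel" for i
    by (intro borel_measurable_continuous_onI) (auto simp: divide_inverse intro!: continuous_intros)
  then have "{x \<in> space borel. \<lfloor>x $ i / s\<rfloor> = k $ i} \<in> sets (borel :: (real^'a) measure)" for i
    by measurable
  moreover have "grid_cell s k = (\<Inter>i\<in>UNIV. {x \<in> space borel. \<lfloor>x $ i / s\<rfloor> = k $ i})"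
    by (auto simp: grid_cell_def grid_index_def vec_eq_iff)
  ultimately show ?thesis by (metis (no_types, lifting) sets.finite_INT finite UNIV_not_empty)
qed

lemma emeasure_cbox_cart:
  fixes l u :: "real^'d"
  assumes "\<And>i. l $ i \<le> u $ i"
  shows "emeasure lborel (cbox l u) = ennreal (\<Prod>i\<in>UNIV. u $ i - l $ i)"
    "emeasure lborel (box l u) = ennreal (\<Prod>i\<in>UNIV. u $ i - l $ i)"
proof -
  have "cbox l u \<noteq> {}" using assms by (simp add: interval_ne_empty_cart)
  then have "measure lborel (cbox l u) = (\<Prod>i\<in>UNIV. u $ i - l $ i)" by (rule content_cbox_cart)
  then show "emeasure lborel (cbox l u) = ennreal (\<Prod>i\<in>UNIV. u $ i - l $ i)"
    using emeasure_eq_ennreal_measure[of lborel "cbox l u"] emeasure_lborel_cbox_finite[of l u] by simp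
  then show "emeasure lborel (box l u) = ennreal (\<Prod>i\<in>UNIV. u $ i - l $ i)"
    by (simp add: emeasure_lborel_cbox_eq emeasure_lborel_box_eq)
qed

lemma emeasure_grid_cell:
  fixes k :: "int^'d"
  assumes "s > 0"
  shows "emeasure lborel (grid_cell s k) = ennreal (s ^ CARD('d))"
proof (rule antisym)
  let ?l = "(\<chi> i. s * real_of_int (k $ i)) :: real^'d"
  let ?u = "(\<chi> i. ?l $ i + s) :: real^'d"
  have le: "?l $ i \<le> ?u $ i" for i using assms by simp
  have "emeasure lborel (grid_cell s k) \<le> emeasure lborel (cbox ?l ?u)"
    using grid_cell_between_boxes(2)[OF assms] by (intro emeasure_mono) auto
  then show "emeasure lborel (grid_cell s k) \<le> ennreal (s ^ CARD('d))"
    using emeasure_cbox_cart(1)[OF le] by simp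
  have "emeasure lborel (box ?l ?u) \<le> emeasure lborel (grid_cell s k)"
    using grid_cell_between_boxes(1)[OF assms] grid_cell_borel by (intro emeasure_mono) auto
  then show "ennreal (s ^ CARD('d)) \<le> emeasure lborel (grid_cell s k)"
    using emeasure_cbox_cart(2)[OF le] by simp
qed

lemma cube_eq_cbox: "cube s = cbox (\<chi> i. - s) (\<chi> i. s)"
  by (auto simp: cube_def mem_box_cart)

lemma emeasure_cube: "s \<ge> 0 \<Longrightarrow> emeasure lborel (cube s :: (real^'d) set) = ennreal ((2 * s) ^ CARD('d))"
  unfolding cube_eq_cbox by (subst emeasure_cbox_cart) auto

lemma grid_cell_diff_cube:
  assumes "s > 0" "x \<in> grid_cell s k" "y \<in> grid_cell s k"
  shows "y - x \<in> cube s"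
proof -
  have "\<bar>y $ i - x $ i\<bar> \<le> s" for i
  proof -
    have "\<lfloor>x $ i / s\<rfloor> = \<lfloor>y $ i / s\<rfloor>"
      using assms by (auto simp: grid_cell_def grid_index_def vec_eq_iff)
    then have "\<bar>y $ i / s - x $ i / s\<bar> \<le> 1" by linarith
    then have "\<bar>y $ i - x $ i\<bar> / s \<le> 1" using assms(1) by (simp add: abs_div_pos diff_divide_distrib)
    then show ?thesis using assms(1) by simp
  qed
  then have "- s \<le> y $ i - x $ i \<and> y $ i - x $ i \<le> s" for i by (metis abs_le_iff minus_le_iff)
  then show ?thesis by (simp add: cube_def)
qed

lemma norm_cube_le:
  fixes s :: real
  assumes "(h :: real^'d) \<in> cube s"
  shows "norm h \<le> CARD('d) * s"
proof -
  have "norm h \<le> (\<Sum>i\<in>UNIV. \<bar>h $ i\<bar>)" by (rule norm_le_l1_cart)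
  also have "\<dots> \<le> (\<Sum>i\<in>(UNIV::'d set). s)"
    using assms by (intro sum_mono) (simp add: cube_def abs_le_iff minus_le_iff)
  finally show ?thesis by simp
qed

text \<open>The first two parts combine to the variance identity: the double integral over \<open>Q\<close> of the
  squared difference is twice \<open>q \<integral> \<phi>\<^sup>2 - (\<integral> \<phi>)\<^sup>2\<close>.\<close>
lemma nn_integral_square_difference:
  assumes \<phi>: "\<phi> \<in> test_functions UNIV" and Q: "Q \<in> sets borel" "emeasure lborel Q = ennreal q" "q \<ge> 0"
  defines "I \<equiv> LINT x|lborel. indicator Q x * \<phi> x" and "J \<equiv> LINT x|lborel. indicator Q x * (\<phi> x)\<^sup>2"
  shows "(\<integral>\<^sup>+y. indicator Q x * indicator Q y * ennreal ((\<phi> y - \<phi> x)\<^sup>2) \<partial>lborel)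
      = ennreal (indicator Q x * (J - 2 * \<phi> x * I + q * (\<phi> x)\<^sup>2))" (is ?inner)
    and "(\<integral>\<^sup>+x. ennreal (indicator Q x * (J - 2 * \<phi> x * I + q * (\<phi> x)\<^sup>2)) \<partial>lborel)
      = ennreal (2 * q * J - 2 * I\<^sup>2)" (is ?outer)
    and "0 \<le> 2 * q * J - 2 * I\<^sup>2"
proof -
  have c: "continuous_on UNIV \<phi>" by (rule test_functionsD(5)[OF \<phi>])
  have int1: "integrable lborel \<phi>"
    by (rule continuous_compact_support_integrable(3)[OF c test_functionsD(2)[OF \<phi>]])
       (rule test_function_zero)
  have int2: "integrable lborel (\<lambda>x. (\<phi> x)\<^sup>2)"
    by (rule continuous_compact_support_integrable(3)[OF continuous_on_power[OF c]
          test_functionsD(2)[OF \<phi>]]) (drule test_function_zero, simp)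
  have i0: "integrable lborel (indicator Q :: _ \<Rightarrow> real)"
    using Q by (intro integrable_real_indicator) auto
  have m0: "measure lborel Q = q"
    using Q by (simp add: measure_def)
  have i1: "integrable lborel (\<lambda>x. indicator Q x * \<phi> x)"
    using integrable_mult_indicator[of Q lborel \<phi>] int1 Q by simp
  have i2: "integrable lborel (\<lambda>x. indicator Q x * (\<phi> x)\<^sup>2)"
    using integrable_mult_indicator[of Q lborel "\<lambda>x. (\<phi> x)\<^sup>2"] int2 Q by simp
  have expand: "indicator Q y * (\<phi> y - t)\<^sup>2
      = indicator Q y * (\<phi> y)\<^sup>2 - 2 * t * (indicator Q y * \<phi> y) + t\<^sup>2 * indicator Q y" for y t
    by (simp add: power2_diff algebra_simps)
  have it: "integrable lborel (\<lambda>y. indicator Q y * (\<phi> y - t)\<^sup>2)" for t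
    unfolding expand using i0 i1 i2 by (intro Bochner_Integration.integrable_add Bochner_Integration.integrable_diff integrable_mult_right) auto
  have val: "(LINT y|lborel. indicator Q y * (\<phi> y - t)\<^sup>2) = J - 2 * t * I + q * t\<^sup>2" for t
    unfolding expand using i0 i1 i2 by (simp add: m0 I_def J_def)
  have nonneg: "0 \<le> J - 2 * t * I + q * t\<^sup>2" for t
    unfolding val[symmetric] by (intro integral_nonneg_AE AE_I2) simp
  have "(\<integral>\<^sup>+y. indicator Q x * indicator Q y * ennreal ((\<phi> y - \<phi> x)\<^sup>2) \<partial>lborel)
     = (\<integral>\<^sup>+y. indicator Q x * ennreal (indicator Q y * (\<phi> y - \<phi> x)\<^sup>2) \<partial>lborel)"
    by (intro nn_integral_cong) (simp add: ennreal_mult' ennreal_indicator mult.assoc)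
  also have "\<dots> = indicator Q x * (\<integral>\<^sup>+y. ennreal (indicator Q y * (\<phi> y - \<phi> x)\<^sup>2) \<partial>lborel)"
    using it by (intro nn_integral_cmult) (simp add: borel_measurable_integrable)
  also have "(\<integral>\<^sup>+y. ennreal (indicator Q y * (\<phi> y - \<phi> x)\<^sup>2) \<partial>lborel) = ennreal (J - 2 * \<phi> x * I + q * (\<phi> x)\<^sup>2)"
    using it by (subst nn_integral_eq_integral) (auto simp: val)
  finally show ?inner by (simp add: ennreal_mult' ennreal_indicator)
  have e2: "indicator Q x * (J - 2 * \<phi> x * I + q * (\<phi> x)\<^sup>2)
     = J * indicator Q x - 2 * I * (indicator Q x * \<phi> x) + q * (indicator Q x * (\<phi> x)\<^sup>2)" for x
    by (simp add: algebra_simps)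
  have int: "integrable lborel (\<lambda>x. indicator Q x * (J - 2 * \<phi> x * I + q * (\<phi> x)\<^sup>2))"
    unfolding e2 using i0 i1 i2 by (intro Bochner_Integration.integrable_add Bochner_Integration.integrable_diff integrable_mult_right) auto
  have "(LINT x|lborel. indicator Q x * (J - 2 * \<phi> x * I + q * (\<phi> x)\<^sup>2)) = J * q - 2 * I * I + q * J"
    unfolding e2 using i0 i1 i2 by (simp add: m0 I_def[symmetric] J_def[symmetric])
  also have "\<dots> = 2 * q * J - 2 * I\<^sup>2" by (simp add: power2_eq_square)
  finally have val2: "(LINT x|lborel. indicator Q x * (J - 2 * \<phi> x * I + q * (\<phi> x)\<^sup>2)) = 2 * q * J - 2 * I\<^sup>2" .
  have nn: "0 \<le> indicator Q x * (J - 2 * \<phi> x * I + q * (\<phi> x)\<^sup>2)" for x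
    using nonneg by (intro mult_nonneg_nonneg) auto
  show "0 \<le> 2 * q * J - 2 * I\<^sup>2"
    unfolding val2[symmetric] using nn by (intro integral_nonneg_AE AE_I2)
  show ?outer using int nn by (subst nn_integral_eq_integral) (auto simp: val2)
qed

text \<open>By the variance identity, the deviation of \<open>\<phi>\<close> from its cell means is a double integral over pairs of
  points in a common cell. Such pairs differ by a vector \<open>h\<close> of the cube of half-width \<open>s\<close>, so the sum
  over all cells is at most the integral over \<open>h\<close> of the squared distance in the mean of \<open>\<phi>\<close> and its
  translate by \<open>h\<close>. The cube has \<open>2\<^sup>d\<close> times the volume \<open>s\<^sup>d\<close> of a cell, and \<open>norm h \<le> d s\<close>.\<close>
theorem grid_Poincare:
  fixes \<phi> :: "real^'d \<Rightarrow> real" and s :: real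
  assumes \<phi>: "\<phi> \<in> test_functions UNIV" and s: "s > 0" and K: "finite K"
  shows "(LINT x:(\<Union>k\<in>K. grid_cell s k)|lebesgue. (\<phi> x)\<^sup>2)
    \<le> 2 ^ CARD('d) * (CARD('d))\<^sup>2 * s\<^sup>2 * sqnorm lebesgue (classical_grad \<phi>)
      + (\<Sum>k\<in>K. (LINT x:grid_cell s k|lebesgue. \<phi> x)\<^sup>2) / s ^ CARD('d)"
proof -
  let ?d = "CARD('d)"
  let ?G = "sqnorm lebesgue (classical_grad \<phi>)"
  define I where "I = (\<lambda>k. LINT x|lborel. indicator (grid_cell s k) x * \<phi> x)"
  define J where "J = (\<lambda>k. LINT x|lborel. indicator (grid_cell s k) x * (\<phi> x)\<^sup>2)"
  define q where "q = s ^ ?d"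
  have q: "q > 0" using s by (simp add: q_def)
  have c: "continuous_on UNIV \<phi>" by (rule test_functionsD(5)[OF \<phi>])
  have cm[measurable]: "\<phi> \<in> borel_measurable borel" using c by (rule borel_measurable_continuous_onI)
  have cell[measurable]: "grid_cell s k \<in> sets borel" for k :: "int^'d" by (rule grid_cell_borel)
  have meas: "emeasure lborel (grid_cell s k) = ennreal q" for k :: "int^'d"
    using emeasure_grid_cell[OF s] by (simp add: q_def)
  note sq = nn_integral_square_difference[OF \<phi> cell meas less_imp_le[OF q]]
  have inner: "(\<integral>\<^sup>+y. indicator (grid_cell s k) x * indicator (grid_cell s k) y * ennreal ((\<phi> y - \<phi> x)\<^sup>2) \<partial>lborel)
      = ennreal (indicator (grid_cell s k) x * (J k - 2 * \<phi> x * I k + q * (\<phi> x)\<^sup>2))" for k x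
    unfolding I_def J_def by (rule sq(1))
  have outer: "(\<integral>\<^sup>+x. ennreal (indicator (grid_cell s k) x * (J k - 2 * \<phi> x * I k + q * (\<phi> x)\<^sup>2)) \<partial>lborel)
      = ennreal (2 * q * J k - 2 * (I k)\<^sup>2)" for k
    unfolding I_def J_def by (rule sq(2))
  have nonneg: "0 \<le> 2 * q * J k - 2 * (I k)\<^sup>2" for k
    unfolding I_def J_def by (rule sq(3))
  have fm: "(\<lambda>y. (\<phi> y - \<phi> x)\<^sup>2) \<in> borel_measurable borel" for x by measurable
  have "ennreal (\<Sum>k\<in>K. 2 * q * J k - 2 * (I k)\<^sup>2) = (\<Sum>k\<in>K. ennreal (2 * q * J k - 2 * (I k)\<^sup>2))"
    by (simp only: sum_ennreal[OF nonneg])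
  also have "\<dots> = (\<Sum>k\<in>K. \<integral>\<^sup>+x. (\<integral>\<^sup>+y. indicator (grid_cell s k) x * indicator (grid_cell s k) y
        * ennreal ((\<phi> y - \<phi> x)\<^sup>2) \<partial>lborel) \<partial>lborel)"
    unfolding inner outer ..
  also have "\<dots> = (\<integral>\<^sup>+x. (\<Sum>k\<in>K. \<integral>\<^sup>+y. indicator (grid_cell s k) x * indicator (grid_cell s k) y
        * ennreal ((\<phi> y - \<phi> x)\<^sup>2) \<partial>lborel) \<partial>lborel)"
    unfolding inner by (intro nn_integral_sum[symmetric]) measurable
  also have "\<dots> \<le> (\<integral>\<^sup>+x. (\<integral>\<^sup>+y. indicator (cube s) (y - x) * ennreal ((\<phi> y - \<phi> x)\<^sup>2) \<partial>lborel) \<partial>lborel)"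
  proof (rule nn_integral_mono)
    fix x :: "real^'d"
    have "(\<Sum>k\<in>K. \<integral>\<^sup>+y. indicator (grid_cell s k) x * indicator (grid_cell s k) y * ennreal ((\<phi> y - \<phi> x)\<^sup>2) \<partial>lborel)
       = (\<integral>\<^sup>+y. (\<Sum>k\<in>K. indicator (grid_cell s k) x * indicator (grid_cell s k) y * ennreal ((\<phi> y - \<phi> x)\<^sup>2)) \<partial>lborel)"
      using fm[of x] by (intro nn_integral_sum[symmetric]) measurable
    also have "\<dots> \<le> (\<integral>\<^sup>+y. indicator (cube s) (y - x) * ennreal ((\<phi> y - \<phi> x)\<^sup>2) \<partial>lborel)"
    proof (rule nn_integral_mono)
      fix y :: "real^'d"
      let ?e = "ennreal ((\<phi> y - \<phi> x)\<^sup>2)"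
      have "(\<Sum>k\<in>K. indicator (grid_cell s k) x * indicator (grid_cell s k) y * ?e)
         \<le> (\<Sum>k\<in>K. if k = grid_index s x then indicator (cube s) (y - x) * ?e else 0)"
      proof (intro sum_mono)
        fix k
        show "indicator (grid_cell s k) x * indicator (grid_cell s k) y * ?e
            \<le> (if k = grid_index s x then indicator (cube s) (y - x) * ?e else 0)"
          using grid_cell_diff_cube[OF s, of x k y]
          by (cases "x \<in> grid_cell s k"; cases "y \<in> grid_cell s k") (auto simp: grid_cell_def)
      qed
      also have "\<dots> \<le> indicator (cube s) (y - x) * ?e"
        using K by (simp add: sum.delta)
      finally show "(\<Sum>k\<in>K. indicator (grid_cell s k) x * indicator (grid_cell s k) y * ?e)
         \<le> indicator (cube s) (y - x) * ?e" .
    qed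
    finally show "(\<Sum>k\<in>K. \<integral>\<^sup>+y. indicator (grid_cell s k) x * indicator (grid_cell s k) y * ennreal ((\<phi> y - \<phi> x)\<^sup>2) \<partial>lborel)
       \<le> (\<integral>\<^sup>+y. indicator (cube s) (y - x) * ennreal ((\<phi> y - \<phi> x)\<^sup>2) \<partial>lborel)" .
  qed
  also have "\<dots> = (\<integral>\<^sup>+x. (\<integral>\<^sup>+h. indicator (cube s) h * ennreal ((\<phi> (x + h) - \<phi> x)\<^sup>2) \<partial>lborel) \<partial>lborel)"
  proof (rule nn_integral_cong)
    fix x :: "real^'d"
    have cube: "cube s \<in> sets (borel :: (real^'d) measure)" by (simp add: cube_eq_cbox)
    have "(\<lambda>y. indicator (cube s) (y - x) :: ennreal) \<in> borel_measurable borel"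
      by (rule measurable_compose[of "\<lambda>y. y - x" borel borel]) (use cube in auto)
    then have "(\<lambda>y. indicator (cube s) (y - x) * ennreal ((\<phi> y - \<phi> x)\<^sup>2)) \<in> borel_measurable borel"
      using fm[of x] by measurable
    from nn_integral_lborel_translate[OF this, of x]
    show "(\<integral>\<^sup>+y. indicator (cube s) (y - x) * ennreal ((\<phi> y - \<phi> x)\<^sup>2) \<partial>lborel)
        = (\<integral>\<^sup>+h. indicator (cube s) h * ennreal ((\<phi> (x + h) - \<phi> x)\<^sup>2) \<partial>lborel)"
      by (simp add: add.commute)
  qed
  also have "\<dots> = (\<integral>\<^sup>+h. (\<integral>\<^sup>+x. indicator (cube s) h * ennreal ((\<phi> (x + h) - \<phi> x)\<^sup>2) \<partial>lborel) \<partial>lborel)"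
  proof -
    have cube: "cube s \<in> sets (borel :: (real^'d) measure)" by (simp add: cube_eq_cbox)
    have "continuous_on UNIV (\<lambda>z::(real^'d) \<times> (real^'d). (\<phi> (fst z + snd z) - \<phi> (fst z))\<^sup>2)"
      by (intro continuous_intros continuous_on_compose2[OF c]) auto
    then have m1: "(\<lambda>z. ennreal ((\<phi> (fst z + snd z) - \<phi> (fst z))\<^sup>2)) \<in> borel_measurable (lborel \<Otimes>\<^sub>M lborel)"
      unfolding lborel_prod measurable_lborel2 by (rule continuous_nn_measurable)
    have m2: "(\<lambda>z::(real^'d) \<times> (real^'d). indicator (cube s) (snd z) :: ennreal) \<in> borel_measurable (lborel \<Otimes>\<^sub>M lborel)"
      by (rule measurable_compose[OF measurable_snd]) (use cube in auto)
    have "(\<lambda>(x, h). indicator (cube s) h * ennreal ((\<phi> (x + h) - \<phi> x)\<^sup>2)) \<in> borel_measurable (lborel \<Otimes>\<^sub>M lborel)"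
      using borel_measurable_times_ennreal[OF m2 m1] by (simp add: split_beta)
    from lborel_pair.Fubini'[OF this] show ?thesis by simp
  qed
  also have "\<dots> \<le> (\<integral>\<^sup>+h. ennreal ((real ?d * s)\<^sup>2 * ?G) * indicator (cube s :: (real^'d) set) h \<partial>lborel)"
  proof (rule nn_integral_mono)
    fix h :: "real^'d"
    show "(\<integral>\<^sup>+x. indicator (cube s) h * ennreal ((\<phi> (x + h) - \<phi> x)\<^sup>2) \<partial>lborel)
      \<le> ennreal ((real ?d * s)\<^sup>2 * ?G) * indicator (cube s) h"
    proof (cases "h \<in> cube s")
      case True
      have "(\<integral>\<^sup>+x. ennreal ((\<phi> (x + h) - \<phi> x)\<^sup>2) \<partial>lborel) \<le> ennreal ((norm h)\<^sup>2 * ?G)"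
        by (rule nn_integral_translate_diff_le[OF \<phi>])
      also have "\<dots> \<le> ennreal ((real ?d * s)\<^sup>2 * ?G)"
        using norm_cube_le[OF True] by (intro ennreal_leI mult_right_mono power_mono) auto
      finally show ?thesis using True by simp
    qed simp
  qed
  also have "\<dots> = ennreal ((real ?d * s)\<^sup>2 * ?G) * emeasure lborel (cube s :: (real^'d) set)"
    by (intro nn_integral_cmult_indicator) (simp add: cube_eq_cbox)
  also have "\<dots> = ennreal (((real ?d * s)\<^sup>2 * ?G) * (2 * s) ^ ?d)"
    using s by (simp add: emeasure_cube ennreal_mult'')
  finally have "(\<Sum>k\<in>K. 2 * q * J k - 2 * (I k)\<^sup>2) \<le> ((real ?d * s)\<^sup>2 * ?G) * (2 * s) ^ ?d"
    using s by (subst (asm) ennreal_le_iff) (auto intro!: mult_nonneg_nonneg)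
  also have "\<dots> = q * (2 ^ ?d * (real ?d)\<^sup>2 * s\<^sup>2 * ?G)" by (simp add: q_def power_mult_distrib)
  finally have "2 * q * (\<Sum>k\<in>K. J k) \<le> 2 * (\<Sum>k\<in>K. (I k)\<^sup>2) + q * (2 ^ ?d * (real ?d)\<^sup>2 * s\<^sup>2 * ?G)"
    by (simp add: sum_subtractf sum_distrib_left)
  moreover have "0 \<le> q * (2 ^ ?d * (real ?d)\<^sup>2 * s\<^sup>2 * ?G)" using q by simp
  ultimately have "q * (\<Sum>k\<in>K. J k) \<le> (\<Sum>k\<in>K. (I k)\<^sup>2) + q * (2 ^ ?d * (real ?d)\<^sup>2 * s\<^sup>2 * ?G)" by linarith
  then have main: "(\<Sum>k\<in>K. J k) \<le> 2 ^ ?d * (real ?d)\<^sup>2 * s\<^sup>2 * ?G + (\<Sum>k\<in>K. (I k)\<^sup>2) / q"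
    using q by (simp add: field_simps)
  have J: "(LINT x:(\<Union>k\<in>K. grid_cell s k)|lebesgue. (\<phi> x)\<^sup>2) = (\<Sum>k\<in>K. J k)"
  proof -
    have int2: "integrable lborel (\<lambda>x. (\<phi> x)\<^sup>2)"
      by (rule continuous_compact_support_integrable(3)[OF continuous_on_power[OF c]
            test_functionsD(2)[OF \<phi>]]) (drule test_function_zero, simp)
    have "(LINT x:(\<Union>k\<in>K. grid_cell s k)|lebesgue. (\<phi> x)\<^sup>2)
        = (LINT x|lebesgue. (\<Sum>k\<in>K. indicator (grid_cell s k) x * (\<phi> x)\<^sup>2))"
      unfolding set_lebesgue_integral_def
    proof (intro Bochner_Integration.integral_cong refl)
      fix x :: "real^'d"
      have "(\<Sum>k\<in>K. indicator (grid_cell s k) x * (\<phi> x)\<^sup>2)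
          = (\<Sum>k\<in>K. if k = grid_index s x then (\<phi> x)\<^sup>2 else 0)"
        by (intro sum.cong) (auto simp: grid_cell_def indicator_def)
      then show "indicator (\<Union>k\<in>K. grid_cell s k) x *\<^sub>R (\<phi> x)\<^sup>2
          = (\<Sum>k\<in>K. indicator (grid_cell s k) x * (\<phi> x)\<^sup>2)"
        using K by (auto simp: sum.delta grid_cell_def indicator_def)
    qed
    also have "\<dots> = (LINT x|lborel. (\<Sum>k\<in>K. indicator (grid_cell s k) x * (\<phi> x)\<^sup>2))"
      by (rule integral_completion) measurable
    also have "\<dots> = (\<Sum>k\<in>K. J k)"
      unfolding J_def using integrable_mult_indicator[OF _ int2] cell
      by (intro Bochner_Integration.integral_sum) simp
    finally show ?thesis .
  qed
  have I: "(LINT x:grid_cell s k|lebesgue. \<phi> x) = I k" for k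
    unfolding I_def set_lebesgue_integral_def by (subst integral_completion) auto
  show ?thesis unfolding J I using main by (simp add: q_def)
qed

section \<open>Weak gradients and extension by zero\<close>

lemma ae_rep_measurable: "ae_rep u \<in> borel_measurable lebesgue"
  using Quotient3_rep_reflp[OF Quotient3_ae_fun, of u] by (simp add: ae_equal_def)

lemma ae_rep_class:
  assumes "f \<in> borel_measurable lebesgue"
  shows "AE x in lebesgue. ae_rep (ae_class f) x = f x"
proof -
  have "ae_equal f f" using assms by (simp add: ae_equal_def)
  then have "ae_equal (ae_rep (ae_class f)) f"
    using rep_abs_rsp_left[OF Quotient3_ae_fun] by blast
  then show ?thesis by (simp add: ae_equal_def)
qed

lemma ae_fun_eqI:
  assumes "AE x in lebesgue. ae_rep u x = ae_rep v x"
  shows "u = v"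
proof -
  have "ae_equal (ae_rep u) (ae_rep v)" unfolding ae_equal_def
    by (intro conjI ae_rep_measurable assms)
  then show ?thesis using Quotient3_rel_rep[OF Quotient3_ae_fun] by blast
qed

lemma ae_rep_add: "AE x in lebesgue. ae_rep (u + v) x = ae_rep u x + ae_rep v x"
proof -
  have "u + v = ae_class (\<lambda>x. ae_rep u x + ae_rep v x)"
    by (simp add: plus_ae_fun_def)
  then show ?thesis
    using ae_rep_class[OF borel_measurable_add[OF ae_rep_measurable ae_rep_measurable], of u v]
    by simp
qed

lemma ae_rep_scale: "AE x in lebesgue. ae_rep (c *\<^sub>R u) x = c * ae_rep u x"
proof -
  have "c *\<^sub>R u = ae_class (\<lambda>x. c * ae_rep u x)"
    by (simp add: scaleR_ae_fun_def)
  then show ?thesis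
    using ae_rep_class[OF borel_measurable_times[OF borel_measurable_const ae_rep_measurable], of c u]
    by simp
qed

lemma ae_rep_zero: "AE x in lebesgue. ae_rep (0 :: 'd::finite ae_fun) x = 0"
  using ae_rep_scale[of 0 0] by simp

lemma ae_fun_eq_zero:
  assumes "square_integrable lebesgue (ae_rep u)" "(LINT x|lebesgue. (ae_rep u x)\<^sup>2) = 0"
  shows "u = 0"
proof (rule ae_fun_eqI)
  have "AE x in lebesgue. (ae_rep u x)\<^sup>2 = 0"
    using integral_nonneg_eq_0_iff_AE[OF square_integrable_power2[OF assms(1)]] assms(2) by simp
  with ae_rep_zero show "AE x in lebesgue. ae_rep u x = ae_rep 0 x" by eventually_elim simp
qed

lemma L2_on_UNIV: "L2_on UNIV f \<longleftrightarrow> square_integrable lebesgue f"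
  by (simp add: L2_on_def square_integrable_def set_borel_measurable_def set_integrable_def)

text \<open>This describes \<open>H1_0 UNIV\<close> (see \<open>test_approximable_H1_0_UNIV\<close>) in terms of functions, with the gradient as a
  parameter instead of the choice made by \<open>weak_grad\<close>; therefore it is visibly a linear relation.\<close>
definition test_approximable :: "(real^'d \<Rightarrow> real) \<Rightarrow> (real^'d \<Rightarrow> real^'d) \<Rightarrow> bool" where
  "test_approximable u G \<longleftrightarrow> square_integrable lebesgue u \<and> square_integrable lebesgue G \<and>
     (\<exists>\<phi>. (\<forall>n. \<phi> n \<in> test_functions UNIV) \<and> L2_tendsto lebesgue \<phi> u
        \<and> L2_tendsto lebesgue (\<lambda>n. classical_grad (\<phi> n)) G)"

lemma is_weak_grad_UNIV:
  "is_weak_grad UNIV u G \<longleftrightarrow> square_integrable lebesgue G \<and>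
     (\<forall>\<phi>\<in>test_functions UNIV. \<forall>i.
        (LINT x|lebesgue. u x * partial_deriv i \<phi> x) = - (LINT x|lebesgue. G x $ i * \<phi> x))"
  by (simp add: is_weak_grad_def L2_on_UNIV set_lebesgue_integral_def)

lemma test_approximable_is_weak_grad:
  assumes "test_approximable u G"
  shows "is_weak_grad UNIV u G"
  unfolding is_weak_grad_UNIV
proof (intro conjI ballI allI)
  have u: "square_integrable lebesgue u" and G: "square_integrable lebesgue G"
    using assms by (auto simp: test_approximable_def)
  show "square_integrable lebesgue G" by (rule G)
  obtain \<phi> where \<phi>: "\<And>n. \<phi> n \<in> test_functions UNIV" "L2_tendsto lebesgue \<phi> u"
    "L2_tendsto lebesgue (\<lambda>n. classical_grad (\<phi> n)) G"
    using assms by (auto simp: test_approximable_def)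
  fix \<psi> :: "real^'a \<Rightarrow> real" and i
  assume \<psi>: "\<psi> \<in> test_functions UNIV"
  note sq = test_function_square_integrable[OF \<phi>(1)] classical_grad_square_integrable[OF \<phi>(1)]
  have dpsi: "square_integrable lebesgue (partial_deriv i \<psi>)"
    using square_integrable_nth[OF classical_grad_square_integrable[OF \<psi>], of i]
    by (simp add: partial_deriv_eq_classical_grad[abs_def])
  have psi: "square_integrable lebesgue \<psi>" by (rule test_function_square_integrable[OF \<psi>])
  have "(\<lambda>n. LINT x|lebesgue. \<phi> n x * partial_deriv i \<psi> x) \<longlonglongrightarrow> (LINT x|lebesgue. u x * partial_deriv i \<psi> x)"
    using L2_tendsto_inner[OF sq(1) u \<phi>(2) dpsi dpsi L2_tendsto_const] by simp
  moreover have "(\<lambda>n. LINT x|lebesgue. classical_grad (\<phi> n) x $ i * \<psi> x) \<longlonglongrightarrow> (LINT x|lebesgue. G x $ i * \<psi> x)"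
    using L2_tendsto_inner[OF square_integrable_nth[OF sq(2)] square_integrable_nth[OF G]
        L2_tendsto_nth[OF sq(2) G \<phi>(3)] psi psi L2_tendsto_const] by simp
  ultimately have "(\<lambda>n. LINT x|lebesgue. \<phi> n x * partial_deriv i \<psi> x) \<longlonglongrightarrow> (LINT x|lebesgue. u x * partial_deriv i \<psi> x)"
    "(\<lambda>n. LINT x|lebesgue. \<phi> n x * partial_deriv i \<psi> x) \<longlonglongrightarrow> - (LINT x|lebesgue. G x $ i * \<psi> x)"
    using test_function_integration_by_parts[OF \<phi>(1) \<psi>] tendsto_minus by auto
  then show "(LINT x|lebesgue. u x * partial_deriv i \<psi> x) = - (LINT x|lebesgue. G x $ i * \<psi> x)"
    by (rule LIMSEQ_unique)
qed

text \<open>This identifies the gradient chosen by \<open>weak_grad UNIV\<close> with any gradient found by other means. The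
  additivity of \<open>weak_grad\<close> depends on it.\<close>
lemma weak_grad_unique:
  fixes G :: "real^'d \<Rightarrow> real^'d"
  assumes "is_weak_grad UNIV u G" "is_weak_grad UNIV u H"
  shows "AE x in lebesgue. G x = H x"
proof -
  have G: "square_integrable lebesgue G" and H: "square_integrable lebesgue H"
    using assms by (auto simp: is_weak_grad_UNIV)
  have "AE x in lebesgue. G x $ i - H x $ i = 0" for i
  proof (rule fundamental_lemma)
    show "square_integrable lebesgue (\<lambda>x. G x $ i - H x $ i)"
      by (intro square_integrable_diff square_integrable_nth G H)
    fix \<phi> :: "real^'d \<Rightarrow> real" assume \<phi>: "\<phi> \<in> test_functions UNIV"
    have "(LINT x|lebesgue. (G x $ i - H x $ i) * \<phi> x)
        = (LINT x|lebesgue. G x $ i * \<phi> x) - (LINT x|lebesgue. H x $ i * \<phi> x)"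
      using square_integrable_mult[OF square_integrable_nth[OF G] test_function_square_integrable[OF \<phi>]]
        square_integrable_mult[OF square_integrable_nth[OF H] test_function_square_integrable[OF \<phi>]]
      by (simp add: left_diff_distrib)
    also have "\<dots> = 0"
    proof -
      have "(LINT x|lebesgue. u x * partial_deriv i \<phi> x) = - (LINT x|lebesgue. G x $ i * \<phi> x)"
        "(LINT x|lebesgue. u x * partial_deriv i \<phi> x) = - (LINT x|lebesgue. H x $ i * \<phi> x)"
        using assms \<phi> unfolding is_weak_grad_UNIV by blast+
      then show ?thesis by simp
    qed
    finally show "(LINT x|lebesgue. (G x $ i - H x $ i) * \<phi> x) = 0" .
  qed
  then have "AE x in lebesgue. \<forall>i. G x $ i - H x $ i = 0"
    by (simp add: AE_all_countable)
  then show ?thesis by eventually_elim (simp add: vec_eq_iff)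
qed

lemma L2_on_extension:
  assumes "L2_on \<Omega> f"
  shows "square_integrable lebesgue (\<lambda>x. indicator \<Omega> x *\<^sub>R f x)"
proof -
  have ind: "(norm (indicator \<Omega> x *\<^sub>R y))\<^sup>2 = indicator \<Omega> x *\<^sub>R (norm y)\<^sup>2" for x and y :: 'b
    by (simp add: indicator_def)
  show ?thesis
    using assms unfolding L2_on_def square_integrable_def set_borel_measurable_def set_integrable_def ind
    by blast
qed

lemma H1_weak_grad:
  assumes "u \<in> H1 \<Omega>"
  shows "is_weak_grad \<Omega> (ae_rep u) (weak_grad \<Omega> u)"
  unfolding weak_grad_def using assms by (intro someI_ex[of "is_weak_grad _ _"]) (simp add: H1_def)

lemma test_approximable_AE_cong:
  assumes "test_approximable u G" "AE x in lebesgue. G x = H x" "H \<in> borel_measurable lebesgue"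
  shows "test_approximable u H"
proof -
  have H: "square_integrable lebesgue H"
    using assms square_integrable_AE_cong by (auto simp: test_approximable_def)
  obtain \<phi> where \<phi>: "\<And>n. \<phi> n \<in> test_functions UNIV" "L2_tendsto lebesgue \<phi> u"
    "L2_tendsto lebesgue (\<lambda>n. classical_grad (\<phi> n)) G"
    using assms by (auto simp: test_approximable_def)
  have "L2_tendsto lebesgue (\<lambda>n. classical_grad (\<phi> n)) H"
  proof (rule L2_tendsto_AE_cong[OF \<phi>(3) _ _ _ assms(2)])
    show "classical_grad (\<phi> n) \<in> borel_measurable lebesgue" for n
      using classical_grad_square_integrable[OF \<phi>(1)] square_integrable_measurable by blast
    show "G \<in> borel_measurable lebesgue"
      using assms(1) square_integrable_measurable by (auto simp: test_approximable_def)
  qed (rule assms(3))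
  then show ?thesis using \<phi> H assms(1) unfolding test_approximable_def by blast
qed

lemma sum_tendsto_0D:
  fixes a b :: "nat \<Rightarrow> real"
  assumes "(\<lambda>n. a n + b n) \<longlonglongrightarrow> 0" "\<And>n. 0 \<le> a n" "\<And>n. 0 \<le> b n"
  shows "a \<longlonglongrightarrow> 0" "b \<longlonglongrightarrow> 0"
proof -
  show "a \<longlonglongrightarrow> 0"
    by (rule tendsto_sandwich[OF _ _ tendsto_const assms(1)]) (simp_all add: assms(2,3))
  show "b \<longlonglongrightarrow> 0"
    by (rule tendsto_sandwich[OF _ _ tendsto_const assms(1)]) (simp_all add: assms(2,3))
qed

lemma test_approximable_choice:
  assumes "\<And>n. test_approximable (u n) (G n)"
  shows "\<exists>\<phi>. \<forall>n. \<phi> n \<in> test_functions UNIV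
    \<and> sqnorm lebesgue (\<lambda>x. \<phi> n x - u n x) < inverse (real (Suc n))
    \<and> sqnorm lebesgue (\<lambda>x. classical_grad (\<phi> n) x - G n x) < inverse (real (Suc n))"
proof (rule choice, rule allI)
  fix n
  obtain \<phi> where \<phi>: "\<And>m. \<phi> m \<in> test_functions UNIV" "L2_tendsto lebesgue \<phi> (u n)"
    "L2_tendsto lebesgue (\<lambda>m. classical_grad (\<phi> m)) (G n)"
    using assms[of n] by (auto simp: test_approximable_def)
  have pos: "0 < inverse (real (Suc n))" by simp
  from eventually_conj[OF order_tendstoD(2)[OF \<phi>(2)[unfolded L2_tendsto_def] pos]
      order_tendstoD(2)[OF \<phi>(3)[unfolded L2_tendsto_def] pos]]
  show "\<exists>\<phi>. \<phi> \<in> test_functions UNIV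
    \<and> sqnorm lebesgue (\<lambda>x. \<phi> x - u n x) < inverse (real (Suc n))
    \<and> sqnorm lebesgue (\<lambda>x. classical_grad \<phi> x - G n x) < inverse (real (Suc n))"
    using \<phi>(1) eventually_happens'[OF sequentially_bot] by blast
qed

lemma H1_0_norm_split:
  assumes u: "square_integrable lebesgue u" and G: "square_integrable lebesgue G"
    and \<phi>: "\<phi> \<in> test_functions UNIV"
  shows "(LINT x|lebesgue. (u x - \<phi> x)\<^sup>2 + (norm (G x - classical_grad \<phi> x))\<^sup>2)
    = sqnorm lebesgue (\<lambda>x. u x - \<phi> x) + sqnorm lebesgue (\<lambda>x. G x - classical_grad \<phi> x)"
  using square_integrable_norm[OF square_integrable_diff[OF u test_function_square_integrable[OF \<phi>]]]
    square_integrable_norm[OF square_integrable_diff[OF G classical_grad_square_integrable[OF \<phi>]]]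
  by simp

lemma H1_0_UNIV_test_approximable:
  assumes "u \<in> H1_0 UNIV"
  shows "test_approximable (ae_rep u) (weak_grad UNIV u)"
proof -
  have H1: "u \<in> H1 UNIV" using assms by (simp add: H1_0_def)
  then have u: "square_integrable lebesgue (ae_rep u)" by (simp add: H1_def L2_on_UNIV)
  have G: "square_integrable lebesgue (weak_grad UNIV u)"
    using H1_weak_grad[OF H1] by (simp add: is_weak_grad_UNIV)
  obtain \<phi> where \<phi>: "\<And>n::nat. \<phi> n \<in> test_functions UNIV" and lim:
    "(\<lambda>n. LINT x|lebesgue. (ae_rep u x - \<phi> n x)\<^sup>2
            + (norm (weak_grad UNIV u x - classical_grad (\<phi> n) x))\<^sup>2) \<longlonglongrightarrow> 0"
    using assms by (auto simp: H1_0_def set_lebesgue_integral_def)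
  note lim' = sum_tendsto_0D[OF lim[unfolded H1_0_norm_split[OF u G \<phi>]]]
  have "L2_tendsto lebesgue \<phi> (ae_rep u)" "L2_tendsto lebesgue (\<lambda>n. classical_grad (\<phi> n)) (weak_grad UNIV u)"
    unfolding L2_tendsto_commute by (rule lim'; simp)+
  then show ?thesis using u G \<phi> unfolding test_approximable_def by blast
qed

lemma test_approximable_H1_0_UNIV:
  assumes "test_approximable (ae_rep u) G"
  shows "u \<in> H1_0 UNIV" "AE x in lebesgue. weak_grad UNIV u x = G x"
proof -
  have G: "is_weak_grad UNIV (ae_rep u) G" by (rule test_approximable_is_weak_grad[OF assms])
  have u: "square_integrable lebesgue (ae_rep u)" using assms by (simp add: test_approximable_def)
  have H1: "u \<in> H1 UNIV" using u G by (auto simp: H1_def L2_on_UNIV)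
  show ae: "AE x in lebesgue. weak_grad UNIV u x = G x"
    by (rule weak_grad_unique[OF H1_weak_grad[OF H1] G])
  have W: "square_integrable lebesgue (weak_grad UNIV u)"
    using H1_weak_grad[OF H1] by (simp add: is_weak_grad_UNIV)
  have "AE x in lebesgue. G x = weak_grad UNIV u x" using ae by eventually_elim simp
  then have "test_approximable (ae_rep u) (weak_grad UNIV u)"
    by (rule test_approximable_AE_cong[OF assms _ square_integrable_measurable[OF W]])
  then obtain \<phi> where \<phi>: "\<And>n. \<phi> n \<in> test_functions UNIV" "L2_tendsto lebesgue \<phi> (ae_rep u)"
    "L2_tendsto lebesgue (\<lambda>n. classical_grad (\<phi> n)) (weak_grad UNIV u)"
    by (auto simp: test_approximable_def)
  have "(\<lambda>n. LINT x|lebesgue. (ae_rep u x - \<phi> n x)\<^sup>2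
            + (norm (weak_grad UNIV u x - classical_grad (\<phi> n) x))\<^sup>2) \<longlonglongrightarrow> 0"
    unfolding H1_0_norm_split[OF u W \<phi>(1)]
    using tendsto_add[OF \<phi>(2,3)[unfolded L2_tendsto_commute]] by simp
  then show "u \<in> H1_0 UNIV"
    using H1 \<phi>(1) unfolding H1_0_def by (auto simp: set_lebesgue_integral_def)
qed

text \<open>A test function on \<open>\<real>\<^sup>d\<close> need not vanish near the boundary of \<open>\<Omega>\<close>, so the defining property of a weak
  gradient on \<open>\<Omega>\<close> says nothing about it. The approximating test functions, on the other hand, are
  supported in \<open>\<Omega>\<close>, and they converge to the extensions by zero of \<open>u\<close> and of its gradient.\<close>
lemma H1_0_extension:
  assumes "u \<in> H1_0 \<Omega>" "\<Omega> \<in> sets lebesgue"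
  shows "u \<in> H1_0 UNIV"
    "AE x in lebesgue. weak_grad UNIV u x = indicator \<Omega> x *\<^sub>R weak_grad \<Omega> u x"
    "AE x in lebesgue. x \<notin> \<Omega> \<longrightarrow> ae_rep u x = 0"
proof -
  let ?G = "\<lambda>x. indicator \<Omega> x *\<^sub>R weak_grad \<Omega> u x"
  have H1: "u \<in> H1 \<Omega>" using assms by (simp add: H1_0_def)
  then show off: "AE x in lebesgue. x \<notin> \<Omega> \<longrightarrow> ae_rep u x = 0" by (simp add: H1_def)
  have G: "square_integrable lebesgue ?G"
    using H1_weak_grad[OF H1] by (intro L2_on_extension) (simp add: is_weak_grad_def)
  have "square_integrable lebesgue (\<lambda>x. indicator \<Omega> x *\<^sub>R ae_rep u x)"
    using H1 by (intro L2_on_extension) (simp add: H1_def)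
  moreover have "AE x in lebesgue. indicator \<Omega> x *\<^sub>R ae_rep u x = ae_rep u x"
    using off by eventually_elim (auto simp: indicator_def)
  ultimately have u: "square_integrable lebesgue (ae_rep u)"
    by (rule square_integrable_AE_cong[OF _ ae_rep_measurable])
  obtain \<phi> where \<phi>: "\<And>n::nat. \<phi> n \<in> test_functions \<Omega>" and lim:
    "(\<lambda>n. LINT x:\<Omega>|lebesgue. (ae_rep u x - \<phi> n x)\<^sup>2
            + (norm (weak_grad \<Omega> u x - classical_grad (\<phi> n) x))\<^sup>2) \<longlonglongrightarrow> 0"
    using assms(1) unfolding H1_0_def by blast
  have \<phi>U: "\<phi> n \<in> test_functions UNIV" for n using \<phi> test_functionsD(6) by blast
  have "(LINT x:\<Omega>|lebesgue. (ae_rep u x - \<phi> n x)\<^sup>2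
            + (norm (weak_grad \<Omega> u x - classical_grad (\<phi> n) x))\<^sup>2)
      = (LINT x|lebesgue. (ae_rep u x - \<phi> n x)\<^sup>2 + (norm (?G x - classical_grad (\<phi> n) x))\<^sup>2)" for n
    unfolding set_lebesgue_integral_def
  proof (rule integral_cong_AE)
    have m1: "(\<lambda>x. (norm (ae_rep u x - \<phi> n x))\<^sup>2) \<in> borel_measurable lebesgue"
      using square_integrable_norm[OF square_integrable_diff[OF u test_function_square_integrable[OF \<phi>U[of n]]]]
      by (rule borel_measurable_integrable)
    have m2: "(\<lambda>x. (norm (?G x - classical_grad (\<phi> n) x))\<^sup>2) \<in> borel_measurable lebesgue"
      using square_integrable_norm[OF square_integrable_diff[OF G classical_grad_square_integrable[OF \<phi>U[of n]]]]
      by (rule borel_measurable_integrable)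
    show m: "(\<lambda>x. (ae_rep u x - \<phi> n x)\<^sup>2 + (norm (?G x - classical_grad (\<phi> n) x))\<^sup>2) \<in> borel_measurable lebesgue"
      using borel_measurable_add[OF m1 m2] by simp
    have "(\<lambda>x. indicator \<Omega> x *\<^sub>R ((ae_rep u x - \<phi> n x)\<^sup>2 + (norm (?G x - classical_grad (\<phi> n) x))\<^sup>2))
        \<in> borel_measurable lebesgue"
      by (intro borel_measurable_scaleR borel_measurable_indicator assms(2) m)
    moreover have "indicator \<Omega> x *\<^sub>R ((ae_rep u x - \<phi> n x)\<^sup>2 + (norm (?G x - classical_grad (\<phi> n) x))\<^sup>2)
      = indicator \<Omega> x *\<^sub>R ((ae_rep u x - \<phi> n x)\<^sup>2 + (norm (weak_grad \<Omega> u x - classical_grad (\<phi> n) x))\<^sup>2)" for x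
      by (simp add: indicator_def)
    ultimately show "(\<lambda>x. indicator \<Omega> x *\<^sub>R ((ae_rep u x - \<phi> n x)\<^sup>2
        + (norm (weak_grad \<Omega> u x - classical_grad (\<phi> n) x))\<^sup>2)) \<in> borel_measurable lebesgue"
      by (simp only:)
    show "AE x in lebesgue. indicator \<Omega> x *\<^sub>R ((ae_rep u x - \<phi> n x)\<^sup>2
            + (norm (weak_grad \<Omega> u x - classical_grad (\<phi> n) x))\<^sup>2)
        = (ae_rep u x - \<phi> n x)\<^sup>2 + (norm (?G x - classical_grad (\<phi> n) x))\<^sup>2"
      using off
    proof eventually_elim
      case (elim x)
      show ?case
      proof (cases "x \<in> \<Omega>")
        case False
        then have "x \<notin> closure {x. \<phi> n x \<noteq> 0}" using test_functionsD(3)[OF \<phi>[of n]] by blast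
        then have "\<phi> n x = 0" "classical_grad (\<phi> n) x = 0"
          by (rule test_function_zero, rule classical_grad_eq_0)
        then show ?thesis using False elim by simp
      qed simp
    qed
  qed
  then have "(\<lambda>n. (sqnorm lebesgue (\<lambda>x. ae_rep u x - \<phi> n x))
      + sqnorm lebesgue (\<lambda>x. ?G x - classical_grad (\<phi> n) x)) \<longlonglongrightarrow> 0"
    using lim H1_0_norm_split[OF u G \<phi>U] by simp
  note lim' = sum_tendsto_0D[OF this]
  have "L2_tendsto lebesgue \<phi> (ae_rep u)" "L2_tendsto lebesgue (\<lambda>n. classical_grad (\<phi> n)) ?G"
    unfolding L2_tendsto_commute by (rule lim'; simp)+
  then have "test_approximable (ae_rep u) ?G"
    using u G \<phi>U unfolding test_approximable_def by blast
  then show "u \<in> H1_0 UNIV" "AE x in lebesgue. weak_grad UNIV u x = ?G x"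
    by (rule test_approximable_H1_0_UNIV)+
qed

lemma test_approximable_add:
  assumes "test_approximable u G" "test_approximable v H"
  shows "test_approximable (\<lambda>x. u x + v x) (\<lambda>x. G x + H x)"
proof -
  have sq: "square_integrable lebesgue u" "square_integrable lebesgue G"
    "square_integrable lebesgue v" "square_integrable lebesgue H"
    using assms by (auto simp: test_approximable_def)
  obtain \<phi> where \<phi>: "\<And>n. \<phi> n \<in> test_functions UNIV" "L2_tendsto lebesgue \<phi> u"
    "L2_tendsto lebesgue (\<lambda>n. classical_grad (\<phi> n)) G"
    using assms(1) by (auto simp: test_approximable_def)
  obtain \<psi> where \<psi>: "\<And>n. \<psi> n \<in> test_functions UNIV" "L2_tendsto lebesgue \<psi> v"
    "L2_tendsto lebesgue (\<lambda>n. classical_grad (\<psi> n)) H"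
    using assms(2) by (auto simp: test_approximable_def)
  have "L2_tendsto lebesgue (\<lambda>n x. \<phi> n x + \<psi> n x) (\<lambda>x. u x + v x)"
    using \<phi> \<psi> sq test_function_square_integrable by (intro L2_tendsto_add) blast+
  moreover have "L2_tendsto lebesgue (\<lambda>n. classical_grad (\<lambda>x. \<phi> n x + \<psi> n x)) (\<lambda>x. G x + H x)"
  proof -
    have "classical_grad (\<lambda>x. \<phi> n x + \<psi> n x) = (\<lambda>x. classical_grad (\<phi> n) x + classical_grad (\<psi> n) x)" for n
      by (rule ext) (rule classical_grad_add[OF \<phi>(1) \<psi>(1)])
    moreover have "L2_tendsto lebesgue (\<lambda>n x. classical_grad (\<phi> n) x + classical_grad (\<psi> n) x) (\<lambda>x. G x + H x)"
      using \<phi> \<psi> sq classical_grad_square_integrable by (intro L2_tendsto_add) blast+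
    ultimately show ?thesis by simp
  qed
  ultimately show ?thesis
    unfolding test_approximable_def
    by (intro conjI exI[of _ "\<lambda>n x. \<phi> n x + \<psi> n x"] allI square_integrable_add sq
        test_function_add \<phi>(1) \<psi>(1))
qed

lemma test_approximable_scale:
  assumes "test_approximable u G"
  shows "test_approximable (\<lambda>x. c * u x) (\<lambda>x. c *\<^sub>R G x)"
proof -
  have sq: "square_integrable lebesgue u" "square_integrable lebesgue G"
    using assms by (auto simp: test_approximable_def)
  obtain \<phi> where \<phi>: "\<And>n. \<phi> n \<in> test_functions UNIV" "L2_tendsto lebesgue \<phi> u"
    "L2_tendsto lebesgue (\<lambda>n. classical_grad (\<phi> n)) G"
    using assms(1) by (auto simp: test_approximable_def)
  have "L2_tendsto lebesgue (\<lambda>n x. c * \<phi> n x) (\<lambda>x. c * u x)"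
    using L2_tendsto_scaleR[OF \<phi>(2), of c] by simp
  moreover have "L2_tendsto lebesgue (\<lambda>n. classical_grad (\<lambda>x. c * \<phi> n x)) (\<lambda>x. c *\<^sub>R G x)"
  proof -
    have "classical_grad (\<lambda>x. c * \<phi> n x) = (\<lambda>x. c *\<^sub>R classical_grad (\<phi> n) x)" for n
      by (rule ext) (rule classical_grad_scale[OF \<phi>(1)])
    then show ?thesis using L2_tendsto_scaleR[OF \<phi>(3), of c] by simp
  qed
  moreover have "square_integrable lebesgue (\<lambda>x. c * u x)"
    using square_integrable_scaleR[OF sq(1), of c] by simp
  ultimately show ?thesis
    using square_integrable_scaleR[OF sq(2)] test_function_scale[OF \<phi>(1)] unfolding test_approximable_def
    by (intro conjI exI[of _ "\<lambda>n x. c * \<phi> n x"]) auto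
qed

lemma test_approximable_AE_cong_fun:
  assumes "test_approximable u G" "AE x in lebesgue. u x = v x" "v \<in> borel_measurable lebesgue"
  shows "test_approximable v G"
proof -
  have v: "square_integrable lebesgue v"
    using assms square_integrable_AE_cong by (auto simp: test_approximable_def)
  obtain \<phi> where \<phi>: "\<And>n. \<phi> n \<in> test_functions UNIV" "L2_tendsto lebesgue \<phi> u"
    "L2_tendsto lebesgue (\<lambda>n. classical_grad (\<phi> n)) G"
    using assms by (auto simp: test_approximable_def)
  have "L2_tendsto lebesgue \<phi> v"
  proof (rule L2_tendsto_AE_cong[OF \<phi>(2) _ _ assms(3,2)])
    show "\<phi> n \<in> borel_measurable lebesgue" for n
      using test_function_square_integrable[OF \<phi>(1)] square_integrable_measurable by blast
    show "u \<in> borel_measurable lebesgue"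
      using assms(1) square_integrable_measurable by (auto simp: test_approximable_def)
  qed
  then show ?thesis using \<phi> v assms(1) unfolding test_approximable_def by blast
qed

lemma H1_0_UNIV_add:
  assumes "u \<in> H1_0 UNIV" "v \<in> H1_0 UNIV"
  shows "u + v \<in> H1_0 UNIV"
    "AE x in lebesgue. weak_grad UNIV (u + v) x = weak_grad UNIV u x + weak_grad UNIV v x"
proof -
  have "AE x in lebesgue. ae_rep u x + ae_rep v x = ae_rep (u + v) x"
    using ae_rep_add[of u v] by eventually_elim simp
  then have "test_approximable (ae_rep (u + v)) (\<lambda>x. weak_grad UNIV u x + weak_grad UNIV v x)"
    by (rule test_approximable_AE_cong_fun[OF test_approximable_add[OF
          H1_0_UNIV_test_approximable[OF assms(1)] H1_0_UNIV_test_approximable[OF assms(2)]]])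
       (rule ae_rep_measurable)
  then show "u + v \<in> H1_0 UNIV"
    "AE x in lebesgue. weak_grad UNIV (u + v) x = weak_grad UNIV u x + weak_grad UNIV v x"
    by (rule test_approximable_H1_0_UNIV)+
qed

lemma H1_0_UNIV_scale:
  assumes "u \<in> H1_0 UNIV"
  shows "c *\<^sub>R u \<in> H1_0 UNIV"
    "AE x in lebesgue. weak_grad UNIV (c *\<^sub>R u) x = c *\<^sub>R weak_grad UNIV u x"
proof -
  have "AE x in lebesgue. c * ae_rep u x = ae_rep (c *\<^sub>R u) x"
    using ae_rep_scale[of c u] by eventually_elim simp
  then have "test_approximable (ae_rep (c *\<^sub>R u)) (\<lambda>x. c *\<^sub>R weak_grad UNIV u x)"
    by (rule test_approximable_AE_cong_fun[OF test_approximable_scale[OF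
          H1_0_UNIV_test_approximable[OF assms]]])
       (rule ae_rep_measurable)
  then show "c *\<^sub>R u \<in> H1_0 UNIV"
    "AE x in lebesgue. weak_grad UNIV (c *\<^sub>R u) x = c *\<^sub>R weak_grad UNIV u x"
    by (rule test_approximable_H1_0_UNIV)+
qed

section \<open>The form domain of a confining potential\<close>

lemma sym_form_integral:
  fixes F :: "'v::real_vector \<Rightarrow> 'a \<Rightarrow> 'b::euclidean_space"
  assumes X: "subspace X" and sq: "\<And>u. u \<in> X \<Longrightarrow> square_integrable M (F u)"
    and add: "\<And>u v. u \<in> X \<Longrightarrow> v \<in> X \<Longrightarrow> AE x in M. F (u + v) x = F u x + F v x"
    and scale: "\<And>u c. u \<in> X \<Longrightarrow> AE x in M. F (c *\<^sub>R u) x = c *\<^sub>R F u x"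
    and w: "w \<in> borel_measurable M" "AE x in M. \<bar>w x\<bar> \<le> C"
  shows "sym_form X (\<lambda>u v. LINT x|M. w x * (F u x \<bullet> F v x))"
proof -
  have int: "integrable M (\<lambda>x. w x * (F u x \<bullet> F v x))" if "u \<in> X" "v \<in> X" for u v
    by (rule integrable_bounded_mult[OF square_integrable_inner[OF sq[OF that(1)] sq[OF that(2)]] w])
  have m: "(\<lambda>x. w x * (F u x \<bullet> F v x)) \<in> borel_measurable M" if "u \<in> X" "v \<in> X" for u v
    using int[OF that] by (rule borel_measurable_integrable)
  show ?thesis
  proof
    show "subspace X" by (rule X)
    show "(LINT x|M. w x * (F u x \<bullet> F v x)) = (LINT x|M. w x * (F v x \<bullet> F u x))" for u v
      by (simp add: inner_commute)
  next
    fix u v z assume X3: "u \<in> X" "v \<in> X" "z \<in> X"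
    then have uv: "u + v \<in> X" using X subspace_add by blast
    have "(LINT x|M. w x * (F (u + v) x \<bullet> F z x))
        = (LINT x|M. w x * (F u x \<bullet> F z x) + w x * (F v x \<bullet> F z x))"
    proof (rule integral_cong_AE)
      show "AE x in M. w x * (F (u + v) x \<bullet> F z x) = w x * (F u x \<bullet> F z x) + w x * (F v x \<bullet> F z x)"
        using add[OF X3(1,2)] by eventually_elim (simp add: inner_add_left distrib_left)
      show "(\<lambda>x. w x * (F u x \<bullet> F z x) + w x * (F v x \<bullet> F z x)) \<in> borel_measurable M"
        by (intro borel_measurable_add m X3)
    qed (rule m[OF uv X3(3)])
    then show "(LINT x|M. w x * (F (u + v) x \<bullet> F z x))
        = (LINT x|M. w x * (F u x \<bullet> F z x)) + (LINT x|M. w x * (F v x \<bullet> F z x))"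
      using int X3 by simp
  next
    fix u v c assume X2: "u \<in> X" "v \<in> X"
    then have cu: "c *\<^sub>R u \<in> X" using X subspace_scale by blast
    have "(LINT x|M. w x * (F (c *\<^sub>R u) x \<bullet> F v x)) = (LINT x|M. c * (w x * (F u x \<bullet> F v x)))"
    proof (rule integral_cong_AE)
      show "AE x in M. w x * (F (c *\<^sub>R u) x \<bullet> F v x) = c * (w x * (F u x \<bullet> F v x))"
        using scale[OF X2(1), of c] by eventually_elim simp
      show "(\<lambda>x. c * (w x * (F u x \<bullet> F v x))) \<in> borel_measurable M"
        by (intro borel_measurable_times borel_measurable_const m X2)
    qed (rule m[OF cu X2(2)])
    then show "(LINT x|M. w x * (F (c *\<^sub>R u) x \<bullet> F v x)) = c * (LINT x|M. w x * (F u x \<bullet> F v x))"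
      by simp
  qed
qed

lemma integral_split_set:
  fixes f :: "'a::euclidean_space \<Rightarrow> real"
  assumes "integrable lebesgue f" "S \<in> sets lebesgue"
  shows "(LINT x|lebesgue. f x) = (LINT x:S|lebesgue. f x) + (LINT x:-S|lebesgue. f x)"
proof -
  have "(LINT x|lebesgue. f x) = (LINT x|lebesgue. indicator S x *\<^sub>R f x + indicator (- S) x *\<^sub>R f x)"
    by (intro Bochner_Integration.integral_cong) (auto simp: indicator_def)
  also have "\<dots> = (LINT x:S|lebesgue. f x) + (LINT x:-S|lebesgue. f x)"
    unfolding set_lebesgue_integral_def
    using assms by (intro Bochner_Integration.integral_add integrable_mult_indicator)
       (auto simp: Compl_in_sets_lebesgue)
  finally show ?thesis .
qed

lemma finite_int_vectors: "finite {k :: int^'n. \<forall>i. \<bar>k $ i\<bar> \<le> m}"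
proof -
  have "finite (PiE UNIV (\<lambda>_::'n. {-m..m}))" by (intro finite_PiE) auto
  then have "finite (vec_lambda ` (PiE UNIV (\<lambda>_::'n. {-m..m})))" by (rule finite_imageI)
  moreover have "{k :: int^'n. \<forall>i. \<bar>k $ i\<bar> \<le> m} \<subseteq> vec_lambda ` (PiE UNIV (\<lambda>_::'n. {-m..m}))"
  proof
    fix k :: "int^'n" assume k: "k \<in> {k. \<forall>i. \<bar>k $ i\<bar> \<le> m}"
    have "-m \<le> k $ i \<and> k $ i \<le> m" for i using k by (metis abs_le_iff mem_Collect_eq minus_le_iff)
    then have "(\<lambda>i. k $ i) \<in> PiE UNIV (\<lambda>_::'n. {-m..m})" by auto
    then have "vec_lambda (\<lambda>i. k $ i) \<in> vec_lambda ` (PiE UNIV (\<lambda>_::'n. {-m..m}))" by (rule imageI)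
    then show "k \<in> vec_lambda ` (PiE UNIV (\<lambda>_::'n. {-m..m}))" by simp
  qed
  ultimately show ?thesis by (rule rev_finite_subset)
qed

definition form_domain :: "(real^'d \<Rightarrow> real) \<Rightarrow> 'd ae_fun set" where
  "form_domain V1 = {u \<in> H1_0 UNIV. integrable lebesgue (\<lambda>x. V1 x * (ae_rep u x)\<^sup>2)}"

text \<open>The vector field whose \<open>L\<^sup>2\<close> inner product is the form \<open>a\<close>; it turns convergence with respect to \<open>a\<close> into
  convergence in the mean.\<close>
definition energy :: "(real^'d \<Rightarrow> real) \<Rightarrow> 'd ae_fun \<Rightarrow> real^'d \<Rightarrow> (real^'d) \<times> real" where
  "energy V1 u x = (weak_grad UNIV u x, sqrt (V1 x) * ae_rep u x)"

locale confining_potential =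
  fixes V1 :: "real^'d \<Rightarrow> real"
  assumes V1_nonneg: "0 \<le> V1 x"
    and V1_measurable: "V1 \<in> borel_measurable lebesgue"
    and V1_coercive: "filterlim V1 at_top at_infinity"
begin

abbreviation W where "W \<equiv> form_domain V1"
abbreviation a where "a \<equiv> A_inner UNIV V1"

lemma sqrt_V1_measurable: "(\<lambda>x. sqrt (V1 x)) \<in> borel_measurable lebesgue"
  by (rule measurable_compose[OF V1_measurable borel_measurable_sqrt])

lemma square_integrable_sqrt_V1:
  assumes "f \<in> borel_measurable lebesgue"
  shows "square_integrable lebesgue (\<lambda>x. sqrt (V1 x) * f x)
    \<longleftrightarrow> integrable lebesgue (\<lambda>x. V1 x * (f x)\<^sup>2)"
proof -
  have "(\<lambda>x. sqrt (V1 x) * f x) \<in> borel_measurable lebesgue"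
    by (intro borel_measurable_times sqrt_V1_measurable assms)
  then show ?thesis by (simp add: square_integrable_def power_mult_distrib V1_nonneg)
qed

lemma form_domain_L2:
  assumes "u \<in> W"
  shows "square_integrable lebesgue (ae_rep u)" "square_integrable lebesgue (weak_grad UNIV u)"
    "square_integrable lebesgue (energy V1 u)" "test_approximable (ae_rep u) (weak_grad UNIV u)"
proof -
  show t: "test_approximable (ae_rep u) (weak_grad UNIV u)"
    using assms by (intro H1_0_UNIV_test_approximable) (simp add: form_domain_def)
  then show "square_integrable lebesgue (ae_rep u)" and G: "square_integrable lebesgue (weak_grad UNIV u)"
    by (auto simp: test_approximable_def)
  have "square_integrable lebesgue (\<lambda>x. sqrt (V1 x) * ae_rep u x)"
    using assms square_integrable_sqrt_V1[OF ae_rep_measurable, of u] by (simp add: form_domain_def)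
  then show "square_integrable lebesgue (energy V1 u)"
    unfolding energy_def[abs_def] by (rule square_integrable_Pair[OF G])
qed

lemma subspace_form_domain: "subspace W"
proof (rule subspaceI)
  have iff: "u \<in> W \<longleftrightarrow> u \<in> H1_0 UNIV \<and> square_integrable lebesgue (\<lambda>x. sqrt (V1 x) * ae_rep u x)" for u
    using square_integrable_sqrt_V1[OF ae_rep_measurable, of u] by (simp add: form_domain_def)
  have m: "(\<lambda>x. sqrt (V1 x) * ae_rep u x) \<in> borel_measurable lebesgue" for u :: "'d ae_fun"
    by (intro borel_measurable_times sqrt_V1_measurable ae_rep_measurable)
  show add: "u + v \<in> W" if "u \<in> W" "v \<in> W" for u v
  proof -
    have "square_integrable lebesgue (\<lambda>x. sqrt (V1 x) * ae_rep u x + sqrt (V1 x) * ae_rep v x)"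
      using that unfolding iff by (intro square_integrable_add) auto
    moreover have "AE x in lebesgue. sqrt (V1 x) * ae_rep u x + sqrt (V1 x) * ae_rep v x
        = sqrt (V1 x) * ae_rep (u + v) x"
      using ae_rep_add[of u v] by eventually_elim (simp add: distrib_left)
    ultimately show ?thesis
      using that H1_0_UNIV_add(1)[of u v] square_integrable_AE_cong[OF _ m] unfolding iff by blast
  qed
  show scale: "c *\<^sub>R u \<in> W" if "u \<in> W" for u c
  proof -
    have "square_integrable lebesgue (\<lambda>x. c *\<^sub>R (sqrt (V1 x) * ae_rep u x))"
      using that unfolding iff by (intro square_integrable_scaleR) auto
    moreover have "AE x in lebesgue. c *\<^sub>R (sqrt (V1 x) * ae_rep u x) = sqrt (V1 x) * ae_rep (c *\<^sub>R u) x"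
      using ae_rep_scale[of c u] by eventually_elim simp
    ultimately show ?thesis
      using that H1_0_UNIV_scale(1)[of u c] square_integrable_AE_cong[OF _ m] unfolding iff by blast
  qed
  have "square_integrable lebesgue (\<lambda>_::real^'d. 0::real)" "square_integrable lebesgue (\<lambda>_::real^'d. 0::real^'d)"
    by (auto simp: square_integrable_def)
  have z: "AE x in lebesgue. 0 = ae_rep (0 :: 'd ae_fun) x"
    using ae_rep_zero by eventually_elim simp
  have tz: "(\<lambda>_. 0) \<in> test_functions (UNIV :: (real^'d) set)"
  proof -
    have "(\<lambda>x. 0 * bump 0 0 0 x) \<in> test_functions (UNIV :: (real^'d) set)"
      by (rule test_function_scale[OF bump_test_function])
    then show ?thesis by simp
  qed
  have gz: "classical_grad (\<lambda>_. 0) = (\<lambda>_::real^'d. 0)"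
    by (rule ext) (rule classical_grad_eq_0, simp)
  have "test_approximable (\<lambda>_::real^'d. 0) (\<lambda>_. 0)"
    unfolding test_approximable_def
    by (intro conjI exI[of _ "\<lambda>_ _. 0"]) (auto simp: square_integrable_def L2_tendsto_def tz gz)
  then have "test_approximable (ae_rep (0 :: 'd ae_fun)) (\<lambda>_. 0)"
    by (rule test_approximable_AE_cong_fun[OF _ z ae_rep_measurable])
  then have "0 \<in> H1_0 (UNIV :: (real^'d) set)" by (rule test_approximable_H1_0_UNIV)
  moreover have "square_integrable lebesgue (\<lambda>x. sqrt (V1 x) * ae_rep 0 x)"
  proof (rule square_integrable_AE_cong[OF _ m])
    show "AE x in lebesgue. 0 = sqrt (V1 x) * ae_rep 0 x" using z by eventually_elim simp
  qed (simp add: square_integrable_def)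
  ultimately show "0 \<in> W" unfolding iff by blast
qed

lemma energy_add:
  assumes "u \<in> W" "v \<in> W"
  shows "AE x in lebesgue. energy V1 (u + v) x = energy V1 u x + energy V1 v x"
proof -
  have "u \<in> H1_0 UNIV" "v \<in> H1_0 UNIV" using assms by (auto simp: form_domain_def)
  from H1_0_UNIV_add(2)[OF this] ae_rep_add[of u v] show ?thesis
    by eventually_elim (simp add: energy_def distrib_left)
qed

lemma energy_scale:
  assumes "u \<in> W"
  shows "AE x in lebesgue. energy V1 (c *\<^sub>R u) x = c *\<^sub>R energy V1 u x"
proof -
  have "u \<in> H1_0 UNIV" using assms by (auto simp: form_domain_def)
  from H1_0_UNIV_scale(2)[OF this, of c] ae_rep_scale[of c u] show ?thesis
    by eventually_elim (simp add: energy_def)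
qed

lemma A_inner_energy: "a u v = (LINT x|lebesgue. energy V1 u x \<bullet> energy V1 v x)"
proof -
  have "energy V1 u x \<bullet> energy V1 v x
      = weak_grad UNIV u x \<bullet> weak_grad UNIV v x + V1 x * ae_rep u x * ae_rep v x" for x
  proof -
    have "energy V1 u x \<bullet> energy V1 v x = weak_grad UNIV u x \<bullet> weak_grad UNIV v x
        + (sqrt (V1 x) * sqrt (V1 x)) * ae_rep u x * ae_rep v x"
      by (simp only: energy_def inner_Pair inner_real_def mult_ac)
    then show ?thesis using V1_nonneg[of x] by simp
  qed
  then show ?thesis by (simp add: A_inner_def set_lebesgue_integral_def)
qed

lemma sym_form_A: "sym_form W a"
proof -
  have "sym_form W (\<lambda>u v. LINT x|lebesgue. 1 * (energy V1 u x \<bullet> energy V1 v x))"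
    by (rule sym_form_integral[where C = 1]; (rule subspace_form_domain form_domain_L2 energy_add
        energy_scale | simp))
  then show ?thesis by (simp add: A_inner_energy[abs_def])
qed

lemma sym_form_V:
  assumes "Linf V2"
  shows "sym_form W (V_form UNIV V2)"
proof -
  obtain C where C: "V2 \<in> borel_measurable lebesgue" "AE x in lebesgue. \<bar>V2 x\<bar> \<le> C"
    using assms by (auto simp: Linf_def)
  have "sym_form W (\<lambda>u v. LINT x|lebesgue. V2 x * (ae_rep u x \<bullet> ae_rep v x))"
  proof (rule sym_form_integral[OF subspace_form_domain _ _ _ C])
    show "AE x in lebesgue. ae_rep (c *\<^sub>R u) x = c *\<^sub>R ae_rep u x" for c and u :: "'d ae_fun"
      using ae_rep_scale[of c u] by simp
  qed (rule form_domain_L2 ae_rep_add, assumption?)+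
  then show ?thesis by (simp add: V_form_def[abs_def] set_lebesgue_integral_def mult.assoc)
qed

lemma sym_form_L2: "sym_form W (L2_inner UNIV)"
proof -
  have "Linf (\<lambda>_::real^'d. 1)" by (auto simp: Linf_def)
  from sym_form_V[OF this] show ?thesis
    by (simp add: V_form_def[abs_def] L2_inner_def[abs_def])
qed

lemma A_inner_split:
  assumes "u \<in> W"
  shows "a u u = sqnorm lebesgue (weak_grad UNIV u) + (LINT x|lebesgue. V1 x * (ae_rep u x)\<^sup>2)"
proof -
  have "a u u = (LINT x|lebesgue. (norm (weak_grad UNIV u x))\<^sup>2 + V1 x * (ae_rep u x)\<^sup>2)"
    by (simp add: A_inner_def set_lebesgue_integral_def power2_norm_eq_inner,
        simp add: power2_eq_square mult.assoc)
  then show ?thesis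
    using assms square_integrable_norm[OF form_domain_L2(2)[OF assms]] by (simp add: form_domain_def)
qed

lemma tail_bound:
  assumes "u \<in> W" "T \<in> sets lebesgue" "\<kappa> > 0" "\<And>x. x \<in> T \<Longrightarrow> \<kappa> \<le> V1 x"
  shows "\<kappa> * (LINT x:T|lebesgue. (ae_rep u x)\<^sup>2) \<le> (LINT x|lebesgue. V1 x * (ae_rep u x)\<^sup>2)"
proof -
  have i: "integrable lebesgue (\<lambda>x. (ae_rep u x)\<^sup>2)"
    using square_integrable_power2[OF form_domain_L2(1)[OF assms(1)]] .
  have "\<kappa> * (LINT x:T|lebesgue. (ae_rep u x)\<^sup>2) = (LINT x|lebesgue. \<kappa> * (indicator T x *\<^sub>R (ae_rep u x)\<^sup>2))"
    by (simp add: set_lebesgue_integral_def)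
  also have "\<dots> \<le> (LINT x|lebesgue. V1 x * (ae_rep u x)\<^sup>2)"
  proof (rule integral_mono)
    show "integrable lebesgue (\<lambda>x. \<kappa> * (indicator T x *\<^sub>R (ae_rep u x)\<^sup>2))"
      by (intro integrable_mult_right integrable_mult_indicator assms(2) i)
    show "integrable lebesgue (\<lambda>x. V1 x * (ae_rep u x)\<^sup>2)" using assms(1) by (simp add: form_domain_def)
    show "\<kappa> * (indicator T x *\<^sub>R (ae_rep u x)\<^sup>2) \<le> V1 x * (ae_rep u x)\<^sup>2" for x
      using assms(4)[of x] V1_nonneg[of x] by (cases "x \<in> T") (auto intro!: mult_right_mono)
  qed
  finally show ?thesis .
qed

lemma V1_large_outside_ball:
  obtains R where "R > 0" "\<And>x. R \<le> norm x \<Longrightarrow> \<kappa> \<le> V1 x"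
proof -
  have "\<forall>\<^sub>F x in at_infinity. \<kappa> \<le> V1 x" using V1_coercive by (simp add: filterlim_at_top)
  then obtain b where b: "\<And>x. b \<le> norm x \<Longrightarrow> \<kappa> \<le> V1 x" unfolding eventually_at_infinity by blast
  show ?thesis using b by (intro that[of "max b 1"]) auto
qed

text \<open>Outside a ball of radius \<open>R\<close> the mass of \<open>u\<close> is controlled by the potential. A translation of length \<open>2 R\<close>
  moves the ball off itself, so the mass inside is controlled as well.\<close>
lemma Poincare:
  obtains C where "C \<ge> 0" "\<And>u. u \<in> W \<Longrightarrow> (LINT x|lebesgue. (ae_rep u x)\<^sup>2) \<le> C * a u u"
proof -
  obtain R where R: "R > 0" "\<And>x. R \<le> norm x \<Longrightarrow> 1 \<le> V1 x"
    by (rule V1_large_outside_ball[of 1]) blast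
  define h :: "real^'d" where "h = (2 * R) *\<^sub>R axis (SOME i. True) 1"
  have h: "norm h = 2 * R" using R by (simp add: h_def norm_axis_1)
  define S where "S = ball (0 :: real^'d) R"
  have S: "S \<in> sets borel" "S \<in> sets lebesgue" "- S \<in> sets lebesgue"
    by (auto simp: S_def intro: Compl_in_sets_lebesgue[THEN iffD2])
  have out: "x + h \<notin> S" if "x \<in> S" for x
    using norm_triangle_ineq2[of h "- x"] that by (simp add: S_def h add.commute)
  have "(LINT x|lebesgue. (ae_rep u x)\<^sup>2) \<le> (8 * R\<^sup>2 + 3) * a u u" if u: "u \<in> W" for u
  proof -
    note L2 = form_domain_L2[OF u]
    obtain \<phi> where \<phi>: "\<And>n. \<phi> n \<in> test_functions UNIV" "L2_tendsto lebesgue \<phi> (ae_rep u)"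
      "L2_tendsto lebesgue (\<lambda>n. classical_grad (\<phi> n)) (weak_grad UNIV u)"
      using L2(4) by (auto simp: test_approximable_def)
    note sq = test_function_square_integrable[OF \<phi>(1)] classical_grad_square_integrable[OF \<phi>(1)]
    have "(LINT x:S|lebesgue. (norm (ae_rep u x))\<^sup>2)
        \<le> 2 * (norm h)\<^sup>2 * sqnorm lebesgue (weak_grad UNIV u)
          + 2 * (LINT x:-S|lebesgue. (norm (ae_rep u x))\<^sup>2)"
    proof (rule LIMSEQ_le)
      show "(\<lambda>n. LINT x:S|lebesgue. (norm (\<phi> n x))\<^sup>2) \<longlonglongrightarrow> (LINT x:S|lebesgue. (norm (ae_rep u x))\<^sup>2)"
        by (rule L2_tendsto_set_norm[OF sq(1) L2(1) \<phi>(2) S(2)])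
      show "(\<lambda>n. 2 * (norm h)\<^sup>2 * sqnorm lebesgue (classical_grad (\<phi> n))
          + 2 * (LINT x:-S|lebesgue. (norm (\<phi> n x))\<^sup>2))
        \<longlonglongrightarrow> 2 * (norm h)\<^sup>2 * sqnorm lebesgue (weak_grad UNIV u)
          + 2 * (LINT x:-S|lebesgue. (norm (ae_rep u x))\<^sup>2)"
        by (intro tendsto_intros L2_tendsto_norm[OF sq(2) L2(2) \<phi>(3)]
            L2_tendsto_set_norm[OF sq(1) L2(1) \<phi>(2) S(3)])
      show "\<exists>N. \<forall>n\<ge>N. (LINT x:S|lebesgue. (norm (\<phi> n x))\<^sup>2)
        \<le> 2 * (norm h)\<^sup>2 * sqnorm lebesgue (classical_grad (\<phi> n))
          + 2 * (LINT x:-S|lebesgue. (norm (\<phi> n x))\<^sup>2)"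
        using test_function_translate_diff_le[OF \<phi>(1) S(1) out] by simp
    qed
    then have S_bound: "(LINT x:S|lebesgue. (ae_rep u x)\<^sup>2)
        \<le> 8 * R\<^sup>2 * sqnorm lebesgue (weak_grad UNIV u)
          + 2 * (LINT x:-S|lebesgue. (ae_rep u x)\<^sup>2)"
      by (simp add: h power_mult_distrib)
    have T_bound: "1 * (LINT x:-S|lebesgue. (ae_rep u x)\<^sup>2) \<le> (LINT x|lebesgue. V1 x * (ae_rep u x)\<^sup>2)"
      using R(2) by (intro tail_bound[OF u S(3)]) (auto simp: S_def)
    have nn: "0 \<le> sqnorm lebesgue (weak_grad UNIV u)" "0 \<le> (LINT x|lebesgue. V1 x * (ae_rep u x)\<^sup>2)"
      using V1_nonneg by (auto intro!: integral_nonneg_AE)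
    have "(LINT x|lebesgue. (ae_rep u x)\<^sup>2)
        \<le> 8 * R\<^sup>2 * sqnorm lebesgue (weak_grad UNIV u) + 3 * (LINT x|lebesgue. V1 x * (ae_rep u x)\<^sup>2)"
      using integral_split_set[OF square_integrable_power2[OF L2(1)] S(2)] S_bound T_bound by linarith
    also have "\<dots> \<le> (8 * R\<^sup>2 + 3) * a u u"
      unfolding A_inner_split[OF u] using nn by (simp add: algebra_simps)
    finally show ?thesis .
  qed
  then show ?thesis using that[of "8 * R\<^sup>2 + 3"] by simp
qed

lemma A_inner_pos:
  assumes "u \<in> W" "u \<noteq> 0"
  shows "0 < a u u"
proof -
  obtain C where C: "C \<ge> 0" "\<And>u. u \<in> W \<Longrightarrow> (LINT x|lebesgue. (ae_rep u x)\<^sup>2) \<le> C * a u u"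
    by (rule Poincare) blast
  have "0 \<le> a u u" by (simp add: A_inner_energy)
  moreover have "a u u \<noteq> 0"
  proof
    assume "a u u = 0"
    then have "(LINT x|lebesgue. (ae_rep u x)\<^sup>2) \<le> 0" using C(2)[OF assms(1)] by simp
    moreover have "0 \<le> (LINT x|lebesgue. (ae_rep u x)\<^sup>2)" by simp
    ultimately have "(LINT x|lebesgue. (ae_rep u x)\<^sup>2) = 0" by simp
    then show False using ae_fun_eq_zero[OF form_domain_L2(1)[OF assms(1)]] assms(2) by blast
  qed
  ultimately show ?thesis by simp
qed

lemma inner_form_A: "inner_form W a"
  using sym_form_A A_inner_pos by (simp add: inner_form_def inner_form_axioms_def)

text \<open>The compactness of the embedding of \<open>W\<close> into \<open>L\<^sup>2\<close>: up to an error \<open>\<delta> a u u\<close>, the norm of \<open>u\<close> is seen by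
  finitely many functionals, namely the means over finitely many cells of a grid that cover the ball
  outside of which \<open>V1 \<ge> 1 / \<delta>\<close>.\<close>
lemma finite_rank_L2_bound:
  assumes "\<delta> > 0"
  obtains K :: "(int^'d) set" and l :: "int^'d \<Rightarrow> 'd ae_fun \<Rightarrow> real" and M where "finite K"
    "\<And>k. k \<in> K \<Longrightarrow> linear_functional_on W (l k)"
    "\<And>k u. k \<in> K \<Longrightarrow> u \<in> W \<Longrightarrow> (l k u)\<^sup>2 \<le> M * a u u"
    "\<And>u. u \<in> W \<Longrightarrow> (LINT x|lebesgue. (ae_rep u x)\<^sup>2) \<le> \<delta> * a u u + (\<Sum>k\<in>K. (l k u)\<^sup>2)"
proof -
  obtain R where R: "R > 0" "\<And>x. R \<le> norm x \<Longrightarrow> 1 / \<delta> \<le> V1 x"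
    by (rule V1_large_outside_ball[of "1 / \<delta>"]) blast
  let ?d = "CARD('d)"
  define c where "c = 2 ^ ?d * (real ?d)\<^sup>2"
  have c: "c > 0" by (simp add: c_def)
  \<comment> \<open>The cell width for which the constant of the grid inequality is \<open>\<delta>\<close>.\<close>
  define s where "s = sqrt (\<delta> / c)"
  have s: "s > 0" and s2: "c * s\<^sup>2 = \<delta>" using assms c by (auto simp: s_def)
  define q where "q = s ^ ?d"
  have q: "q > 0" using s by (simp add: q_def)
  define K where "K = {k :: int^'d. \<forall>i. \<bar>k $ i\<bar> \<le> \<lceil>R / s\<rceil> + 1}"
  have K: "finite K" unfolding K_def by (rule finite_int_vectors)
  define B where "B = (\<Union>k\<in>K. grid_cell s k)"
  have Bb: "B \<in> sets borel" unfolding B_def using K grid_cell_borel by (intro sets.finite_UN) auto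
  then have B: "B \<in> sets lebesgue" "- B \<in> sets lebesgue" by (auto intro: Compl_in_sets_lebesgue[THEN iffD2])
  have ball: "x \<in> B" if "norm x < R" for x
  proof -
    have "\<bar>grid_index s x $ i\<bar> \<le> \<lceil>R / s\<rceil> + 1" for i
    proof -
      have "\<bar>x $ i\<bar> \<le> R" using component_le_norm_cart[of x i] that by simp
      then have "x $ i \<le> R" "- R \<le> x $ i" by auto
      then have "x $ i / s \<le> R / s" "- (R / s) \<le> x $ i / s"
        using s divide_right_mono[of "- R" "x $ i" s] by (auto simp: divide_right_mono)
      then have "\<lfloor>x $ i / s\<rfloor> \<le> \<lceil>R / s\<rceil> + 1" "- \<lfloor>x $ i / s\<rfloor> \<le> \<lceil>R / s\<rceil> + 1" by linarith+
      then show ?thesis by (simp add: grid_index_def)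
    qed
    then have "grid_index s x \<in> K" by (simp add: K_def)
    then show ?thesis by (auto simp: B_def grid_cell_def)
  qed
  let ?I = "\<lambda>k u. LINT x:grid_cell s k|lebesgue. ae_rep u x"
  \<comment> \<open>Normalized such that \<open>(l k u)\<^sup>2\<close> is the squared integral divided by the volume of the cell.\<close>
  define l :: "int^'d \<Rightarrow> 'd ae_fun \<Rightarrow> real" where "l = (\<lambda>k u. ?I k u / sqrt q)"
  have cell: "square_integrable lebesgue (indicator (grid_cell s k) :: _ \<Rightarrow> real)"
      "sqnorm lebesgue (\<lambda>x. indicator (grid_cell s k) x :: real) = q" for k :: "int^'d"
  proof -
    have cb: "grid_cell s k \<in> sets borel" by (rule grid_cell_borel)
    have em: "emeasure lebesgue (grid_cell s k) = ennreal q"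
      using emeasure_grid_cell[OF s, of k] cb by (simp add: q_def)
    have n: "(\<lambda>x. (norm (indicator (grid_cell s k) x :: real))\<^sup>2) = indicator (grid_cell s k)"
      by (auto simp: indicator_def)
    have i: "integrable lebesgue (indicator (grid_cell s k) :: _ \<Rightarrow> real)"
      using em cb by (intro integrable_real_indicator) auto
    then show "square_integrable lebesgue (indicator (grid_cell s k) :: _ \<Rightarrow> real)"
      unfolding square_integrable_def n by (auto intro: borel_measurable_integrable)
    show "sqnorm lebesgue (\<lambda>x. indicator (grid_cell s k) x :: real) = q"
      unfolding n using em q by (simp add: measure_def)
  qed
  have I: "?I k u = (LINT x|lebesgue. indicator (grid_cell s k) x \<bullet> ae_rep u x)" for k u
    by (simp add: set_lebesgue_integral_def)
  have lin: "linear_functional_on W (l k)" for k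
    unfolding linear_functional_on_def
  proof (intro conjI ballI allI)
    have int: "integrable lebesgue (\<lambda>x. indicator (grid_cell s k) x \<bullet> ae_rep u x)" if "u \<in> W" for u
      using square_integrable_inner[OF cell(1) form_domain_L2(1)[OF that]] .
    note m = borel_measurable_integrable[OF int]
    fix u v assume uv: "u \<in> W" "v \<in> W"
    then have uvW: "u + v \<in> W" using subspace_add[OF subspace_form_domain] by blast
    have "?I k (u + v) = (LINT x|lebesgue. indicator (grid_cell s k) x \<bullet> ae_rep u x
        + indicator (grid_cell s k) x \<bullet> ae_rep v x)"
      unfolding I
    proof (rule integral_cong_AE[OF m[OF uvW] borel_measurable_add[OF m[OF uv(1)] m[OF uv(2)]]])
      show "AE x in lebesgue. (indicator (grid_cell s k) x :: real) \<bullet> ae_rep (u + v) x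
        = indicator (grid_cell s k) x \<bullet> ae_rep u x + indicator (grid_cell s k) x \<bullet> ae_rep v x"
        using ae_rep_add[of u v] by eventually_elim (simp add: distrib_left)
    qed
    then have "?I k (u + v) = ?I k u + ?I k v"
      unfolding I using int[OF uv(1)] int[OF uv(2)] by simp
    then show "l k (u + v) = l k u + l k v" by (simp add: l_def add_divide_distrib)
  next
    have int: "integrable lebesgue (\<lambda>x. indicator (grid_cell s k) x \<bullet> ae_rep u x)" if "u \<in> W" for u
      using square_integrable_inner[OF cell(1) form_domain_L2(1)[OF that]] .
    note m = borel_measurable_integrable[OF int]
    fix r u assume u: "u \<in> W"
    then have ru: "r *\<^sub>R u \<in> W" using subspace_scale[OF subspace_form_domain] by blast
    have "?I k (r *\<^sub>R u) = (LINT x|lebesgue. r * (indicator (grid_cell s k) x \<bullet> ae_rep u x))"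
      unfolding I
    proof (rule integral_cong_AE[OF m[OF ru] borel_measurable_times[OF borel_measurable_const m[OF u]]])
      show "AE x in lebesgue. (indicator (grid_cell s k) x :: real) \<bullet> ae_rep (r *\<^sub>R u) x
        = r * (indicator (grid_cell s k) x \<bullet> ae_rep u x)"
        using ae_rep_scale[of r u] by eventually_elim simp
    qed
    then have "?I k (r *\<^sub>R u) = r * ?I k u" unfolding I by simp
    then show "l k (r *\<^sub>R u) = r * l k u" by (simp add: l_def)
  qed
  obtain C where C: "C \<ge> 0" "\<And>u. u \<in> W \<Longrightarrow> (LINT x|lebesgue. (ae_rep u x)\<^sup>2) \<le> C * a u u"
    by (rule Poincare) blast
  have lsq: "(l k u)\<^sup>2 = (?I k u)\<^sup>2 / q" for k u using q by (simp add: l_def power_divide)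
  have bound: "(l k u)\<^sup>2 \<le> C * a u u" if u: "u \<in> W" for k u
  proof -
    have "(?I k u)\<^sup>2 \<le> q * sqnorm lebesgue (ae_rep u)"
      using integral_inner_Cauchy_Schwarz[OF cell(1) form_domain_L2(1)[OF u], of k] unfolding cell(2) I .
    then have "(l k u)\<^sup>2 \<le> (LINT x|lebesgue. (ae_rep u x)\<^sup>2)"
      unfolding lsq using q by (simp add: field_simps)
    then show ?thesis using C(2)[OF u] by linarith
  qed
  have main: "(LINT x|lebesgue. (ae_rep u x)\<^sup>2) \<le> \<delta> * a u u + (\<Sum>k\<in>K. (l k u)\<^sup>2)" if u: "u \<in> W" for u
  proof -
    note L2 = form_domain_L2[OF u]
    obtain \<phi> where \<phi>: "\<And>n. \<phi> n \<in> test_functions UNIV" "L2_tendsto lebesgue \<phi> (ae_rep u)"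
      "L2_tendsto lebesgue (\<lambda>n. classical_grad (\<phi> n)) (weak_grad UNIV u)"
      using L2(4) by (auto simp: test_approximable_def)
    note sq = test_function_square_integrable[OF \<phi>(1)] classical_grad_square_integrable[OF \<phi>(1)]
    have "(LINT x:B|lebesgue. (norm (ae_rep u x))\<^sup>2)
        \<le> c * s\<^sup>2 * sqnorm lebesgue (weak_grad UNIV u) + (\<Sum>k\<in>K. (?I k u)\<^sup>2) / q"
    proof (rule LIMSEQ_le)
      show "(\<lambda>n. LINT x:B|lebesgue. (norm (\<phi> n x))\<^sup>2) \<longlonglongrightarrow> (LINT x:B|lebesgue. (norm (ae_rep u x))\<^sup>2)"
        by (rule L2_tendsto_set_norm[OF sq(1) L2(1) \<phi>(2) B(1)])
      have "(\<lambda>n. LINT x:grid_cell s k|lebesgue. \<phi> n x) \<longlonglongrightarrow> ?I k u" for k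
        using L2_tendsto_inner[OF cell(1) cell(1) L2_tendsto_const sq(1) L2(1) \<phi>(2), of k]
        by (simp add: set_lebesgue_integral_def)
      then show "(\<lambda>n. c * s\<^sup>2 * sqnorm lebesgue (classical_grad (\<phi> n))
          + (\<Sum>k\<in>K. (LINT x:grid_cell s k|lebesgue. \<phi> n x)\<^sup>2) / q)
        \<longlonglongrightarrow> c * s\<^sup>2 * sqnorm lebesgue (weak_grad UNIV u) + (\<Sum>k\<in>K. (?I k u)\<^sup>2) / q"
        using q by (intro tendsto_intros L2_tendsto_norm[OF sq(2) L2(2) \<phi>(3)]) auto
      show "\<exists>N. \<forall>n\<ge>N. (LINT x:B|lebesgue. (norm (\<phi> n x))\<^sup>2)
        \<le> c * s\<^sup>2 * sqnorm lebesgue (classical_grad (\<phi> n))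
          + (\<Sum>k\<in>K. (LINT x:grid_cell s k|lebesgue. \<phi> n x)\<^sup>2) / q"
        using grid_Poincare[OF \<phi>(1) s K] by (simp add: B_def c_def q_def)
    qed
    then have B_bound: "(LINT x:B|lebesgue. (ae_rep u x)\<^sup>2)
        \<le> \<delta> * sqnorm lebesgue (weak_grad UNIV u) + (\<Sum>k\<in>K. (l k u)\<^sup>2)"
      unfolding lsq s2 by (simp add: sum_divide_distrib)
    have "1 / \<delta> * (LINT x:-B|lebesgue. (ae_rep u x)\<^sup>2) \<le> (LINT x|lebesgue. V1 x * (ae_rep u x)\<^sup>2)"
      using R(2) ball assms by (intro tail_bound[OF u B(2)]) (auto simp: not_less[symmetric])
    then have T_bound: "(LINT x:-B|lebesgue. (ae_rep u x)\<^sup>2) \<le> \<delta> * (LINT x|lebesgue. V1 x * (ae_rep u x)\<^sup>2)"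
      using assms by (simp add: field_simps)
    show ?thesis
      using integral_split_set[OF square_integrable_power2[OF L2(1)] B(1)] B_bound T_bound
      unfolding A_inner_split[OF u] distrib_left by linarith
  qed
  show ?thesis by (rule that[OF K lin bound main])
qed

text \<open>The energy vectors and the functions themselves converge in the mean and, on a subsequence, almost
  everywhere. The latter identifies the limit of \<open>sqrt V1 u\<^sub>n\<close>. Test functions that are ever closer to the
  members of the sequence approximate its limit, which therefore belongs to \<open>H1_0 UNIV\<close> again.\<close>
lemma form_domain_complete:
  assumes u: "\<And>n. u n \<in> W"
    and Cauchy: "\<And>e. e > 0 \<Longrightarrow> \<exists>N. \<forall>m\<ge>N. \<forall>n\<ge>N. a (u m - u n) (u m - u n) < e"
  shows "\<exists>w\<in>W. (\<lambda>n. a (u n - w) (u n - w)) \<longlonglongrightarrow> 0"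
proof -
  define f where "f = (\<lambda>u x. (energy V1 u x, ae_rep u x))"
  have f: "square_integrable lebesgue (f v)" if "v \<in> W" for v
    unfolding f_def using form_domain_L2[OF that] by (intro square_integrable_Pair)
  have fdiff: "AE x in lebesgue. f v x - f w x = f (v - w) x" if vw: "v \<in> W" "w \<in> W" for v w
  proof -
    have d: "v - w \<in> W" using vw subspace_diff[OF subspace_form_domain] by blast
    have eq: "(v - w) + w = v" by simp
    from energy_add[OF d vw(2), unfolded eq] ae_rep_add[of "v - w" w, unfolded eq] show ?thesis
      by eventually_elim (simp add: f_def)
  qed
  have dist: "sqnorm lebesgue (\<lambda>x. f v x - f w x) = a (v - w) (v - w) + (LINT x|lebesgue. (ae_rep (v - w) x)\<^sup>2)"
    if vw: "v \<in> W" "w \<in> W" for v w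
  proof -
    have d: "v - w \<in> W" using vw subspace_diff[OF subspace_form_domain] by blast
    have "sqnorm lebesgue (\<lambda>x. f v x - f w x) = sqnorm lebesgue (f (v - w))"
    proof (rule integral_cong_AE)
      show "(\<lambda>x. (norm (f v x - f w x))\<^sup>2) \<in> borel_measurable lebesgue"
        by (intro borel_measurable_norm_sq square_integrable_measurable
            square_integrable_diff f vw)
      show "(\<lambda>x. (norm (f (v - w) x))\<^sup>2) \<in> borel_measurable lebesgue"
        by (intro borel_measurable_norm_sq square_integrable_measurable f d)
      show "AE x in lebesgue. (norm (f v x - f w x))\<^sup>2 = (norm (f (v - w) x))\<^sup>2"
        using fdiff[OF vw] by eventually_elim simp
    qed
    also have "\<dots> = a (v - w) (v - w) + (LINT x|lebesgue. (ae_rep (v - w) x)\<^sup>2)"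
      unfolding f_def norm_Pair_sq A_inner_energy power2_norm_eq_inner[symmetric]
      using square_integrable_norm[OF form_domain_L2(3)[OF d]] square_integrable_norm[OF form_domain_L2(1)[OF d]]
      by simp
    finally show ?thesis .
  qed
  obtain C where C: "C \<ge> 0" "\<And>u. u \<in> W \<Longrightarrow> (LINT x|lebesgue. (ae_rep u x)\<^sup>2) \<le> C * a u u"
    by (rule Poincare) blast
  have "\<exists>N. \<forall>m\<ge>N. \<forall>n\<ge>N. (sqnorm lebesgue (\<lambda>x. f (u m) x - f (u n) x)) < e" if e: "e > 0" for e
  proof -
    have "e / (1 + C) > 0" using e C(1) by simp
    then obtain N where N: "\<And>m n. m \<ge> N \<Longrightarrow> n \<ge> N \<Longrightarrow> a (u m - u n) (u m - u n) < e / (1 + C)"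
      using Cauchy by blast
    have "sqnorm lebesgue (\<lambda>x. f (u m) x - f (u n) x) < e" if "m \<ge> N" "n \<ge> N" for m n
    proof -
      have "u m - u n \<in> W" using u subspace_diff[OF subspace_form_domain] by blast
      then have "sqnorm lebesgue (\<lambda>x. f (u m) x - f (u n) x) \<le> (1 + C) * a (u m - u n) (u m - u n)"
        unfolding dist[OF u u] using C(2) by (simp add: distrib_right)
      also have "\<dots> < e" using N[OF that] C(1) by (simp add: field_simps)
      finally show ?thesis .
    qed
    then show ?thesis by blast
  qed
  then obtain F r where F: "square_integrable lebesgue F" "L2_tendsto lebesgue (\<lambda>n. f (u n)) F"
    "strict_mono (r :: nat \<Rightarrow> nat)" "AE x in lebesgue. (\<lambda>n. f (u (r n)) x) \<longlonglongrightarrow> F x"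
    using square_integrable_complete[of lebesgue "\<lambda>n. f (u n)"] f[OF u] by blast
  define G where "G = (\<lambda>x. fst (fst (F x)))"
  define g where "g = (\<lambda>x. snd (F x))"
  have G: "square_integrable lebesgue G" and g: "square_integrable lebesgue g"
    unfolding G_def g_def
    by (rule square_integrable_fst_snd(1)[OF square_integrable_fst_snd(1)[OF F(1)]],
        rule square_integrable_fst_snd(2)[OF F(1)])
  define w where "w = ae_class g"
  have wg: "AE x in lebesgue. ae_rep w x = g x"
    unfolding w_def by (rule ae_rep_class[OF square_integrable_measurable[OF g]])
  have F_eq: "AE x in lebesgue. F x = ((G x, sqrt (V1 x) * g x), g x)"
    using F(4)
  proof eventually_elim
    case (elim x)
    have 1: "(\<lambda>n. snd (f (u (r n)) x)) \<longlonglongrightarrow> g x"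
      unfolding g_def by (rule tendsto_snd[OF elim])
    have "(\<lambda>n. sqrt (V1 x) * snd (f (u (r n)) x)) \<longlonglongrightarrow> sqrt (V1 x) * g x"
      by (rule tendsto_mult_left[OF 1])
    moreover have "(\<lambda>n. snd (fst (f (u (r n)) x))) \<longlonglongrightarrow> snd (fst (F x))"
      by (rule tendsto_snd[OF tendsto_fst[OF elim]])
    ultimately have "snd (fst (F x)) = sqrt (V1 x) * g x"
      by (simp add: f_def energy_def LIMSEQ_unique)
    then show ?case by (simp add: G_def g_def prod_eq_iff)
  qed
  obtain \<phi> where \<phi>: "\<And>n. \<phi> n \<in> test_functions UNIV"
    "\<And>n. (sqnorm lebesgue (\<lambda>x. \<phi> n x - ae_rep (u n) x)) < inverse (real (Suc n))"
    "\<And>n. (sqnorm lebesgue (\<lambda>x. classical_grad (\<phi> n) x - weak_grad UNIV (u n) x)) < inverse (real (Suc n))"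
    using test_approximable_choice[of "\<lambda>n. ae_rep (u n)" "\<lambda>n. weak_grad UNIV (u n)",
      OF form_domain_L2(4)[OF u]] by blast
  have comp: "norm (snd (z::((real^'d) \<times> real) \<times> real)) \<le> norm z" "norm (fst (fst z)) \<le> norm z" for z
    using norm_snd_le[of "snd z" "fst z"] norm_fst_le[of "fst z" "snd z"]
      norm_fst_le[of "fst (fst z)" "snd (fst z)"] by simp_all
  have "L2_tendsto lebesgue (\<lambda>n. ae_rep (u n)) g"
  proof (rule L2_tendsto_dominated[OF F(2) square_integrable_diff[OF f[OF u] F(1)]])
    show "(\<lambda>x. ae_rep (u n) x - g x) \<in> borel_measurable lebesgue" for n
      by (intro square_integrable_measurable square_integrable_diff g form_domain_L2(1)[OF u])
    show "AE x in lebesgue. norm (ae_rep (u n) x - g x) \<le> norm (f (u n) x - F x)" for n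
      using comp(1)[of "f (u n) _ - F _"] by (simp add: f_def g_def)
  qed
  then have lim_g: "L2_tendsto lebesgue \<phi> g"
    by (rule L2_tendsto_perturb[OF test_function_square_integrable[OF \<phi>(1)]
          form_domain_L2(1)[OF u] g _ less_imp_le[OF \<phi>(2)]])
  have "L2_tendsto lebesgue (\<lambda>n. weak_grad UNIV (u n)) G"
  proof (rule L2_tendsto_dominated[OF F(2) square_integrable_diff[OF f[OF u] F(1)]])
    show "(\<lambda>x. weak_grad UNIV (u n) x - G x) \<in> borel_measurable lebesgue" for n
      by (intro square_integrable_measurable square_integrable_diff G form_domain_L2(2)[OF u])
    show "AE x in lebesgue. norm (weak_grad UNIV (u n) x - G x) \<le> norm (f (u n) x - F x)" for n
      using comp(2)[of "f (u n) _ - F _"] by (simp add: f_def G_def energy_def)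
  qed
  then have lim_G: "L2_tendsto lebesgue (\<lambda>n. classical_grad (\<phi> n)) G"
    by (rule L2_tendsto_perturb[OF classical_grad_square_integrable[OF \<phi>(1)]
          form_domain_L2(2)[OF u] G _ less_imp_le[OF \<phi>(3)]])
  have "test_approximable g G"
    using g G \<phi>(1) lim_g lim_G unfolding test_approximable_def by blast
  moreover have "AE x in lebesgue. g x = ae_rep w x" using wg by eventually_elim simp
  ultimately have "test_approximable (ae_rep w) G"
    by (rule test_approximable_AE_cong_fun[OF _ _ ae_rep_measurable])
  note w = test_approximable_H1_0_UNIV[OF this]
  have F_f: "AE x in lebesgue. F x = f w x"
    using F_eq w(2) wg
  proof eventually_elim
    case (elim x)
    then show ?case by (simp only: f_def energy_def)
  qed
  have "square_integrable lebesgue (\<lambda>x. snd (fst (F x)))"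
    by (rule square_integrable_fst_snd(2)[OF square_integrable_fst_snd(1)[OF F(1)]])
  moreover have "AE x in lebesgue. snd (fst (F x)) = sqrt (V1 x) * ae_rep w x"
    using F_f by eventually_elim (simp add: f_def energy_def)
  ultimately have "square_integrable lebesgue (\<lambda>x. sqrt (V1 x) * ae_rep w x)"
    by (rule square_integrable_AE_cong[OF _ borel_measurable_times[OF sqrt_V1_measurable ae_rep_measurable]])
  then have wW: "w \<in> W"
    using w(1) square_integrable_sqrt_V1[OF ae_rep_measurable, of w] by (simp add: form_domain_def)
  have "L2_tendsto lebesgue (\<lambda>n. f (u n)) (f w)"
    using F(2) by (rule L2_tendsto_AE_cong[OF _ _ _ _ F_f])
       (intro square_integrable_measurable f u wW F(1))+
  then have lim: "(\<lambda>n. a (u n - w) (u n - w) + (LINT x|lebesgue. (ae_rep (u n - w) x)\<^sup>2)) \<longlonglongrightarrow> 0"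
    unfolding L2_tendsto_def dist[OF u wW] .
  have "(\<lambda>n. a (u n - w) (u n - w)) \<longlonglongrightarrow> 0"
    using sum_tendsto_0D(1)[OF lim] by (simp add: A_inner_energy)
  then show ?thesis using wW by blast
qed

end

section \<open>Uniform spectral bounds\<close>

lemma inner_form_transfer:
  assumes "inner_form W a" "subspace X" "X \<subseteq> W" "\<And>u v. u \<in> X \<Longrightarrow> v \<in> X \<Longrightarrow> b u v = a u v"
  shows "inner_form X b"
proof -
  interpret inner_form W a by fact
  have *: "u \<in> W" if "u \<in> X" for u using that assms(3) by blast
  show ?thesis
  proof
    show "subspace X" by fact
    show "b u v = b v u" if "u \<in> X" "v \<in> X" for u v
      using that by (simp add: assms(4) commute *)
    show "b (u + v) w = b u w + b v w" if "u \<in> X" "v \<in> X" "w \<in> X" for u v w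
      using that subspace_add[OF assms(2) that(1,2)] by (simp add: assms(4) add_left *)
    show "b (c *\<^sub>R u) v = c * b u v" if "u \<in> X" "v \<in> X" for c u v
      using that subspace_scale[OF assms(2) that(1)] by (simp add: assms(4) scale_left *)
    show "0 < b u u" if "u \<in> X" "u \<noteq> 0" for u
      using that pos by (simp add: assms(4) *)
  qed
qed

lemma galerkin_op_characterization:
  assumes m: "inner_form X (L2_inner \<Omega>)" and B: "finite B" "X = span B"
    and b: "linear_functional_on X (b u)"
  shows "galerkin_op \<Omega> X b u \<in> X \<and> (\<forall>v\<in>X. L2_inner \<Omega> (galerkin_op \<Omega> X b u) v = b u v)"
  unfolding galerkin_op_def
proof (rule theI')
  interpret inner_form X "L2_inner \<Omega>" by fact
  show "\<exists>!w. w \<in> X \<and> (\<forall>v\<in>X. L2_inner \<Omega> w v = b u v)"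
  proof (rule ex_ex1I)
    show "\<exists>w. w \<in> X \<and> (\<forall>v\<in>X. L2_inner \<Omega> w v = b u v)"
      using Riesz_representation[OF B b] by blast
    show "w = w'" if "w \<in> X \<and> (\<forall>v\<in>X. L2_inner \<Omega> w v = b u v)"
      "w' \<in> X \<and> (\<forall>v\<in>X. L2_inner \<Omega> w' v = b u v)" for w w'
      using that by (intro eqI) auto
  qed
qed

text \<open>By the Riesz representation theorem on \<open>X\<close> the first Galerkin operator is a bijection of \<open>X\<close>, so \<open>T u = \<mu> u\<close>
  says that both Galerkin operators agree on \<open>\<mu> u\<close> and \<open>u\<close>, respectively. Testing this equality with
  \<open>w \<in> X\<close> in the \<open>L\<^sup>2\<close> inner product leaves only the two forms.\<close>
lemma precond_op_eigen_iff:
  assumes m: "inner_form X (L2_inner \<Omega>)" and a: "inner_form X (A_inner \<Omega> V1)"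
    and v: "sym_form X (V_form \<Omega> V2)" and B: "finite B" "X = span B" and u: "u \<in> X"
  shows "precond_op \<Omega> V1 V2 X u = \<mu> *\<^sub>R u
    \<longleftrightarrow> (\<forall>w\<in>X. A_inner \<Omega> V1 u w + V_form \<Omega> V2 u w = \<mu> * A_inner \<Omega> V1 u w)"
proof -
  interpret M: inner_form X "L2_inner \<Omega>" by fact
  interpret A: inner_form X "A_inner \<Omega> V1" by fact
  interpret V: sym_form X "V_form \<Omega> V2" by fact
  interpret Q: sym_form X "\<lambda>u v. A_inner \<Omega> V1 u v + V_form \<Omega> V2 u v"
    by (rule sym_form_sum) (unfold_locales)
  let ?Q = "\<lambda>u v. A_inner \<Omega> V1 u v + V_form \<Omega> V2 u v"
  let ?GA = "galerkin_op \<Omega> X (A_inner \<Omega> V1)" and ?GQ = "galerkin_op \<Omega> X ?Q"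
  have right: "linear_functional_on X (b u)" if "sym_form X b" "u \<in> X" for b u
  proof -
    interpret sym_form X b by fact
    show ?thesis using that(2) by (auto simp: linear_functional_on_def add_right scale_right)
  qed
  have GA: "?GA u \<in> X" "v \<in> X \<Longrightarrow> L2_inner \<Omega> (?GA u) v = A_inner \<Omega> V1 u v" if "u \<in> X" for u v
    using galerkin_op_characterization[OF m B, of "A_inner \<Omega> V1", OF right[OF A.sym_form_axioms that]] by auto
  have GQ: "?GQ u \<in> X" "v \<in> X \<Longrightarrow> L2_inner \<Omega> (?GQ u) v = ?Q u v" if "u \<in> X" for u v
    using galerkin_op_characterization[OF m B, of ?Q, OF right[OF Q.sym_form_axioms that]] by auto
  have inj: "inj_on ?GA X"
  proof (rule inj_onI)
    fix u w assume uw: "u \<in> X" "w \<in> X" "?GA u = ?GA w"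
    have "A_inner \<Omega> V1 u z = A_inner \<Omega> V1 w z" if "z \<in> X" for z
      using GA(2)[OF uw(1) that] GA(2)[OF uw(2) that] uw(3) by simp
    then show "u = w" using A.eqI[OF uw(1,2)] by blast
  qed
  have surj: "w \<in> ?GA ` X" if w: "w \<in> X" for w
  proof -
    obtain z where z: "z \<in> X" "\<And>v. v \<in> X \<Longrightarrow> A_inner \<Omega> V1 z v = L2_inner \<Omega> w v"
      using A.Riesz_representation[OF B right[OF M.sym_form_axioms w]] by blast
    have "?GA z = w"
      using GA[OF z(1)] z(2) w by (intro M.eqI) auto
    then show ?thesis using z(1) by blast
  qed
  have \<mu>u: "\<mu> *\<^sub>R u \<in> X" using u A.subspace subspace_scale by blast
  have "precond_op \<Omega> V1 V2 X u = \<mu> *\<^sub>R u \<longleftrightarrow> ?GA (\<mu> *\<^sub>R u) = ?GQ u"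
  proof
    assume "precond_op \<Omega> V1 V2 X u = \<mu> *\<^sub>R u"
    then have "inv_into X ?GA (?GQ u) = \<mu> *\<^sub>R u" by (simp add: precond_op_def)
    then show "?GA (\<mu> *\<^sub>R u) = ?GQ u" using f_inv_into_f[OF surj[OF GQ(1)[OF u]]] by simp
  next
    assume "?GA (\<mu> *\<^sub>R u) = ?GQ u"
    then have "inv_into X ?GA (?GQ u) = \<mu> *\<^sub>R u" using inv_into_f_f[OF inj \<mu>u] by simp
    then show "precond_op \<Omega> V1 V2 X u = \<mu> *\<^sub>R u" by (simp add: precond_op_def)
  qed
  also have "\<dots> \<longleftrightarrow> (\<forall>w\<in>X. ?Q u w = \<mu> * A_inner \<Omega> V1 u w)"
  proof
    assume eq: "?GA (\<mu> *\<^sub>R u) = ?GQ u"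
    show "\<forall>w\<in>X. ?Q u w = \<mu> * A_inner \<Omega> V1 u w"
    proof
      fix w assume w: "w \<in> X"
      show "?Q u w = \<mu> * A_inner \<Omega> V1 u w"
        using GA(2)[OF \<mu>u w] GQ(2)[OF u w] eq A.scale_left[OF u w] by simp
    qed
  next
    assume eq: "\<forall>w\<in>X. ?Q u w = \<mu> * A_inner \<Omega> V1 u w"
    show "?GA (\<mu> *\<^sub>R u) = ?GQ u"
    proof (rule M.eqI[OF GA(1)[OF \<mu>u] GQ(1)[OF u]])
      fix w assume w: "w \<in> X"
      show "L2_inner \<Omega> (?GA (\<mu> *\<^sub>R u)) w = L2_inner \<Omega> (?GQ u) w"
        using GA(2)[OF \<mu>u w] GQ(2)[OF u w] eq A.scale_left[OF u w] w by simp
    qed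
  qed
  finally show ?thesis .
qed

lemma cube_lebesgue: "cube L \<in> sets lebesgue"
  by (simp add: cube_eq_cbox)

lemma UNIV_lebesgue: "UNIV \<in> sets lebesgue"
  by simp

lemma L2_inner_cube:
  assumes "u \<in> H1_0 (cube L)"
  shows "L2_inner (cube L) u v = L2_inner UNIV u v"
  unfolding L2_inner_def set_lebesgue_integral_def
proof (rule integral_cong_AE)
  show "AE x in lebesgue. indicator (cube L) x *\<^sub>R (ae_rep u x * ae_rep v x)
      = indicator UNIV x *\<^sub>R (ae_rep u x * ae_rep v x)"
    using H1_0_extension(3)[OF assms cube_lebesgue] by eventually_elim (auto simp: indicator_def)
qed (intro borel_measurable_scaleR borel_measurable_indicator cube_lebesgue borel_measurable_times
    ae_rep_measurable UNIV_lebesgue)+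

lemma V_form_cube:
  assumes "u \<in> H1_0 (cube L)" "V2 \<in> borel_measurable lebesgue"
  shows "V_form (cube L) V2 u v = V_form UNIV V2 u v"
  unfolding V_form_def set_lebesgue_integral_def
proof (rule integral_cong_AE)
  show "AE x in lebesgue. indicator (cube L) x *\<^sub>R (V2 x * ae_rep u x * ae_rep v x)
      = indicator UNIV x *\<^sub>R (V2 x * ae_rep u x * ae_rep v x)"
    using H1_0_extension(3)[OF assms(1) cube_lebesgue] by eventually_elim (auto simp: indicator_def)
qed (intro borel_measurable_scaleR borel_measurable_indicator cube_lebesgue borel_measurable_times
    ae_rep_measurable assms(2) UNIV_lebesgue)+

text \<open>The gradient chosen by \<open>weak_grad (cube L)\<close> is arbitrary outside the cube, where it may fail to be
  measurable; only its product with the indicator function can be used.\<close>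
lemma A_inner_cube:
  assumes u: "u \<in> H1_0 (cube L)" and v: "v \<in> H1_0 (cube L)" and V1: "V1 \<in> borel_measurable lebesgue"
  shows "A_inner (cube L) V1 u v = A_inner UNIV V1 u v"
proof -
  let ?g = "\<lambda>u x. indicator (cube L) x *\<^sub>R weak_grad (cube L) u x"
  let ?m = "\<lambda>x. V1 x * ae_rep u x * ae_rep v x"
  have H1: "u \<in> H1 (cube L)" "v \<in> H1 (cube L)" using u v by (auto simp: H1_0_def)
  then have g: "?g u \<in> borel_measurable lebesgue" "?g v \<in> borel_measurable lebesgue"
    by (intro square_integrable_measurable L2_on_extension; use H1_weak_grad in \<open>auto simp: is_weak_grad_def\<close>)+
  have m: "?m \<in> borel_measurable lebesgue"
    by (intro borel_measurable_times V1 ae_rep_measurable)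
  have G: "weak_grad UNIV w \<in> borel_measurable lebesgue" if "w \<in> H1_0 (cube L)" for w
    using H1_0_UNIV_test_approximable[OF H1_0_extension(1)[OF that cube_lebesgue]]
    by (intro square_integrable_measurable) (simp add: test_approximable_def)
  have "A_inner (cube L) V1 u v = (LINT x|lebesgue. ?g u x \<bullet> ?g v x + indicator (cube L) x *\<^sub>R ?m x)"
    unfolding A_inner_def set_lebesgue_integral_def
    by (intro Bochner_Integration.integral_cong refl) (simp add: indicator_def)
  also have "\<dots> = (LINT x|lebesgue. weak_grad UNIV u x \<bullet> weak_grad UNIV v x + ?m x)"
  proof (rule integral_cong_AE)
    show "(\<lambda>x. ?g u x \<bullet> ?g v x + indicator (cube L) x *\<^sub>R ?m x) \<in> borel_measurable lebesgue"
      by (intro borel_measurable_add borel_measurable_inner g borel_measurable_scaleR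
          borel_measurable_indicator cube_lebesgue m)
    show "(\<lambda>x. weak_grad UNIV u x \<bullet> weak_grad UNIV v x + ?m x) \<in> borel_measurable lebesgue"
      by (intro borel_measurable_add borel_measurable_inner G u v m)
    show "AE x in lebesgue. ?g u x \<bullet> ?g v x + indicator (cube L) x *\<^sub>R ?m x
        = weak_grad UNIV u x \<bullet> weak_grad UNIV v x + ?m x"
      using H1_0_extension(2)[OF u cube_lebesgue] H1_0_extension(2)[OF v cube_lebesgue]
        H1_0_extension(3)[OF u cube_lebesgue]
    proof eventually_elim
      case (elim x)
      then show ?case by (cases "x \<in> cube L") auto
    qed
  qed
  also have "\<dots> = A_inner UNIV V1 u v" by (simp add: A_inner_def set_lebesgue_integral_def)
  finally show ?thesis .
qed

lemma V_form_le:
  assumes "square_integrable lebesgue (ae_rep u)" "V2 \<in> borel_measurable lebesgue"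
    and "AE x in lebesgue. \<bar>V2 x\<bar> \<le> C"
  shows "\<bar>V_form UNIV V2 u u\<bar> \<le> C * (LINT x|lebesgue. (ae_rep u x)\<^sup>2)"
proof -
  note i = square_integrable_power2[OF assms(1)]
  have iV: "integrable lebesgue (\<lambda>x. V2 x * (ae_rep u x)\<^sup>2)"
    by (rule integrable_bounded_mult[OF i assms(2,3)])
  have "\<bar>LINT x|lebesgue. V2 x * (ae_rep u x)\<^sup>2\<bar> \<le> (LINT x|lebesgue. \<bar>V2 x * (ae_rep u x)\<^sup>2\<bar>)"
    by (rule integral_abs_bound)
  also have "\<dots> \<le> (LINT x|lebesgue. C * (ae_rep u x)\<^sup>2)"
  proof (rule integral_mono_AE)
    show "AE x in lebesgue. \<bar>V2 x * (ae_rep u x)\<^sup>2\<bar> \<le> C * (ae_rep u x)\<^sup>2"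
      using assms(3) by eventually_elim (auto simp: abs_mult intro!: mult_right_mono)
  qed (use i iV in auto)
  finally show ?thesis
    by (simp add: V_form_def set_lebesgue_integral_def power2_eq_square mult.assoc)
qed

context confining_potential
begin

lemma H1_0_cube_subset_form_domain:
  assumes "Linf_loc V1"
  shows "H1_0 (cube L) \<subseteq> W"
proof
  fix u :: "'d ae_fun" assume u: "u \<in> H1_0 (cube L)"
  note ext = H1_0_extension[OF u cube_lebesgue]
  have "compact (cube L :: (real^'d) set)" by (simp add: cube_eq_cbox)
  then obtain C where C: "AE x in lebesgue. x \<in> cube L \<longrightarrow> \<bar>V1 x\<bar> \<le> C"
    using assms unfolding Linf_loc_def by blast
  have "integrable lebesgue (\<lambda>x. V1 x * (ae_rep u x)\<^sup>2)"
  proof (rule Bochner_Integration.integrable_bound)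
    have "square_integrable lebesgue (ae_rep u)"
      using H1_0_UNIV_test_approximable[OF ext(1)] by (simp add: test_approximable_def)
    from square_integrable_power2[OF this]
    show "integrable lebesgue (\<lambda>x. C * (ae_rep u x)\<^sup>2)" by simp
    show "(\<lambda>x. V1 x * (ae_rep u x)\<^sup>2) \<in> borel_measurable lebesgue"
      by (intro borel_measurable_times borel_measurable_power V1_measurable ae_rep_measurable)
    show "AE x in lebesgue. norm (V1 x * (ae_rep u x)\<^sup>2) \<le> norm (C * (ae_rep u x)\<^sup>2)"
      using C ext(3)
    proof eventually_elim
      case (elim x)
      then show ?case by (cases "x \<in> cube L") (auto simp: abs_mult intro!: mult_right_mono)
    qed
  qed
  then show "u \<in> W" using ext(1) by (simp add: form_domain_def)
qed

lemma inner_form_L2: "inner_form W (L2_inner UNIV)"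
proof -
  have "0 < L2_inner UNIV u u" if u: "u \<in> W" "u \<noteq> 0" for u
  proof -
    have "(LINT x|lebesgue. (ae_rep u x)\<^sup>2) \<noteq> 0"
      using ae_fun_eq_zero[OF form_domain_L2(1)[OF u(1)]] u(2) by blast
    then have "0 < (LINT x|lebesgue. (ae_rep u x)\<^sup>2)"
      by (intro order.not_eq_order_implies_strict) auto
    then show ?thesis
      by (simp only: L2_inner_def set_lebesgue_integral_def power2_eq_square indicator_UNIV scaleR_one)
  qed
  then show ?thesis using sym_form_L2 by (simp add: inner_form_def inner_form_axioms_def)
qed

text \<open>All dependence on the domain and the mesh is moved into the space \<open>X\<close>; the forms are those of the
  whole space.\<close>
lemma conforming_pencil:
  assumes "Linf_loc V1" "Linf V2" "conforming_space (cube L) X"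
  obtains B where "X \<subseteq> W" "pencil X a (V_form UNIV V2) (precond_op (cube L) V1 V2 X) B"
proof -
  obtain B where B: "finite B" "X = span B" and XH: "X \<subseteq> H1_0 (cube L)"
    using assms(3) by (auto simp: conforming_space_def)
  have X: "subspace X" using B by simp
  have XW: "X \<subseteq> W" using XH H1_0_cube_subset_form_domain[OF assms(1)] by blast
  have V2: "V2 \<in> borel_measurable lebesgue" using assms(2) by (simp add: Linf_def)
  have eqA: "A_inner (cube L) V1 u v = a u v" and eqV: "V_form (cube L) V2 u v = V_form UNIV V2 u v"
    and eqL: "L2_inner (cube L) u v = L2_inner UNIV u v" if "u \<in> X" "v \<in> X" for u v
    using that XH A_inner_cube[OF _ _ V1_measurable] V_form_cube[OF _ V2] L2_inner_cube by blast+
  have A: "inner_form X a" by (rule inner_form_transfer[OF inner_form_A X XW]) simp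
  have V: "sym_form X (V_form UNIV V2)" by (rule sym_form_subset[OF sym_form_V[OF assms(2)] X XW])
  have A': "inner_form X (A_inner (cube L) V1)" by (rule inner_form_transfer[OF inner_form_A X XW eqA])
  have L': "inner_form X (L2_inner (cube L))" by (rule inner_form_transfer[OF inner_form_L2 X XW eqL])
  have V': "sym_form X (V_form (cube L) V2)"
  proof -
    interpret V: sym_form X "V_form UNIV V2" by (rule V)
    show ?thesis
    proof
      show "subspace X" by (rule X)
    qed (use subspace_add[OF X] subspace_scale[OF X] in
        \<open>auto simp: eqV V.add_left V.scale_left intro: V.commute\<close>)
  qed
  have "pencil X a (V_form UNIV V2) (precond_op (cube L) V1 V2 X) B"
  proof (intro pencil.intro pencil_axioms.intro A V B)
    show "precond_op (cube L) V1 V2 X u = \<mu> *\<^sub>R u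
        \<longleftrightarrow> (\<forall>w\<in>X. a u w + V_form UNIV V2 u w = \<mu> * a u w)" if "u \<in> X" for u \<mu>
      using precond_op_eigen_iff[OF L' A' V' B that] eqA[OF that] eqV[OF that] by simp
  qed
  then show ?thesis using that XW by blast
qed

lemma uniform_eigenvalue_count:
  assumes "Linf_loc V1" "Linf V2" "\<epsilon> > 0"
  shows "\<exists>M. \<forall>L X. conforming_space (cube L) X \<longrightarrow>
    finite (eigenvalues X (precond_op (cube L) V1 V2 X)) \<and>
    eigenvalue_count X (precond_op (cube L) V1 V2 X) (- {1 - \<epsilon><..<1 + \<epsilon>}) \<le> M"
proof -
  obtain C0 where V2: "V2 \<in> borel_measurable lebesgue" "AE x in lebesgue. \<bar>V2 x\<bar> \<le> C0"
    using assms(2) by (auto simp: Linf_def)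
  define C where "C = max C0 0"
  have C: "C \<ge> 0" "AE x in lebesgue. \<bar>V2 x\<bar> \<le> C"
    using V2(2) by (auto simp: C_def elim: eventually_mono)
  \<comment> \<open>Small enough for \<open>C \<delta> < \<epsilon>\<close>, also when \<open>C = 0\<close>.\<close>
  define \<delta> where "\<delta> = \<epsilon> / (2 * (C + 1))"
  have \<delta>: "\<delta> > 0" "C * \<delta> < \<epsilon>" using C(1) assms(3) by (auto simp: \<delta>_def field_simps add_nonneg_pos)
  obtain K :: "(int^'d) set" and l M where K: "finite K"
    "\<And>k. k \<in> K \<Longrightarrow> linear_functional_on W (l k)"
    "\<And>u. u \<in> W \<Longrightarrow> (LINT x|lebesgue. (ae_rep u x)\<^sup>2) \<le> \<delta> * a u u + (\<Sum>k\<in>K. (l k u)\<^sup>2)"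
    by (rule finite_rank_L2_bound[OF \<delta>(1)]) blast
  show ?thesis
  proof (intro exI[of _ "2 * card K"] allI impI)
    fix L and X :: "'d ae_fun set" assume conf: "conforming_space (cube L) X"
    obtain B where XW: "X \<subseteq> W" and "pencil X a (V_form UNIV V2) (precond_op (cube L) V1 V2 X) B"
      by (rule conforming_pencil[OF assms(1,2) conf])
    then interpret pencil X a "V_form UNIV V2" "precond_op (cube L) V1 V2 X" B by simp
    have "eigenvalue_count X (precond_op (cube L) V1 V2 X) (- {1 - \<epsilon><..<1 + \<epsilon>}) \<le> 2 * card K"
    proof (rule eigenvalue_count_le[OF K(1) _ _ assms(3)])
      show "linear_functional_on X (l k)" if "k \<in> K" for k
        using K(2)[OF that] XW unfolding linear_functional_on_def by blast
      fix u assume u: "u \<in> X" "u \<noteq> 0" "\<And>k. k \<in> K \<Longrightarrow> l k u = 0"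
      have uW: "u \<in> W" using u XW by blast
      have "\<bar>V_form UNIV V2 u u\<bar> \<le> C * (LINT x|lebesgue. (ae_rep u x)\<^sup>2)"
        by (rule V_form_le[OF form_domain_L2(1)[OF uW] V2(1) C(2)])
      also have "\<dots> \<le> C * (\<delta> * a u u)"
        using K(3)[OF uW] u(3) C(1) by (intro mult_left_mono) auto
      also have "\<dots> = (C * \<delta>) * a u u" by simp
      also have "\<dots> < \<epsilon> * a u u" using \<delta>(2) pos[OF u(1,2)] by (rule mult_strict_right_mono)
      finally show "\<bar>V_form UNIV V2 u u\<bar> < \<epsilon> * a u u" .
    qed
    then show "finite (eigenvalues X (precond_op (cube L) V1 V2 X)) \<and>
      eigenvalue_count X (precond_op (cube L) V1 V2 X) (- {1 - \<epsilon><..<1 + \<epsilon>}) \<le> 2 * card K"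
      using finite_eigenvalues by blast
  qed
qed

lemma schroedinger_positive_form:
  assumes "schroedinger_positive V1 V2" "Linf V2" "u \<in> W" "u \<noteq> 0"
  shows "0 < a u u + V_form UNIV V2 u u"
proof -
  have H: "u \<in> H1 UNIV" "integrable lebesgue (\<lambda>x. V1 x * (ae_rep u x)\<^sup>2)"
    using assms(3) by (auto simp: form_domain_def H1_0_def)
  have i1: "integrable lebesgue (\<lambda>x. (norm (weak_grad UNIV u x))\<^sup>2)"
    by (rule square_integrable_norm[OF form_domain_L2(2)[OF assms(3)]])
  obtain C where C: "V2 \<in> borel_measurable lebesgue" "AE x in lebesgue. \<bar>V2 x\<bar> \<le> C"
    using assms(2) by (auto simp: Linf_def)
  have i2: "integrable lebesgue (\<lambda>x. V2 x * (ae_rep u x)\<^sup>2)"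
    by (rule integrable_bounded_mult[OF square_integrable_power2[OF form_domain_L2(1)[OF assms(3)]] C])
  have "0 < (LINT x|lebesgue. (norm (weak_grad UNIV u x))\<^sup>2 + (V1 x + V2 x) * (ae_rep u x)\<^sup>2)"
    using assms(1,4) H unfolding schroedinger_positive_def by blast
  also have "\<dots> = (LINT x|lebesgue. ((norm (weak_grad UNIV u x))\<^sup>2 + V1 x * (ae_rep u x)\<^sup>2) + V2 x * (ae_rep u x)\<^sup>2)"
    by (simp add: distrib_right add.assoc)
  also have "\<dots> = sqnorm lebesgue (weak_grad UNIV u) + (LINT x|lebesgue. V1 x * (ae_rep u x)\<^sup>2)
      + (LINT x|lebesgue. V2 x * (ae_rep u x)\<^sup>2)"
    using i1 i2 H(2) by simp
  also have "\<dots> = a u u + V_form UNIV V2 u u"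
    unfolding A_inner_split[OF assms(3)]
    by (simp add: V_form_def set_lebesgue_integral_def power2_eq_square mult.assoc)
  finally show ?thesis .
qed

lemma uniform_condition_number:
  assumes "Linf_loc V1" "Linf V2" "schroedinger_positive V1 V2"
  shows "\<exists>\<kappa>. \<forall>L X. conforming_space (cube L) X \<longrightarrow> X \<noteq> {0} \<longrightarrow>
    mu_min X (precond_op (cube L) V1 V2 X) > 0 \<and> condition_number X (precond_op (cube L) V1 V2 X) \<le> \<kappa>"
proof -
  let ?v = "V_form UNIV V2"
  obtain C0 where V2: "V2 \<in> borel_measurable lebesgue" "AE x in lebesgue. \<bar>V2 x\<bar> \<le> C0"
    using assms(2) by (auto simp: Linf_def)
  define C where "C = max C0 0"
  have C: "C \<ge> 0" "AE x in lebesgue. \<bar>V2 x\<bar> \<le> C"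
    using V2(2) by (auto simp: C_def elim: eventually_mono)
  obtain P where P: "P \<ge> 0" "\<And>u. u \<in> W \<Longrightarrow> (LINT x|lebesgue. (ae_rep u x)\<^sup>2) \<le> P * a u u"
    by (rule Poincare) blast
  have vC: "\<bar>?v u u\<bar> \<le> C * (LINT x|lebesgue. (ae_rep u x)\<^sup>2)" if "u \<in> W" for u
    by (rule V_form_le[OF form_domain_L2(1)[OF that] V2(1) C(2)])
  have vP: "\<bar>?v u u\<bar> \<le> (C * P) * a u u" if u: "u \<in> W" for u
    using vC[OF u] mult_left_mono[OF P(2)[OF u] C(1)] by simp
  \<comment> \<open>With \<open>C \<delta> \<le> 1/2\<close>, half of the energy absorbs the error term of the compactness bound.\<close>
  define \<delta> where "\<delta> = 1 / (2 * (C + 1))"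
  have \<delta>: "\<delta> > 0" "C * \<delta> \<le> 1 / 2" using C(1) by (auto simp: \<delta>_def field_simps)
  obtain K :: "(int^'d) set" and l M where K: "finite K"
    "\<And>k. k \<in> K \<Longrightarrow> linear_functional_on W (l k)"
    "\<And>k u. k \<in> K \<Longrightarrow> u \<in> W \<Longrightarrow> (l k u)\<^sup>2 \<le> M * a u u"
    "\<And>u. u \<in> W \<Longrightarrow> (LINT x|lebesgue. (ae_rep u x)\<^sup>2) \<le> \<delta> * a u u + (\<Sum>k\<in>K. (l k u)\<^sup>2)"
    by (rule finite_rank_L2_bound[OF \<delta>(1)]) blast
  interpret A: inner_form W a by (rule inner_form_A)
  have "\<exists>c>0. \<forall>u\<in>W. c * a u u \<le> a u u + ?v u u"
  proof (rule positive_form_coercive[OF inner_form_A sym_form_V[OF assms(2)] vP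
        form_domain_complete schroedinger_positive_form[OF assms(3,2)] K(1,2,3)])
    show "a u u \<le> 2 * (a u u + ?v u u) + (2 * C) * (\<Sum>k\<in>K. (l k u)\<^sup>2)" if u: "u \<in> W" for u
    proof -
      have "\<bar>?v u u\<bar> \<le> C * (\<delta> * a u u + (\<Sum>k\<in>K. (l k u)\<^sup>2))"
        using vC[OF u] mult_left_mono[OF K(4)[OF u] C(1)] by linarith
      also have "\<dots> = (C * \<delta>) * a u u + C * (\<Sum>k\<in>K. (l k u)\<^sup>2)" by (simp add: distrib_left)
      also have "\<dots> \<le> (1 / 2) * a u u + C * (\<Sum>k\<in>K. (l k u)\<^sup>2)"
        using mult_right_mono[OF \<delta>(2) A.nonneg[OF u]] by simp
      finally show ?thesis by simp
    qed
  qed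
  then obtain c where c: "c > 0" "\<And>u. u \<in> W \<Longrightarrow> c * a u u \<le> a u u + ?v u u" by blast
  show ?thesis
  proof (intro exI[of _ "(1 + C * P) / c"] allI impI)
    fix L and X :: "'d ae_fun set" assume conf: "conforming_space (cube L) X" and X: "X \<noteq> {0}"
    obtain B where XW: "X \<subseteq> W" and "pencil X a ?v (precond_op (cube L) V1 V2 X) B"
      by (rule conforming_pencil[OF assms(1,2) conf])
    then interpret pencil X a ?v "precond_op (cube L) V1 V2 X" B by simp
    show "mu_min X (precond_op (cube L) V1 V2 X) > 0
        \<and> condition_number X (precond_op (cube L) V1 V2 X) \<le> (1 + C * P) / c"
    proof (rule condition_number_le[OF X c(1)])
      fix u assume "u \<in> X"
      then have u: "u \<in> W" using XW by blast
      show "c * a u u \<le> a u u + ?v u u" by (rule c(2)[OF u])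
      show "a u u + ?v u u \<le> (1 + C * P) * a u u" using vP[OF u] by (simp add: distrib_right)
    qed
  qed
qed

end

theorem theorem3p5:
  fixes V1 V2 :: "real^'d \<Rightarrow> real"
    and X :: "real \<Rightarrow> real \<Rightarrow> 'd ae_fun set"
  assumes V1_nonneg: "\<And>x. V1 x \<ge> 0"
    and V1_coercive: "filterlim V1 at_top at_infinity"
    and V1_Linf_loc: "Linf_loc V1"
    and V2_Linf: "Linf V2"
    and conforming: "\<And>L h. L > 0 \<Longrightarrow> h > 0 \<Longrightarrow> conforming_space (cube L) (X L h)"
  defines "T \<equiv> \<lambda>L h. precond_op (cube L) V1 V2 (X L h)"
  shows "(\<forall>\<epsilon>>0. \<exists>M::nat. \<forall>L>0. \<forall>h>0.
            finite (eigenvalues (X L h) (T L h)) \<and>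
            eigenvalue_count (X L h) (T L h) (- {1 - \<epsilon><..<1 + \<epsilon>}) \<le> M)
       \<and> (schroedinger_positive V1 V2 \<longrightarrow>
            (\<exists>C. \<forall>L>0. \<forall>h>0. X L h \<noteq> {0} \<longrightarrow>
               mu_min (X L h) (T L h) > 0 \<and> condition_number (X L h) (T L h) \<le> C))"
proof -
  interpret confining_potential V1
    using V1_nonneg V1_coercive V1_Linf_loc by unfold_locales (auto simp: Linf_loc_def)
  show ?thesis
  proof (intro conjI allI impI)
    fix \<epsilon> :: real assume "\<epsilon> > 0"
    then obtain M where M: "\<And>L X. conforming_space (cube L) X \<Longrightarrow>
        finite (eigenvalues X (precond_op (cube L) V1 V2 X)) \<and>
        eigenvalue_count X (precond_op (cube L) V1 V2 X) (- {1 - \<epsilon><..<1 + \<epsilon>}) \<le> M"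
      using uniform_eigenvalue_count[OF V1_Linf_loc V2_Linf] by blast
    then show "\<exists>M::nat. \<forall>L>0. \<forall>h>0. finite (eigenvalues (X L h) (T L h)) \<and>
            eigenvalue_count (X L h) (T L h) (- {1 - \<epsilon><..<1 + \<epsilon>}) \<le> M"
      unfolding T_def by (intro exI[of _ M] allI impI M conforming)
  next
    assume "schroedinger_positive V1 V2"
    then obtain \<kappa> where \<kappa>: "\<And>L X. conforming_space (cube L) X \<Longrightarrow> X \<noteq> {0} \<Longrightarrow>
        mu_min X (precond_op (cube L) V1 V2 X) > 0
        \<and> condition_number X (precond_op (cube L) V1 V2 X) \<le> \<kappa>"
      using uniform_condition_number[OF V1_Linf_loc V2_Linf] by blast
    then show "\<exists>C. \<forall>L>0. \<forall>h>0. X L h \<noteq> {0} \<longrightarrow>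
               mu_min (X L h) (T L h) > 0 \<and> condition_number (X L h) (T L h) \<le> C"
      unfolding T_def by (intro exI[of _ \<kappa>] allI impI \<kappa> conforming)
  qed
qed

end
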